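(* Let $\mathbb K$ be a commutative field, $\Gamma_0\neq\{I\}$ a subgroup of $GL(n,\mathbb K)$, $\delta:\Gamma_0\to\Gamma_0$, $M\mapsto M^{\delta}$, an endomorphism, and let $\Gamma$ be the group of all matrices $$g(u,v,M)=\begin{pmatrix}1&0&0\\ u&M&0\\ v&0&M^{\delta}\end{pmatrix},\qquad u,v\in\mathbb K^n,\ M\in\Gamma_0 .$$ Let $\Xi=T_B\Gamma_0'$ be the complex product of the groups $T_B=\{g(u,Bu,I);\ u\in\mathbb K^n\}$ with $B\in GL(n,\mathbb K)$ and $\Gamma_0'=\{g(0,0,M);\ M\in\Gamma_0\}$. Let $H=\{g(u,Au,I);\ u\in\mathbb K^n\}\le\Gamma$ with $A\in GL(n,\mathbb K)$. Assume that no element of the set $\{M^{-1}B^{-1}M^{\delta}A;\ M\in\Gamma_0\}$ has eigenvalue $1$. Then the following hold. (1) The mapping $\sigma:\Gamma/H\to\Gamma$ defined by $$g(0,v,M)H\mapsto g\big(M(BM-M^{\delta}A)^{-1}v,\ BM(BM-M^{\delta}A)^{-1}v,\ M\big)$$ is a sharply transitive section with image $\Xi$. (2) The loop $L_{\Xi}$ corresponding to $\sigma$ is isomorphic to the semidirect product $\mathbb K^n\rtimes\Gamma_0$ of the normal subgroup $\mathbb K^n$ by the group $\Gamma_0$ under the multiplication defined by $$(u_1,M_1)\ast(u_2,M_2)=(u_1+u_2^{\psi},M_1M_2)$$ for all $u_i\in\mathbb K^n$, $M_i\in\Gamma_0$, where $\psi$ is the invertible linear map $$x\mapsto[B-(M_1M_2)^{\delta}A(M_1M_2)^{-1}]^{-1}[M_1^{\delta}(B-M_2^{\delta}AM_2^{-1})]\,x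 .$$ (3) The loop $L_{\Xi}$ is a group if and only if $\{M^{-1}B^{-1}M^{\delta};\ M\in\Gamma_0\}=\{B^{-1}\}$. This is equivalent to the condition that $T_B$ is a normal subgroup of $\Gamma$. (4) Let $\Delta'$ be the semidirect product of the group $T_B'$, which is the minimal normal subgroup of $\Gamma$ containing $T_B$, by the group $\Gamma_0'$. If in $\Gamma_0$ there is an element $M_0$ such that the matrix $M_0^{-1}B^{-1}M_0^{\delta}B$ has no eigenvalue $1$, then $T_B'=\{g(u,v,I);\ u,v\in\mathbb K^n\}$ and $\Delta'=\Gamma$. (5) Let $\Theta$ be the maximal normal subgroup of $\Gamma$ contained in $H$. Then $\Theta$ consists of the matrices $g(v,Av,I)$, $v\in V$, where $V$ is the maximal subspace of $\mathbb K^n$ for which $M^{\delta}v=(AMA^{-1})v$ holds for all $v\in V$ and $M\in\Gamma_0$. The group $\Delta$ generated by the set $\Xi$ of left translations is the factor group $\Delta'/(\Theta\cap\Delta')$. The stabilizer of the identity of $L_{\Xi}$ is the group $H/(\Theta\cap\Delta')$. (6) No loop $L_{\Xi}$ satisfies the left inverse as well as the right inverse property. (7) If $\mathbb K$ is a topological field, then any loop $L_{\Xi}$ is a topological loop. For real or complex numbers any loop $L_{\Xi}$ is analytic.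
   Context: A loop is a set $L$ with a binary operation $\cdot$ and an element $e$ with $e\cdot x=x\cdot e=x$ for all $x$, such that $a\cdot y=b$ and $x\cdot a=b$ have precisely one solution, denoted $y=a\backslash b$ and $x=b/a$. The left translation by $a$ is $\lambda_a:y\mapsto a\cdot y$. A loop $L$ is a semidirect product of $H_1$ by $K_1$ if $H_1,K_1$ are subloops, $H_1$ is a normal subloop, $L=H_1K_1$ and $H_1\cap K_1=\{e\}$. A loop has the left inverse property, respectively the right inverse property, if the identity $x^{-1}(xy)=y$, respectively $(yx)x^{-1}=y$, holds for all $x,y$, where $x^{-1}$ denotes the inverse of $x$. For a group $G$ and a subgroup $H$, a sharply transitive section is a section $\sigma:G/H\to G$ (that is, $\sigma(xH)\in xH$ for all $x\in G$) with $\sigma(H)=1$, such that the subset $\sigma(G/H)$ generates $G$ and acts sharply transitively on $G/H=\{xH;\ x\in G\}$ (for all cosets $aH,bH$ there is exactly one $s\in\sigma(G/H)$ with $s\,aH=bH$). The corresponding loop is $G/H$ with $xH\ast yH=\sigma(xH)\,yH$, or equivalently $\sigma(G/H)$ with $x\ast y=\sigma(xyH)$; its left translations are given by the action of the elements of $\sigma(G/H)$ on $G/H$. $\mathbb K^n$ is the $n$-dimensional space of column vectors and $I$ is the identity matrix. The complex product of two subgroups is the set of all products of an element of the first with an element of the second. A topological loop is a loop on a topological space for which the maps $(x,y)\mapsto x\cdot y$, $(x,y)\mapsto x\backslash y$ and $(x,y)\mapsto y/x$ are continuous; analytic loops are defined likewise with analytic maps on an analytic manifold.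
   Formalization: (1) σ generates Γ only iff Δ'=Γ; (3) "only if" needs Θ∩Δ'=1, in general: T_BΘ normal; (5) Θ is given by Av∈V, not v∈V, and the stabilizer is (H∩Δ')/(Θ∩Δ'); (6) only for L_Ξ not a group; (7) analytic for each Lie structure on Γ₀ making M, M^δ analytic. *)

theory Defs
  imports
    "HOL-Analysis.Analysis"
    "HOL-Algebra.Left_Coset"
    "HOL-Algebra.Generated_Groups"
    "HOL-Algebra.Bij"
begin

section \<open>Loops\<close>

text \<open>Loops are carried by the record type of monoids, so that \<^const>\<open>iso\<close>, \<^const>\<open>group\<close>
  and the products of subsets of HOL-Algebra apply to them directly.\<close>

definition loop :: "('a, 'b) monoid_scheme \<Rightarrow> bool" where
  "loop L \<longleftrightarrow>
     \<one>\<^bsub>L\<^esub> \<in> carrier L \<and>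
     (\<forall>x\<in>carrier L. \<forall>y\<in>carrier L. x \<otimes>\<^bsub>L\<^esub> y \<in> carrier L) \<and>
     (\<forall>x\<in>carrier L. \<one>\<^bsub>L\<^esub> \<otimes>\<^bsub>L\<^esub> x = x \<and> x \<otimes>\<^bsub>L\<^esub> \<one>\<^bsub>L\<^esub> = x) \<and>
     (\<forall>a\<in>carrier L. \<forall>b\<in>carrier L.
        (\<exists>!y. y \<in> carrier L \<and> a \<otimes>\<^bsub>L\<^esub> y = b) \<and> (\<exists>!x. x \<in> carrier L \<and> x \<otimes>\<^bsub>L\<^esub> a = b))"

definition ldiv :: "('a, 'b) monoid_scheme \<Rightarrow> 'a \<Rightarrow> 'a \<Rightarrow> 'a" where
  "ldiv L a b = (THE y. y \<in> carrier L \<and> a \<otimes>\<^bsub>L\<^esub> y = b)"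

definition rdiv :: "('a, 'b) monoid_scheme \<Rightarrow> 'a \<Rightarrow> 'a \<Rightarrow> 'a" where
  "rdiv L b a = (THE x. x \<in> carrier L \<and> x \<otimes>\<^bsub>L\<^esub> a = b)"

definition subloop :: "'a set \<Rightarrow> ('a, 'b) monoid_scheme \<Rightarrow> bool" where
  "subloop S L \<longleftrightarrow> S \<subseteq> carrier L \<and> loop (L\<lparr>carrier := S\<rparr>)"

definition normal_subloop :: "'a set \<Rightarrow> ('a, 'b) monoid_scheme \<Rightarrow> bool" where
  "normal_subloop N L \<longleftrightarrow>
     subloop N L \<and>
     (\<forall>x\<in>carrier L. x <#\<^bsub>L\<^esub> N = N #>\<^bsub>L\<^esub> x) \<and>
     (\<forall>x\<in>carrier L. \<forall>y\<in>carrier L.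
        (x <#\<^bsub>L\<^esub> N) #>\<^bsub>L\<^esub> y = x <#\<^bsub>L\<^esub> (N #>\<^bsub>L\<^esub> y) \<and>
        x <#\<^bsub>L\<^esub> (y <#\<^bsub>L\<^esub> N) = (x \<otimes>\<^bsub>L\<^esub> y) <#\<^bsub>L\<^esub> N)"

definition semidirect :: "('a, 'b) monoid_scheme \<Rightarrow> 'a set \<Rightarrow> 'a set \<Rightarrow> bool" where
  "semidirect L N K \<longleftrightarrow>
     loop L \<and> normal_subloop N L \<and> subloop K L \<and>
     carrier L = N <#>\<^bsub>L\<^esub> K \<and> N \<inter> K = {\<one>\<^bsub>L\<^esub>}"

definition left_inverse_property :: "('a, 'b) monoid_scheme \<Rightarrow> bool" where
  "left_inverse_property L \<longleftrightarrow>
     (\<forall>x\<in>carrier L. \<exists>x'\<in>carrier L. x' \<otimes>\<^bsub>L\<^esub> x = \<one>\<^bsub>L\<^esub> \<and> x \<otimes>\<^bsub>L\<^esub> x' = \<one>\<^bsub>L\<^esub> \<and>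
        (\<forall>y\<in>carrier L. x' \<otimes>\<^bsub>L\<^esub> (x \<otimes>\<^bsub>L\<^esub> y) = y))"

definition right_inverse_property :: "('a, 'b) monoid_scheme \<Rightarrow> bool" where
  "right_inverse_property L \<longleftrightarrow>
     (\<forall>x\<in>carrier L. \<exists>x'\<in>carrier L. x' \<otimes>\<^bsub>L\<^esub> x = \<one>\<^bsub>L\<^esub> \<and> x \<otimes>\<^bsub>L\<^esub> x' = \<one>\<^bsub>L\<^esub> \<and>
        (\<forall>y\<in>carrier L. (y \<otimes>\<^bsub>L\<^esub> x) \<otimes>\<^bsub>L\<^esub> x' = y))"

text \<open>The group generated by the left translations, as a subset of the symmetric group.\<close>

definition left_translations :: "('a, 'b) monoid_scheme \<Rightarrow> ('a \<Rightarrow> 'a) set" where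
  "left_translations L = (\<lambda>a. \<lambda>y\<in>carrier L. a \<otimes>\<^bsub>L\<^esub> y) ` carrier L"

definition left_mult_group :: "('a, 'b) monoid_scheme \<Rightarrow> ('a \<Rightarrow> 'a) set" where
  "left_mult_group L = generate (BijGroup (carrier L)) (left_translations L)"

section \<open>Sections of coset spaces\<close>

text \<open>\<open>transitive_section\<close> omits the condition that the image generates \<open>G\<close>,
  which can fail for the section studied here: if $T_B$ is normal, the image is a proper subgroup.\<close>

definition transitive_section ::
  "('a, 'b) monoid_scheme \<Rightarrow> 'a set \<Rightarrow> ('a set \<Rightarrow> 'a) \<Rightarrow> bool" where
  "transitive_section G H s \<longleftrightarrow>
     group G \<and> subgroup H G \<and>
     (\<forall>X\<in>lcosets\<^bsub>G\<^esub> H. s X \<in> X) \<and> s H = \<one>\<^bsub>G\<^esub> \<and>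
     (\<forall>X\<in>lcosets\<^bsub>G\<^esub> H. \<forall>Y\<in>lcosets\<^bsub>G\<^esub> H.
        \<exists>!t. t \<in> s ` (lcosets\<^bsub>G\<^esub> H) \<and> t <#\<^bsub>G\<^esub> X = Y)"

definition sharply_transitive_section ::
  "('a, 'b) monoid_scheme \<Rightarrow> 'a set \<Rightarrow> ('a set \<Rightarrow> 'a) \<Rightarrow> bool" where
  "sharply_transitive_section G H s \<longleftrightarrow>
     transitive_section G H s \<and> generate G (s ` (lcosets\<^bsub>G\<^esub> H)) = carrier G"

definition section_loop ::
  "('a, 'b) monoid_scheme \<Rightarrow> 'a set \<Rightarrow> ('a set \<Rightarrow> 'a) \<Rightarrow> 'a set monoid" where
  "section_loop G H s =
     \<lparr>carrier = lcosets\<^bsub>G\<^esub> H, mult = (\<lambda>X Y. s X <#\<^bsub>G\<^esub> Y), one = H\<rparr>"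

definition normal_closure :: "('a, 'b) monoid_scheme \<Rightarrow> 'a set \<Rightarrow> 'a set" where
  "normal_closure G S = \<Inter>{N. N \<lhd> G \<and> S \<subseteq> N}"

definition normal_core :: "('a, 'b) monoid_scheme \<Rightarrow> 'a set \<Rightarrow> 'a set" where
  "normal_core G H = \<Union>{N. N \<lhd> G \<and> N \<subseteq> H}"

section \<open>The matrix groups\<close>

definition has_eigenvalue :: "'k::field^'n^'n \<Rightarrow> 'k \<Rightarrow> bool" where
  "has_eigenvalue M c \<longleftrightarrow> (\<exists>v. v \<noteq> 0 \<and> M *v v = c *s v)"

definition GL :: "('k::field^'n^'n) monoid" where
  "GL = \<lparr>carrier = {M. invertible M}, mult = (**), one = mat 1\<rparr>"

text \<open>Rows and columns are indexed by the disjoint sum of a one-element type and two copies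
  of the index type of $K^n$, in this order.\<close>

definition gmat ::
  "('k::field^'n^'n \<Rightarrow> 'k^'n^'n) \<Rightarrow> 'k^'n \<Rightarrow> 'k^'n \<Rightarrow> 'k^'n^'n \<Rightarrow>
   'k^(unit + ('n + 'n))^(unit + ('n + 'n))" where
  "gmat \<delta> u v M = (\<chi> i j.
     case i of
       Inl _ \<Rightarrow> (case j of Inl _ \<Rightarrow> 1 | Inr _ \<Rightarrow> 0)
     | Inr (Inl a) \<Rightarrow> (case j of Inl _ \<Rightarrow> u $ a | Inr (Inl b) \<Rightarrow> M $ a $ b | Inr (Inr _) \<Rightarrow> 0)
     | Inr (Inr a) \<Rightarrow> (case j of Inl _ \<Rightarrow> v $ a | Inr (Inl _) \<Rightarrow> 0 | Inr (Inr b) \<Rightarrow> \<delta> M $ a $ b))"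

definition Gam ::
  "('k::field^'n^'n) set \<Rightarrow> ('k^'n^'n \<Rightarrow> 'k^'n^'n) \<Rightarrow>
   ('k^(unit + ('n + 'n))^(unit + ('n + 'n))) monoid" where
  "Gam \<Gamma>0 \<delta> = GL\<lparr>carrier := {gmat \<delta> u v M | u v M. M \<in> \<Gamma>0}\<rparr>"

text \<open>Both $T_B$ and $H$ are of the form \<open>graph_group \<delta> C\<close>, for \<open>C = B\<close> and \<open>C = A\<close>.\<close>

definition graph_group ::
  "('k::field^'n^'n \<Rightarrow> 'k^'n^'n) \<Rightarrow> 'k^'n^'n \<Rightarrow> ('k^(unit + ('n + 'n))^(unit + ('n + 'n))) set" where
  "graph_group \<delta> C = {gmat \<delta> u (C *v u) (mat 1) | u. True}"

definition Gam0' ::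
  "('k::field^'n^'n) set \<Rightarrow> ('k^'n^'n \<Rightarrow> 'k^'n^'n) \<Rightarrow>
   ('k^(unit + ('n + 'n))^(unit + ('n + 'n))) set" where
  "Gam0' \<Gamma>0 \<delta> = {gmat \<delta> 0 0 M | M. M \<in> \<Gamma>0}"

definition loop_data ::
  "('k::field^'n^'n) set \<Rightarrow> ('k^'n^'n \<Rightarrow> 'k^'n^'n) \<Rightarrow> 'k^'n^'n \<Rightarrow> 'k^'n^'n \<Rightarrow> bool" where
  "loop_data \<Gamma>0 \<delta> A B \<longleftrightarrow>
     subgroup \<Gamma>0 GL \<and> \<Gamma>0 \<noteq> {mat 1} \<and>
     \<delta> \<in> hom (GL\<lparr>carrier := \<Gamma>0\<rparr>) (GL\<lparr>carrier := \<Gamma>0\<rparr>) \<and>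
     invertible A \<and> invertible B \<and>
     (\<forall>M\<in>\<Gamma>0. \<not> has_eigenvalue (matrix_inv M ** matrix_inv B ** \<delta> M ** A) 1)"

definition sigma_value ::
  "('k::field^'n^'n \<Rightarrow> 'k^'n^'n) \<Rightarrow> 'k^'n^'n \<Rightarrow> 'k^'n^'n \<Rightarrow> 'k^'n \<Rightarrow> 'k^'n^'n \<Rightarrow>
   'k^(unit + ('n + 'n))^(unit + ('n + 'n))" where
  "sigma_value \<delta> A B v M =
     gmat \<delta> ((M ** matrix_inv (B ** M - \<delta> M ** A)) *v v)
            ((B ** M ** matrix_inv (B ** M - \<delta> M ** A)) *v v) M"

text \<open>The description operator makes this total; that the value depends only on the coset, and
  that every coset is of the form below, is part of what has to be proved.\<close>

definition sigma ::
  "('k::field^'n^'n) set \<Rightarrow> ('k^'n^'n \<Rightarrow> 'k^'n^'n) \<Rightarrow> 'k^'n^'n \<Rightarrow> 'k^'n^'n \<Rightarrow>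
   ('k^(unit + ('n + 'n))^(unit + ('n + 'n))) set \<Rightarrow> 'k^(unit + ('n + 'n))^(unit + ('n + 'n))" where
  "sigma \<Gamma>0 \<delta> A B X =
     (THE z. \<exists>v. \<exists>M\<in>\<Gamma>0. X = gmat \<delta> 0 v M <#\<^bsub>Gam \<Gamma>0 \<delta>\<^esub> graph_group \<delta> A \<and> z = sigma_value \<delta> A B v M)"

definition L_Xi ::
  "('k::field^'n^'n) set \<Rightarrow> ('k^'n^'n \<Rightarrow> 'k^'n^'n) \<Rightarrow> 'k^'n^'n \<Rightarrow> 'k^'n^'n \<Rightarrow>
   ('k^(unit + ('n + 'n))^(unit + ('n + 'n))) set monoid" where
  "L_Xi \<Gamma>0 \<delta> A B = section_loop (Gam \<Gamma>0 \<delta>) (graph_group \<delta> A) (sigma \<Gamma>0 \<delta> A B)"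

definition psi ::
  "('k::field^'n^'n \<Rightarrow> 'k^'n^'n) \<Rightarrow> 'k^'n^'n \<Rightarrow> 'k^'n^'n \<Rightarrow> 'k^'n^'n \<Rightarrow> 'k^'n^'n \<Rightarrow> 'k^'n^'n" where
  "psi \<delta> A B M1 M2 =
     matrix_inv (B - \<delta> (M1 ** M2) ** A ** matrix_inv (M1 ** M2)) **
     (\<delta> M1 ** (B - \<delta> M2 ** A ** matrix_inv M2))"

definition twisted_product ::
  "('k::field^'n^'n) set \<Rightarrow> ('k^'n^'n \<Rightarrow> 'k^'n^'n) \<Rightarrow> 'k^'n^'n \<Rightarrow> 'k^'n^'n \<Rightarrow>
   (('k^'n) \<times> ('k^'n^'n)) monoid" where
  "twisted_product \<Gamma>0 \<delta> A B =
     \<lparr>carrier = UNIV \<times> \<Gamma>0,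
      mult = (\<lambda>(u1, M1) (u2, M2). (u1 + psi \<delta> A B M1 M2 *v u2, M1 ** M2)),
      one = (0, mat 1)\<rparr>"

definition additive_group :: "('a::ab_group_add) monoid" where
  "additive_group = \<lparr>carrier = UNIV, mult = (+), one = 0\<rparr>"

definition greatest_subspace :: "('k::field^'n \<Rightarrow> bool) \<Rightarrow> ('k^'n) set \<Rightarrow> bool" where
  "greatest_subspace P V \<longleftrightarrow>
     vec.subspace V \<and> (\<forall>v\<in>V. P v) \<and>
     (\<forall>W. vec.subspace W \<and> (\<forall>v\<in>W. P v) \<longrightarrow> W \<subseteq> V)"

section \<open>Topological loops\<close>

text \<open>An explicit topology is used in place of a type class, since the field is topological only
  in one of the claims.\<close>

definition topological_field :: "('k::field) topology \<Rightarrow> bool" where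
  "topological_field T \<longleftrightarrow>
     topspace T = UNIV \<and>
     continuous_map (prod_topology T T) T (\<lambda>(x, y). x + y) \<and>
     continuous_map T T uminus \<and>
     continuous_map (prod_topology T T) T (\<lambda>(x, y). x * y) \<and>
     continuous_map (subtopology T (UNIV - {0})) T inverse"

definition topological_loop :: "('a, 'b) monoid_scheme \<Rightarrow> 'a topology \<Rightarrow> bool" where
  "topological_loop L X \<longleftrightarrow>
     loop L \<and> topspace X = carrier L \<and>
     continuous_map (prod_topology X X) X (\<lambda>(x, y). x \<otimes>\<^bsub>L\<^esub> y) \<and>
     continuous_map (prod_topology X X) X (\<lambda>(x, y). ldiv L x y) \<and>
     continuous_map (prod_topology X X) X (\<lambda>(x, y). rdiv L y x)"

definition matrix_topology :: "'k topology \<Rightarrow> ('k^'m^'l) topology" where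
  "matrix_topology T =
     pullback_topology UNIV (\<lambda>M (i, j). M $ i $ j) (product_topology (\<lambda>_. T) UNIV)"

definition quotient_topology :: "'a topology \<Rightarrow> ('a \<Rightarrow> 'b) \<Rightarrow> 'b topology" where
  "quotient_topology X q =
     topology (\<lambda>U. U \<subseteq> q ` topspace X \<and> openin X {x \<in> topspace X. q x \<in> U})"

definition coset_topology ::
  "'k topology \<Rightarrow> ('k::field^'n^'n) set \<Rightarrow> ('k^'n^'n \<Rightarrow> 'k^'n^'n) \<Rightarrow> 'k^'n^'n \<Rightarrow>
   ('k^(unit + ('n + 'n))^(unit + ('n + 'n))) set topology" where
  "coset_topology T \<Gamma>0 \<delta> A =
     quotient_topology (subtopology (matrix_topology T) (carrier (Gam \<Gamma>0 \<delta>)))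
       (\<lambda>x. x <#\<^bsub>Gam \<Gamma>0 \<delta>\<^esub> graph_group \<delta> A)"

section \<open>Analytic loops\<close>

text \<open>The coordinate space over the scalar field \<open>'f\<close> with finite coordinate set \<open>I\<close> is the set
  of functions \<open>I \<rightarrow>\<^sub>E UNIV\<close>; the coordinate set may be empty (dimension 0). A function is analytic
  on \<open>W\<close> if \<open>W\<close> is open and the function has around every point of \<open>W\<close> an unconditionally
  convergent power series expansion, the multi-indices being the elements of \<open>I \<rightarrow>\<^sub>E UNIV\<close>.\<close>

definition coord_space :: "'i set \<Rightarrow> ('i \<Rightarrow> 'f::topological_space) topology" where
  "coord_space I = product_topology (\<lambda>_. euclidean) I"

definition analytic_fun ::
  "'i set \<Rightarrow> ('i \<Rightarrow> 'f::real_normed_field) set \<Rightarrow> (('i \<Rightarrow> 'f) \<Rightarrow> 'f) \<Rightarrow> bool" where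
  "analytic_fun I W f \<longleftrightarrow>
     W \<subseteq> I \<rightarrow>\<^sub>E UNIV \<and>
     (\<forall>a\<in>W. \<exists>r>0. \<exists>c :: ('i \<Rightarrow> nat) \<Rightarrow> 'f.
        \<forall>x \<in> I \<rightarrow>\<^sub>E UNIV. (\<forall>i\<in>I. norm (x i - a i) < r) \<longrightarrow>
          x \<in> W \<and> ((\<lambda>\<alpha>. c \<alpha> * (\<Prod>i\<in>I. (x i - a i) ^ \<alpha> i)) has_sum f x) (I \<rightarrow>\<^sub>E UNIV))"

type_synonym ('p, 'i, 'f) atlas = "('p set \<times> ('p \<Rightarrow> 'i \<Rightarrow> 'f)) set"

definition analytic_manifold ::
  "'p topology \<Rightarrow> 'i set \<Rightarrow> ('p, 'i, 'f::real_normed_field) atlas \<Rightarrow> bool" where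
  "analytic_manifold X I \<A> \<longleftrightarrow>
     finite I \<and> Hausdorff_space X \<and> \<Union>(fst ` \<A>) = topspace X \<and>
     (\<forall>(U, \<phi>)\<in>\<A>. openin X U \<and>
        (\<exists>W. openin (coord_space I) W \<and>
             homeomorphic_map (subtopology X U) (subtopology (coord_space I) W) \<phi>)) \<and>
     (\<forall>(U, \<phi>)\<in>\<A>. \<forall>(V, \<psi>)\<in>\<A>. \<forall>i\<in>I.
        analytic_fun I (\<phi> ` (U \<inter> V)) (\<lambda>z. \<psi> (the_inv_into U \<phi> z) i))"

definition analytic_map ::
  "'p topology \<Rightarrow> 'i set \<Rightarrow> ('p, 'i, 'f::real_normed_field) atlas \<Rightarrow>
   'q topology \<Rightarrow> 'j set \<Rightarrow> ('q, 'j, 'f) atlas \<Rightarrow> ('p \<Rightarrow> 'q) \<Rightarrow> bool" where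
  "analytic_map X I \<A> Y J \<B> f \<longleftrightarrow>
     continuous_map X Y f \<and>
     (\<forall>(U, \<phi>)\<in>\<A>. \<forall>(V, \<psi>)\<in>\<B>. \<forall>j\<in>J.
        analytic_fun I (\<phi> ` {x \<in> U. f x \<in> V}) (\<lambda>z. \<psi> (f (the_inv_into U \<phi> z)) j))"

definition prod_atlas ::
  "('p, 'i, 'f) atlas \<Rightarrow> ('q, 'j, 'f) atlas \<Rightarrow> ('p \<times> 'q, 'i + 'j, 'f) atlas" where
  "prod_atlas \<A> \<B> =
     {(U \<times> V, \<lambda>(x, y). case_sum (\<phi> x) (\<psi> y)) | U \<phi> V \<psi>. (U, \<phi>) \<in> \<A> \<and> (V, \<psi>) \<in> \<B>}"

definition pullback_atlas :: "'q set \<Rightarrow> ('q \<Rightarrow> 'p) \<Rightarrow> ('p, 'i, 'f) atlas \<Rightarrow> ('q, 'i, 'f) atlas" where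
  "pullback_atlas S h \<A> = {({x \<in> S. h x \<in> U}, \<lambda>x. \<phi> (h x)) | U \<phi>. (U, \<phi>) \<in> \<A>}"

definition analytic_loop ::
  "('a, 'b) monoid_scheme \<Rightarrow> 'a topology \<Rightarrow> 'i set \<Rightarrow> ('a, 'i, 'f::real_normed_field) atlas \<Rightarrow> bool" where
  "analytic_loop L X I \<A> \<longleftrightarrow>
     loop L \<and> topspace X = carrier L \<and> analytic_manifold X I \<A> \<and>
     analytic_map (prod_topology X X) (I <+> I) (prod_atlas \<A> \<A>) X I \<A> (\<lambda>(x, y). x \<otimes>\<^bsub>L\<^esub> y) \<and>
     analytic_map (prod_topology X X) (I <+> I) (prod_atlas \<A> \<A>) X I \<A> (\<lambda>(x, y). ldiv L x y) \<and>
     analytic_map (prod_topology X X) (I <+> I) (prod_atlas \<A> \<A>) X I \<A> (\<lambda>(x, y). rdiv L y x)"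

text \<open>Coordinates \<open>C\<close> of the matrix field over the scalar field of the manifold: the field over
  itself, or the complex numbers over the reals. They give the standard charts on vectors and
  matrices.\<close>

definition self_coord :: "'k \<Rightarrow> unit \<Rightarrow> 'k" where
  "self_coord x = (\<lambda>_. x)"

definition Re_Im_coord :: "complex \<Rightarrow> bool \<Rightarrow> real" where
  "Re_Im_coord z = (\<lambda>b. if b then Im z else Re z)"

definition vector_atlas :: "('k \<Rightarrow> 'c \<Rightarrow> 'f) \<Rightarrow> ('k^'n, 'n \<times> 'c, 'f) atlas" where
  "vector_atlas C = {(UNIV, \<lambda>v (i, c). C (v $ i) c)}"

definition matrix_atlas :: "('k \<Rightarrow> 'c \<Rightarrow> 'f) \<Rightarrow> ('k^'m^'l, 'l \<times> 'm \<times> 'c, 'f) atlas" where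
  "matrix_atlas C = {(UNIV, \<lambda>M (i, j, c). C (M $ i $ j) c)}"

text \<open>A Lie group structure on the matrix group \<open>\<Gamma>0\<close> for which the matrix entries of \<open>M\<close> and of
  \<open>\<delta> M\<close> are analytic functions of \<open>M\<close>, i.e. for which \<open>Gam \<Gamma>0 \<delta>\<close> is a Lie group of matrices.
  For a group, analyticity of the product and of both divisions means that it is a Lie group.
  The structure need not be second countable, and its topology may be finer than the one induced
  from the space of matrices.\<close>

definition matrix_Lie_structure ::
  "('k::real_normed_field \<Rightarrow> 'c \<Rightarrow> 'f::real_normed_field) \<Rightarrow> ('k^'n^'n) set \<Rightarrow>
   ('k^'n^'n \<Rightarrow> 'k^'n^'n) \<Rightarrow> ('k^'n^'n) topology \<Rightarrow> 'i set \<Rightarrow> ('k^'n^'n, 'i, 'f) atlas \<Rightarrow> bool" where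
  "matrix_Lie_structure C \<Gamma>0 \<delta> X I \<A> \<longleftrightarrow>
     analytic_loop (GL\<lparr>carrier := \<Gamma>0\<rparr>) X I \<A> \<and>
     analytic_map X I \<A> euclidean UNIV (matrix_atlas C) (\<lambda>M. M) \<and>
     analytic_map X I \<A> euclidean UNIV (matrix_atlas C) \<delta>"

text \<open>The homogeneous space $\Gamma/H$ is identified with the product of $K^n$ and \<open>\<Gamma>0\<close> by means of
  the representatives $g(0,v,M)$ of the cosets, and carries the product manifold structure.\<close>

definition coset_coords ::
  "('k::field^'n^'n) set \<Rightarrow> ('k^'n^'n \<Rightarrow> 'k^'n^'n) \<Rightarrow> 'k^'n^'n \<Rightarrow>
   ('k^(unit + ('n + 'n))^(unit + ('n + 'n))) set \<Rightarrow> ('k^'n) \<times> ('k^'n^'n)" where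
  "coset_coords \<Gamma>0 \<delta> A =
     the_inv_into (UNIV \<times> \<Gamma>0) (\<lambda>(v, M). gmat \<delta> 0 v M <#\<^bsub>Gam \<Gamma>0 \<delta>\<^esub> graph_group \<delta> A)"

definition coset_manifold_topology ::
  "('k::real_normed_field^'n^'n) set \<Rightarrow> ('k^'n^'n \<Rightarrow> 'k^'n^'n) \<Rightarrow> 'k^'n^'n \<Rightarrow>
   ('k^'n^'n) topology \<Rightarrow> ('k^(unit + ('n + 'n))^(unit + ('n + 'n))) set topology" where
  "coset_manifold_topology \<Gamma>0 \<delta> A X =
     pullback_topology (lcosets\<^bsub>Gam \<Gamma>0 \<delta>\<^esub> (graph_group \<delta> A)) (coset_coords \<Gamma>0 \<delta> A)
       (prod_topology euclidean X)"

definition coset_atlas ::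
  "('k::real_normed_field \<Rightarrow> 'c \<Rightarrow> 'f::real_normed_field) \<Rightarrow> ('k^'n^'n) set \<Rightarrow>
   ('k^'n^'n \<Rightarrow> 'k^'n^'n) \<Rightarrow> 'k^'n^'n \<Rightarrow> ('k^'n^'n, 'i, 'f) atlas \<Rightarrow>
   (('k^(unit + ('n + 'n))^(unit + ('n + 'n))) set, 'n \<times> 'c + 'i, 'f) atlas" where
  "coset_atlas C \<Gamma>0 \<delta> A \<A> =
     pullback_atlas (lcosets\<^bsub>Gam \<Gamma>0 \<delta>\<^esub> (graph_group \<delta> A)) (coset_coords \<Gamma>0 \<delta> A)
       (prod_atlas (vector_atlas C) \<A>)"

definition analytic_L_Xi ::
  "('k::real_normed_field \<Rightarrow> 'c \<Rightarrow> 'f::real_normed_field) \<Rightarrow> ('k^'n^'n) set \<Rightarrow>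
   ('k^'n^'n \<Rightarrow> 'k^'n^'n) \<Rightarrow> 'k^'n^'n \<Rightarrow> 'k^'n^'n \<Rightarrow>
   ('k^'n^'n) topology \<Rightarrow> 'i set \<Rightarrow> ('k^'n^'n, 'i, 'f) atlas \<Rightarrow> bool" where
  "analytic_L_Xi C \<Gamma>0 \<delta> A B X I \<A> \<longleftrightarrow>
     analytic_loop (L_Xi \<Gamma>0 \<delta> A B) (coset_manifold_topology \<Gamma>0 \<delta> A X) (UNIV <+> I)
       (coset_atlas C \<Gamma>0 \<delta> A \<A>)"

end

theory Submission
  imports Defs
begin

text \<open>Write the coset of \<open>g(0,w,M)\<close> as \<open>q(w,M)\<close> and put \<open>C(M) = B - M\<^sup>\<delta> A M\<^sup>-\<^sup>1\<close>, which is invertible by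
  the eigenvalue condition. Since \<open>g(u,Bu,N)\<close> maps \<open>q(w,M)\<close> to \<open>q(C(NM)u + N\<^sup>\<delta> w, NM)\<close>, the section is sharply
  transitive, and in the coordinates \<open>(w,M)\<close> the product is
  \<open>(w1,M1)(w2,M2) = (C(M1M2) C(M1)\<^sup>-\<^sup>1 w1 + M1\<^sup>\<delta> w2, M1M2)\<close>; the substitution \<open>w = C(M)u\<close> gives the form in (2).
  Associativity, the left inverse property and the right inverse property each force
  \<open>\<psi>(N,M) = \<psi>(N,1)\<close> for all \<open>N\<close>, \<open>M\<close>, which is also sufficient for associativity. Unfolding \<open>\<psi>\<close>, this says
  that \<open>C(1)\<^sup>-\<^sup>1(BM - M\<^sup>\<delta> B)x\<close> always lies in the space that defines \<open>\<Theta>\<close>, i.e. that \<open>T\<^sub>B \<Theta>\<close> is normal.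
  The three loop operations are rational in the entries of \<open>w\<close>, \<open>M\<close> and \<open>M\<^sup>\<delta>\<close>, so they are continuous,
  respectively analytic, by Cramer's rule.\<close>

section \<open>Invertible matrices over a field\<close>

text \<open>The loop sees \<Gamma> only through its action on the cosets of \<open>H\<close>, whose
  kernel is \<Theta>. If \<open>H\<close> is normal, for instance, the loop is the factor group by
  \<open>H\<close> for every admissible \<open>B\<close>, whether or not \<open>TB\<close> is
  normal. Associativity can therefore reveal properties of \<open>B\<close> only modulo \<Theta>.
  This fixes the form of the claims: the equivalence with normality of \<open>TB\<close> is stated
  when \<Theta> meets \<Delta>' trivially, the general criterion involves the product of
  \<open>TB\<close> and \<Theta>, and the inverse properties are denied to loops that are not
  groups. Likewise \<Xi> generates only \<Delta>', so a section that also generates is obtained over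
  \<Delta>', and the stabilizer comes from the part of \<open>H\<close> inside \<Delta>'. In the
  analytic case \<open>\<Gamma>0\<close> is any subgroup and \<delta> any endomorphism, so a Lie
  structure making the entries of \<open>M\<close> and \<open>\<delta> M\<close> analytic is a
  datum. Its charts need not be given by matrix entries; hence the vector part and the matrix part
  of a product need different arguments.\<close>

lemma matrix_inv_right:
  assumes "invertible (M :: 'k::field^'n^'n)"
  shows "M ** matrix_inv M = mat 1"
  using assms unfolding invertible_def matrix_inv_def by (rule someI2_ex) simp

lemma matrix_inv_left:
  assumes "invertible (M :: 'k::field^'n^'n)"
  shows "matrix_inv M ** M = mat 1"
  using matrix_inv_right[OF assms] by (simp add: matrix_left_right_inverse)

lemma matrix_inv_unique:
  fixes M N :: "'k::field^'n^'n"
  assumes "M ** N = mat 1"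
  shows "matrix_inv M = N"
proof -
  have "invertible M" using assms invertible_right_inverse by blast
  then have "matrix_inv M ** M = mat 1" by (rule matrix_inv_left)
  then show ?thesis by (metis assms matrix_mul_assoc matrix_mul_lid matrix_mul_rid)
qed

lemma matrix_inv_vector:
  assumes "invertible (M :: 'k::field^'n^'n)"
  shows "matrix_inv M *v (M *v x) = x" "M *v (matrix_inv M *v x) = x"
  using assms by (simp_all add: matrix_vector_mul_assoc matrix_inv_left matrix_inv_right)

lemma invertible_matrix_inv: "invertible (M :: 'k::field^'n^'n) \<Longrightarrow> invertible (matrix_inv M)"
  using matrix_inv_left invertible_right_inverse by blast

lemma matrix_inv_mult:
  fixes M N :: "'k::field^'n^'n"
  assumes "invertible M" "invertible N"
  shows "matrix_inv (M ** N) = matrix_inv N ** matrix_inv M"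
  by (rule matrix_inv_unique)
    (metis assms matrix_inv_right matrix_mul_assoc matrix_mul_rid)

lemma matrix_inv_mat_1: "matrix_inv (mat 1 :: 'k::field^'n^'n) = mat 1"
  by (rule matrix_inv_unique) simp

lemma invertible_mat_1: "invertible (mat 1 :: 'k::field^'n^'n)"
  unfolding invertible_def by (metis matrix_mul_lid)

lemma invertible_ker:
  "invertible (M :: 'k::field^'n^'n) \<longleftrightarrow> (\<forall>x. M *v x = 0 \<longrightarrow> x = 0)"
  by (simp add: invertible_left_inverse matrix_left_invertible_ker)

lemma invertible_vector_cancel:
  "invertible (M :: 'k::field^'n^'n) \<Longrightarrow> M *v x = M *v y \<longleftrightarrow> x = y"
  by (metis matrix_inv_vector(1))

lemma matrix_vector_mult_uminus: "M *v (- x) = - (M *v (x :: 'k::field^'n))"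
  using matrix_vector_mult_diff_distrib[of M 0 x] by simp

text \<open>A kernel vector of \<open>N ** M - P ** Q\<close> is fixed by the product in
  \<open>ne\<close>, hence an eigenvector for 1. The four matrices are kept free because the
  standing condition (with \<open>\<delta> M ** A\<close>) and the extra condition that makes
  \<Delta>' all of \<Gamma> (with \<open>\<delta> M0 ** B\<close>) both have this shape.\<close>

lemma not_eigenvalue_1_invertible:
  fixes M N P Q :: "'k::field^'n^'n"
  assumes inv: "invertible M" "invertible N"
    and ne: "\<not> has_eigenvalue (matrix_inv M ** matrix_inv N ** P ** Q) 1"
  shows "invertible (N ** M - P ** Q)"
  unfolding invertible_ker
proof (intro allI impI)
  fix x assume "(N ** M - P ** Q) *v x = 0"
  then have "P *v (Q *v x) = N *v (M *v x)"
    by (simp add: matrix_vector_mult_diff_rdistrib matrix_vector_mul_assoc)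
  then have "(matrix_inv M ** matrix_inv N ** P ** Q) *v x = x"
    by (simp add: matrix_vector_mul_assoc[symmetric] matrix_inv_vector inv)
  then show "x = 0" using ne unfolding has_eigenvalue_def by (metis vector_smult_lid)
qed

section \<open>The matrix group\<close>

lemma sum_UNIV_Plus:
  fixes f :: "'a::finite + 'b::finite \<Rightarrow> 'c::comm_monoid_add"
  shows "sum f UNIV = (\<Sum>a\<in>UNIV. f (Inl a)) + (\<Sum>b\<in>UNIV. f (Inr b))"
  using sum.Plus[of UNIV UNIV f] by (simp add: UNIV_Plus_UNIV o_def)

lemma sum_UNIV_unit: "(\<Sum>i\<in>UNIV. f (i::unit)) = f ()"
  by (simp add: UNIV_unit)

lemma gmat_entries:
  "gmat \<delta> u v M $ Inl i $ Inl j = 1"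
  "gmat \<delta> u v M $ Inl i $ Inr b = 0"
  "gmat \<delta> u v M $ Inr (Inl a) $ Inl j = u $ a"
  "gmat \<delta> u v M $ Inr (Inl a) $ Inr (Inl c) = M $ a $ c"
  "gmat \<delta> u v M $ Inr (Inl a) $ Inr (Inr d) = 0"
  "gmat \<delta> u v M $ Inr (Inr e) $ Inl j = v $ e"
  "gmat \<delta> u v M $ Inr (Inr e) $ Inr (Inl c) = 0"
  "gmat \<delta> u v M $ Inr (Inr e) $ Inr (Inr d) = \<delta> M $ e $ d"
  by (simp_all add: gmat_def)

text \<open>Blockwise multiplication, where \<delta> enters only in the lower right block.
  Multiplicativity is asked of this one pair, because \<delta> is a homomorphism on
  \<open>\<Gamma>0\<close> alone.\<close>

lemma gmat_mult:
  fixes u v :: "'k::field^'n"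
  assumes "\<delta> (M ** N) = \<delta> M ** \<delta> N"
  shows "gmat \<delta> u v M ** gmat \<delta> u' v' N = gmat \<delta> (u + M *v u') (v + \<delta> M *v v') (M ** N)"
proof -
  have "(gmat \<delta> u v M ** gmat \<delta> u' v' N) $ i $ j =
      gmat \<delta> (u + M *v u') (v + \<delta> M *v v') (M ** N) $ i $ j" for i j
    apply (cases i; cases j)
       apply (auto simp: matrix_matrix_mult_def sum_UNIV_Plus sum_UNIV_unit gmat_entries split: sum.splits)
    subgoal for b by (cases b) (auto simp: gmat_entries matrix_vector_mult_def)
    subgoal for b c by (cases b; cases c) (auto simp: gmat_entries matrix_matrix_mult_def assms[unfolded matrix_matrix_mult_def])
    done
  then show ?thesis by (simp add: vec_eq_iff)
qed

lemma gmat_eq_iff: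
  "gmat \<delta> u v M = gmat \<delta> u' v' M' \<longleftrightarrow> u = u' \<and> v = v' \<and> M = M'"
proof
  assume eq: "gmat \<delta> u v M = gmat \<delta> u' v' M'"
  have "u $ a = u' $ a" "v $ a = v' $ a" "M $ a $ b = M' $ a $ b" for a b
    using arg_cong[OF eq, of "\<lambda>X. X $ Inr (Inl a) $ Inl ()"]
      arg_cong[OF eq, of "\<lambda>X. X $ Inr (Inr a) $ Inl ()"]
      arg_cong[OF eq, of "\<lambda>X. X $ Inr (Inl a) $ Inr (Inl b)"] by (simp_all add: gmat_entries)
  then show "u = u' \<and> v = v' \<and> M = M'" by (simp add: vec_eq_iff)
qed simp

lemma gmat_one:
  assumes "\<delta> (mat 1) = mat 1"
  shows "gmat \<delta> 0 0 (mat 1) = mat 1"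
proof -
  have "gmat \<delta> 0 0 (mat 1) $ i $ j = (mat 1 :: 'a^(unit + ('b + 'b))^(unit + ('b + 'b))) $ i $ j" for i j
    using assms by (auto simp: gmat_def mat_def split: sum.splits)
  then show ?thesis by (simp add: vec_eq_iff)
qed

lemma GL_simps: "carrier GL = {M. invertible M}" "x \<otimes>\<^bsub>GL\<^esub> y = x ** y" "\<one>\<^bsub>GL\<^esub> = mat 1"
  by (simp_all add: GL_def)

lemma group_GL: "group (GL :: ('k::field^'n^'n) monoid)"
proof (rule groupI)
  fix x :: "'k^'n^'n" assume "x \<in> carrier GL"
  then show "\<exists>y\<in>carrier GL. y \<otimes>\<^bsub>GL\<^esub> x = \<one>\<^bsub>GL\<^esub>"
    by (intro bexI[of _ "matrix_inv x"]) (auto simp: GL_simps matrix_inv_left invertible_matrix_inv)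
qed (auto simp: GL_simps matrix_mul_assoc invertible_mult invertible_mat_1)

lemma GL_inv: "x \<in> carrier GL \<Longrightarrow> inv\<^bsub>GL\<^esub> x = matrix_inv x"
  by (rule group.inv_equality[OF group_GL])
    (auto simp: GL_simps matrix_inv_left invertible_matrix_inv)

locale loop_setup =
  fixes \<Gamma>0 :: "('k::field^'n^'n) set" and \<delta> :: "'k^'n^'n \<Rightarrow> 'k^'n^'n" and A B :: "'k^'n^'n"
  assumes data: "loop_data \<Gamma>0 \<delta> A B"
begin

abbreviation "\<Gamma> \<equiv> Gam \<Gamma>0 \<delta>"
abbreviation "H \<equiv> graph_group \<delta> A"
abbreviation "TB \<equiv> graph_group \<delta> B"

lemma subgroup_\<Gamma>0: "subgroup \<Gamma>0 GL"
  and A_inv: "invertible A" and B_inv: "invertible B"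
  and \<delta>_hom: "\<delta> \<in> hom (GL\<lparr>carrier := \<Gamma>0\<rparr>) (GL\<lparr>carrier := \<Gamma>0\<rparr>)"
  using data by (auto simp: loop_data_def)

lemma \<Gamma>0_one [simp]: "mat 1 \<in> \<Gamma>0"
  using subgroup.one_closed[OF subgroup_\<Gamma>0] by (simp add: GL_simps)

lemma \<Gamma>0_mult [simp]: "M \<in> \<Gamma>0 \<Longrightarrow> N \<in> \<Gamma>0 \<Longrightarrow> M ** N \<in> \<Gamma>0"
  using subgroup.m_closed[OF subgroup_\<Gamma>0] by (simp add: GL_simps)

lemma \<Gamma>0_invertible [simp]: "M \<in> \<Gamma>0 \<Longrightarrow> invertible M"
  using subgroup.subset[OF subgroup_\<Gamma>0] by (auto simp: GL_simps)

lemma \<Gamma>0_inv [simp]: "M \<in> \<Gamma>0 \<Longrightarrow> matrix_inv M \<in> \<Gamma>0"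
  using subgroup.m_inv_closed[OF subgroup_\<Gamma>0, of M] by (simp add: GL_inv GL_simps)

lemma \<delta>_closed [simp]: "M \<in> \<Gamma>0 \<Longrightarrow> \<delta> M \<in> \<Gamma>0"
  using \<delta>_hom by (auto simp: hom_def GL_simps)

lemma \<delta>_mult [simp]: "M \<in> \<Gamma>0 \<Longrightarrow> N \<in> \<Gamma>0 \<Longrightarrow> \<delta> (M ** N) = \<delta> M ** \<delta> N"
  using \<delta>_hom by (auto simp: hom_def GL_simps)

lemma mult_cancel_\<Gamma>0:
  assumes "M \<in> \<Gamma>0"
  shows "matrix_inv M ** M = mat 1" "M ** matrix_inv M = mat 1"
    "matrix_inv M ** (M ** N) = N" "M ** (matrix_inv M ** N) = N"
    "N ** matrix_inv M ** M = N" "N ** M ** matrix_inv M = N"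
    "matrix_inv M *v (M *v x) = x" "M *v (matrix_inv M *v x) = x"
  using assms by (simp_all add: matrix_inv_left matrix_inv_right matrix_mul_assoc matrix_inv_vector
      flip: matrix_mul_assoc[of N])

lemma \<delta>_one [simp]: "\<delta> (mat 1) = mat 1"
  using \<delta>_mult[OF \<Gamma>0_one \<Gamma>0_one] mult_cancel_\<Gamma>0(3)[OF \<delta>_closed[OF \<Gamma>0_one], of "\<delta> (mat 1)"]
  by (simp add: mult_cancel_\<Gamma>0)

lemma \<delta>_inv [simp]: "M \<in> \<Gamma>0 \<Longrightarrow> \<delta> (matrix_inv M) = matrix_inv (\<delta> M)"
  by (rule matrix_inv_unique[symmetric]) (simp add: mult_cancel_\<Gamma>0 flip: \<delta>_mult)

lemma \<Gamma>_simps: "carrier \<Gamma> = {gmat \<delta> u v M | u v M. M \<in> \<Gamma>0}"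
  "x \<otimes>\<^bsub>\<Gamma>\<^esub> y = x ** y" "\<one>\<^bsub>\<Gamma>\<^esub> = mat 1"
  by (simp_all add: Gam_def GL_simps)

lemma gmat_mult' [simp]:
  "M \<in> \<Gamma>0 \<Longrightarrow> N \<in> \<Gamma>0 \<Longrightarrow>
    gmat \<delta> u v M ** gmat \<delta> u' v' N = gmat \<delta> (u + M *v u') (v + \<delta> M *v v') (M ** N)"
  by (rule gmat_mult) simp

lemma \<Gamma>_one: "\<one>\<^bsub>\<Gamma>\<^esub> = gmat \<delta> 0 0 (mat 1)"
  by (simp add: \<Gamma>_simps gmat_one)

lemma gmat_carrier [simp]: "gmat \<delta> u v M \<in> carrier \<Gamma> \<longleftrightarrow> M \<in> \<Gamma>0"
  by (auto simp: \<Gamma>_simps gmat_eq_iff)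

lemma \<Gamma>_cases [elim?]:
  assumes "x \<in> carrier \<Gamma>"
  obtains u v M where "x = gmat \<delta> u v M" "M \<in> \<Gamma>0"
  using assms by (auto simp: \<Gamma>_simps)

lemma group_\<Gamma>: "group \<Gamma>"
proof (rule groupI)
  fix x assume "x \<in> carrier \<Gamma>"
  then obtain u v M where x: "x = gmat \<delta> u v M" "M \<in> \<Gamma>0" by (rule \<Gamma>_cases)
  show "\<exists>y\<in>carrier \<Gamma>. y \<otimes>\<^bsub>\<Gamma>\<^esub> x = \<one>\<^bsub>\<Gamma>\<^esub>"
    by (intro bexI[of _ "gmat \<delta> (- (matrix_inv M *v u)) (- (matrix_inv (\<delta> M) *v v)) (matrix_inv M)"])
      (simp_all add: x \<Gamma>_one \<Gamma>_simps(2) mult_cancel_\<Gamma>0)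
next
  fix x y assume "x \<in> carrier \<Gamma>" "y \<in> carrier \<Gamma>"
  then show "x \<otimes>\<^bsub>\<Gamma>\<^esub> y \<in> carrier \<Gamma>" by (auto elim!: \<Gamma>_cases simp: \<Gamma>_simps(2))
next
  show "\<one>\<^bsub>\<Gamma>\<^esub> \<in> carrier \<Gamma>" by (simp add: \<Gamma>_one)
qed (auto simp: \<Gamma>_simps matrix_mul_assoc)

sublocale \<Gamma>: group \<Gamma> by (rule group_\<Gamma>)

lemma gmat_inv: "M \<in> \<Gamma>0 \<Longrightarrow>
  inv\<^bsub>\<Gamma>\<^esub> (gmat \<delta> u v M) = gmat \<delta> (- (matrix_inv M *v u)) (- (matrix_inv (\<delta> M) *v v)) (matrix_inv M)"
  by (rule \<Gamma>.inv_equality) (simp_all add: \<Gamma>_one \<Gamma>_simps(2) mult_cancel_\<Gamma>0)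

text \<open>Translations \<open>gmat \<delta> a b (mat 1)\<close> commute with each other, so
  conjugation acts on them through \<open>M\<close> only.\<close>

lemma gmat_conj:
  assumes "M \<in> \<Gamma>0"
  shows "gmat \<delta> u v M \<otimes>\<^bsub>\<Gamma>\<^esub> gmat \<delta> a b (mat 1) \<otimes>\<^bsub>\<Gamma>\<^esub> inv\<^bsub>\<Gamma>\<^esub> (gmat \<delta> u v M) =
    gmat \<delta> (M *v a) (\<delta> M *v b) (mat 1)"
  using assms
  by (simp add: gmat_inv \<Gamma>_simps(2) mult_cancel_\<Gamma>0 matrix_vector_mult_uminus)

section \<open>Subgroups and normal subgroups consisting of translations\<close>

text \<open>Sets of translations are described by a predicate on pairs of vectors, which turns this
  and the next criterion into closure conditions on pairs. The form covers the graph groups,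
  \<open>TB'\<close>, \<Theta> and the product of \<open>TB\<close> and \<Theta>.\<close>

lemma translation_subgroup_iff:
  "subgroup {gmat \<delta> a b (mat 1) | a b. P a b} \<Gamma> \<longleftrightarrow>
    P 0 0 \<and> (\<forall>a b c d. P a b \<longrightarrow> P c d \<longrightarrow> P (a - c) (b - d))"
  (is "subgroup ?S \<Gamma> \<longleftrightarrow> ?P")
proof
  assume "subgroup ?S \<Gamma>"
  then interpret S: subgroup ?S \<Gamma> .
  have "P (a - c) (b - d)" if "P a b" "P c d" for a b c d
  proof -
    have "gmat \<delta> a b (mat 1) \<otimes>\<^bsub>\<Gamma>\<^esub> inv\<^bsub>\<Gamma>\<^esub> (gmat \<delta> c d (mat 1)) \<in> ?S"
      using that by (intro S.m_closed S.m_inv_closed) auto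
    then show ?thesis
      by (simp add: gmat_inv gmat_eq_iff \<Gamma>_simps(2) matrix_inv_mat_1)
  qed
  moreover have "P 0 0" using S.one_closed by (simp add: \<Gamma>_one gmat_eq_iff)
  ultimately show ?P by blast
next
  assume P: ?P
  show "subgroup ?S \<Gamma>"
  proof (rule \<Gamma>.subgroupI)
    fix x assume "x \<in> ?S"
    then obtain a b where "x = gmat \<delta> a b (mat 1)" "P a b" by blast
    then show "inv\<^bsub>\<Gamma>\<^esub> x \<in> ?S"
      using P[THEN conjunct2, rule_format, of 0 0 a b] P
      by (simp add: gmat_inv gmat_eq_iff matrix_inv_mat_1)
  next
    fix x y assume "x \<in> ?S" "y \<in> ?S"
    then obtain a b c d where xy: "x = gmat \<delta> a b (mat 1)" "P a b" "y = gmat \<delta> c d (mat 1)" "P c d"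
      by blast
    have "P (- c) (- d)" using P[THEN conjunct2, rule_format, of 0 0 c d] P xy by simp
    then have "P (a + c) (b + d)" using P[THEN conjunct2, rule_format, of a b "- c" "- d"] xy by simp
    then show "x \<otimes>\<^bsub>\<Gamma>\<^esub> y \<in> ?S" by (simp add: xy gmat_eq_iff \<Gamma>_simps(2))
  qed (use P in auto)
qed

lemma translation_normal_iff:
  "{gmat \<delta> a b (mat 1) | a b. P a b} \<lhd> \<Gamma> \<longleftrightarrow>
    P 0 0 \<and> (\<forall>a b c d. P a b \<longrightarrow> P c d \<longrightarrow> P (a - c) (b - d)) \<and>
    (\<forall>M\<in>\<Gamma>0. \<forall>a b. P a b \<longrightarrow> P (M *v a) (\<delta> M *v b))"
  (is "?S \<lhd> \<Gamma> \<longleftrightarrow> _")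
proof -
  have "(\<forall>x\<in>carrier \<Gamma>. \<forall>h\<in>?S. x \<otimes>\<^bsub>\<Gamma>\<^esub> h \<otimes>\<^bsub>\<Gamma>\<^esub> inv\<^bsub>\<Gamma>\<^esub> x \<in> ?S) \<longleftrightarrow>
    (\<forall>M\<in>\<Gamma>0. \<forall>a b. P a b \<longrightarrow> P (M *v a) (\<delta> M *v b))" (is "?L \<longleftrightarrow> ?R")
  proof
    assume L: ?L
    show ?R
    proof (intro ballI allI impI)
      fix M a b assume "M \<in> \<Gamma>0" "P a b"
      then show "P (M *v a) (\<delta> M *v b)"
        using L[rule_format, of "gmat \<delta> 0 0 M" "gmat \<delta> a b (mat 1)"]
        by (auto simp: gmat_conj gmat_eq_iff)
    qed
  next
    assume R: ?R
    show ?L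
    proof (intro ballI)
      fix x h assume "x \<in> carrier \<Gamma>" "h \<in> ?S"
      moreover from this obtain a b u v M where "h = gmat \<delta> a b (mat 1)" "P a b"
        "x = gmat \<delta> u v M" "M \<in> \<Gamma>0" by (auto elim!: \<Gamma>_cases)
      ultimately show "x \<otimes>\<^bsub>\<Gamma>\<^esub> h \<otimes>\<^bsub>\<Gamma>\<^esub> inv\<^bsub>\<Gamma>\<^esub> x \<in> ?S" using R by (simp add: gmat_conj gmat_eq_iff)
    qed
  qed
  then show ?thesis by (simp add: \<Gamma>.normal_inv_iff translation_subgroup_iff)
qed

lemma graph_group_alt: "graph_group \<delta> D = {gmat \<delta> a b (mat 1) | a b. b = D *v a}"
  by (auto simp: graph_group_def)

lemma subgroup_graph_group: "subgroup (graph_group \<delta> D) \<Gamma>"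
  unfolding graph_group_alt translation_subgroup_iff by (simp add: matrix_vector_mult_diff_distrib)

lemma graph_group_normal_iff:
  "graph_group \<delta> D \<lhd> \<Gamma> \<longleftrightarrow> (\<forall>M\<in>\<Gamma>0. \<forall>x. \<delta> M *v (D *v x) = D *v (M *v x))"
  unfolding graph_group_alt translation_normal_iff by (auto simp: matrix_vector_mult_diff_distrib)

section \<open>The coset space\<close>

text \<open>Conjugating \<open>H\<close> by \<open>gmat \<delta> 0 0 M\<close> gives the graph group
  of \<open>\<delta> M ** A ** matrix_inv M\<close>. So the kernel of \<open>C M\<close> describes
  the intersection of \<open>TB\<close> with this conjugate, and invertibility for all
  \<open>M\<close> says that \<open>TB\<close> meets every conjugate of \<open>H\<close>
  trivially.\<close>

definition C :: "'k^'n^'n \<Rightarrow> 'k^'n^'n" where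
  "C M = B - \<delta> M ** A ** matrix_inv M"

definition q where
  "q p = gmat \<delta> 0 (fst p) (snd p) <#\<^bsub>\<Gamma>\<^esub> H"

lemma BM_inv: "M \<in> \<Gamma>0 \<Longrightarrow> invertible (B ** M - \<delta> M ** A)"
  using data unfolding loop_data_def by (auto intro!: not_eigenvalue_1_invertible)

lemma matrix_diff_mult: "(X - Y) ** Z = X ** Z - Y ** (Z :: 'k^'n^'n)"
  by (simp add: matrix_eq matrix_vector_mult_diff_rdistrib flip: matrix_vector_mul_assoc)

lemma C_mult: "M \<in> \<Gamma>0 \<Longrightarrow> C M ** M = B ** M - \<delta> M ** A"
  by (simp add: C_def matrix_diff_mult mult_cancel_\<Gamma>0)

lemma C_vector: "M \<in> \<Gamma>0 \<Longrightarrow> C M *v (M *v x) = B *v (M *v x) - \<delta> M *v (A *v x)"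
  by (simp add: C_mult matrix_vector_mul_assoc matrix_vector_mult_diff_rdistrib)

lemma C_vector': "C M *v x = B *v x - \<delta> M *v (A *v (matrix_inv M *v x))"
  by (simp add: C_def matrix_vector_mul_assoc matrix_mul_assoc matrix_vector_mult_diff_rdistrib)

lemma C_invertible [simp]: "M \<in> \<Gamma>0 \<Longrightarrow> invertible (C M)"
proof -
  assume M: "M \<in> \<Gamma>0"
  have "C M = (B ** M - \<delta> M ** A) ** matrix_inv M"
    using M by (simp add: mult_cancel_\<Gamma>0 flip: C_mult)
  then show ?thesis using M by (simp add: BM_inv invertible_mult)
qed

lemma C_cancel:
  assumes "M \<in> \<Gamma>0"
  shows "matrix_inv (C M) *v (C M *v x) = x" "C M *v (matrix_inv (C M) *v x) = x"
  using assms by (simp_all add: matrix_inv_vector)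

text \<open>The vector in the formula for the section thus becomes
  \<open>matrix_inv (C M) *v v\<close>: the one \<open>u\<close> for which
  \<open>gmat \<delta> u (B *v u) M\<close> carries the base coset to
  \<open>q (v, M)\<close>.\<close>

lemma M_inv_BM:
  assumes "M \<in> \<Gamma>0"
  shows "M ** matrix_inv (B ** M - \<delta> M ** A) = matrix_inv (C M)"
  using assms by (simp add: matrix_inv_mult mult_cancel_\<Gamma>0 flip: C_mult)

lemma B_M_inv_BM:
  assumes "M \<in> \<Gamma>0"
  shows "B ** M ** matrix_inv (B ** M - \<delta> M ** A) = B ** matrix_inv (C M)"
  using M_inv_BM[OF assms] by (simp flip: matrix_mul_assoc)

lemma gmat_lcoset:
  assumes "M \<in> \<Gamma>0"
  shows "gmat \<delta> u v M <#\<^bsub>\<Gamma>\<^esub> H = {gmat \<delta> (u + M *v x) (v + \<delta> M *v (A *v x)) M | x. True}"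
  using assms by (auto simp: l_coset_def graph_group_def \<Gamma>_simps(2) gmat_eq_iff)

text \<open>Right multiplication by the element of \<open>H\<close> with parameter
  \<open>- (matrix_inv M *v u)\<close> clears the first vector and changes the second one as
  displayed.\<close>

lemma gmat_lcoset_q:
  assumes "M \<in> \<Gamma>0"
  shows "gmat \<delta> u v M <#\<^bsub>\<Gamma>\<^esub> H = q (v - \<delta> M *v (A *v (matrix_inv M *v u)), M)"
proof -
  let ?w = "v - \<delta> M *v (A *v (matrix_inv M *v u))"
  have "(\<exists>x. g = gmat \<delta> (u + M *v x) (v + \<delta> M *v (A *v x)) M) \<longleftrightarrow>
      (\<exists>y. g = gmat \<delta> (0 + M *v y) (?w + \<delta> M *v (A *v y)) M)" for g
  proof (intro iffI; elim exE)
    fix x assume "g = gmat \<delta> (u + M *v x) (v + \<delta> M *v (A *v x)) M"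
    then show "\<exists>y. g = gmat \<delta> (0 + M *v y) (?w + \<delta> M *v (A *v y)) M"
      using assms by (intro exI[of _ "x + matrix_inv M *v u"])
        (simp add: matrix_vector_right_distrib mult_cancel_\<Gamma>0 add.commute)
  next
    fix y assume "g = gmat \<delta> (0 + M *v y) (?w + \<delta> M *v (A *v y)) M"
    then show "\<exists>x. g = gmat \<delta> (u + M *v x) (v + \<delta> M *v (A *v x)) M"
      using assms by (intro exI[of _ "y - matrix_inv M *v u"])
        (simp add: matrix_vector_mult_diff_distrib mult_cancel_\<Gamma>0 gmat_eq_iff)
  qed
  then show ?thesis using assms by (auto simp: q_def gmat_lcoset)
qed

text \<open>The elements of \<open>q (w, M)\<close> have first vector \<open>M *v x\<close>, so
  \<open>gmat \<delta> 0 w M\<close> is the only one whose first vector is 0.\<close>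

lemma inj_q: "inj_on q (UNIV \<times> \<Gamma>0)"
proof (rule inj_onI, clarify)
  fix w M w' M' assume M: "M \<in> \<Gamma>0" "M' \<in> \<Gamma>0" and eq: "q (w, M) = q (w', M')"
  have "gmat \<delta> 0 w M \<in> q (w, M)"
    using M by (auto simp: q_def gmat_lcoset gmat_eq_iff intro!: exI[of _ 0])
  then have "gmat \<delta> 0 w M \<in> q (w', M')" using eq by simp
  then obtain x where "0 = M' *v x" "w = w' + \<delta> M' *v (A *v x)" "M = M'"
    using M by (auto simp: q_def gmat_lcoset gmat_eq_iff)
  moreover from this have "x = 0"
    using M by (metis mult_cancel_\<Gamma>0(7) matrix_vector_mult_0_right)
  ultimately show "w = w' \<and> M = M'" by simp
qed

lemma q_eq_iff: "M \<in> \<Gamma>0 \<Longrightarrow> M' \<in> \<Gamma>0 \<Longrightarrow> q (w, M) = q (w', M') \<longleftrightarrow> w = w' \<and> M = M'"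
  using inj_on_eq_iff[OF inj_q, of "(w, M)" "(w', M')"] by auto

lemma lcosets_eq: "lcosets\<^bsub>\<Gamma>\<^esub> H = q ` (UNIV \<times> \<Gamma>0)"
proof
  show "lcosets\<^bsub>\<Gamma>\<^esub> H \<subseteq> q ` (UNIV \<times> \<Gamma>0)"
    by (auto simp: LCOSETS_def gmat_lcoset_q elim!: \<Gamma>_cases)
  show "q ` (UNIV \<times> \<Gamma>0) \<subseteq> lcosets\<^bsub>\<Gamma>\<^esub> H"
    by (auto simp: LCOSETS_def q_def intro!: bexI[of _ "gmat \<delta> 0 _ _"])
qed

lemma H_q: "H = q (0, mat 1)"
proof -
  have "q (0, mat 1) = \<one>\<^bsub>\<Gamma>\<^esub> <#\<^bsub>\<Gamma>\<^esub> H" by (simp add: q_def \<Gamma>_one)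
  also have "\<dots> = H" by (rule \<Gamma>.lcos_mult_one[OF subgroup.subset[OF subgroup_graph_group]])
  finally show ?thesis by simp
qed

lemma lcoset_lcoset:
  assumes "x \<in> carrier \<Gamma>" "y \<in> carrier \<Gamma>"
  shows "x <#\<^bsub>\<Gamma>\<^esub> (y <#\<^bsub>\<Gamma>\<^esub> H) = (x \<otimes>\<^bsub>\<Gamma>\<^esub> y) <#\<^bsub>\<Gamma>\<^esub> H"
  using assms \<Gamma>.lcos_m_assoc subgroup.subset[OF subgroup_graph_group] by blast

lemma action_q:
  assumes "N \<in> \<Gamma>0" "M \<in> \<Gamma>0"
  shows "gmat \<delta> u v N <#\<^bsub>\<Gamma>\<^esub> q (w, M) =
    q (v + \<delta> N *v w - \<delta> (N ** M) *v (A *v (matrix_inv (N ** M) *v u)), N ** M)"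
proof -
  have "gmat \<delta> u v N <#\<^bsub>\<Gamma>\<^esub> q (w, M) = gmat \<delta> u (v + \<delta> N *v w) (N ** M) <#\<^bsub>\<Gamma>\<^esub> H"
    using assms by (simp add: q_def lcoset_lcoset \<Gamma>_simps(2))
  then show ?thesis using assms by (simp add: gmat_lcoset_q)
qed

lemma action_Xi_q:
  assumes "N \<in> \<Gamma>0" "M \<in> \<Gamma>0"
  shows "gmat \<delta> u (B *v u) N <#\<^bsub>\<Gamma>\<^esub> q (w, M) = q (C (N ** M) *v u + \<delta> N *v w, N ** M)"
  using assms by (simp add: action_q C_vector' algebra_simps)

lemma sigma_value_eq:
  "M \<in> \<Gamma>0 \<Longrightarrow> sigma_value \<delta> A B w M =
    gmat \<delta> (matrix_inv (C M) *v w) (B *v (matrix_inv (C M) *v w)) M"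
  by (simp add: sigma_value_def B_M_inv_BM M_inv_BM matrix_vector_mul_assoc)

text \<open>Injectivity of \<open>q\<close> makes the description in \<open>sigma\<close>
  unambiguous: the coset determines both the vector and the matrix.\<close>

lemma sigma_q_value: "M \<in> \<Gamma>0 \<Longrightarrow> sigma \<Gamma>0 \<delta> A B (q (w, M)) = sigma_value \<delta> A B w M"
  unfolding sigma_def using q_eq_iff by (intro the_equality) (auto simp: q_def)

lemma sigma_q:
  "M \<in> \<Gamma>0 \<Longrightarrow> sigma \<Gamma>0 \<delta> A B (q (w, M)) =
    gmat \<delta> (matrix_inv (C M) *v w) (B *v (matrix_inv (C M) *v w)) M"
  by (simp add: sigma_q_value sigma_value_eq)

abbreviation "\<Xi> \<equiv> TB <#>\<^bsub>\<Gamma>\<^esub> Gam0' \<Gamma>0 \<delta>"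

lemma Xi_eq: "\<Xi> = {gmat \<delta> u (B *v u) M | u M. M \<in> \<Gamma>0}"
proof
  show "\<Xi> \<subseteq> {gmat \<delta> u (B *v u) M | u M. M \<in> \<Gamma>0}"
    by (auto simp: set_mult_def graph_group_def Gam0'_def \<Gamma>_simps(2) gmat_eq_iff)
  show "{gmat \<delta> u (B *v u) M | u M. M \<in> \<Gamma>0} \<subseteq> \<Xi>"
  proof clarify
    fix u M assume "M \<in> \<Gamma>0"
    then have "gmat \<delta> u (B *v u) M = gmat \<delta> u (B *v u) (mat 1) \<otimes>\<^bsub>\<Gamma>\<^esub> gmat \<delta> 0 0 M"
      by (simp add: \<Gamma>_simps(2))
    moreover have "gmat \<delta> u (B *v u) (mat 1) \<in> TB" "gmat \<delta> 0 0 M \<in> Gam0' \<Gamma>0 \<delta>"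
      using \<open>M \<in> \<Gamma>0\<close> by (auto simp: graph_group_def Gam0'_def)
    ultimately show "gmat \<delta> u (B *v u) M \<in> \<Xi>" unfolding set_mult_def by blast
  qed
qed

lemma sigma_image: "sigma \<Gamma>0 \<delta> A B ` (lcosets\<^bsub>\<Gamma>\<^esub> H) = \<Xi>"
proof
  show "sigma \<Gamma>0 \<delta> A B ` (lcosets\<^bsub>\<Gamma>\<^esub> H) \<subseteq> \<Xi>"
    by (fastforce simp: lcosets_eq sigma_q Xi_eq)
  show "\<Xi> \<subseteq> sigma \<Gamma>0 \<delta> A B ` (lcosets\<^bsub>\<Gamma>\<^esub> H)"
  proof (clarsimp simp: Xi_eq lcosets_eq)
    fix u M assume M: "M \<in> \<Gamma>0"
    then have "gmat \<delta> u (B *v u) M = sigma \<Gamma>0 \<delta> A B (q (C M *v u, M))"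
      by (simp add: sigma_q C_cancel)
    then show "gmat \<delta> u (B *v u) M \<in> sigma \<Gamma>0 \<delta> A B ` q ` (UNIV \<times> \<Gamma>0)" using M by blast
  qed
qed

text \<open>The matrix parts force \<open>N = M' ** matrix_inv M\<close>. The vector parts then form
  a linear equation for \<open>u\<close> with coefficient \<open>C M'\<close>, and the eigenvalue
  condition makes this coefficient invertible.\<close>

lemma unique_translation:
  assumes "X \<in> lcosets\<^bsub>\<Gamma>\<^esub> H" "Y \<in> lcosets\<^bsub>\<Gamma>\<^esub> H"
  shows "\<exists>!t. t \<in> \<Xi> \<and> t <#\<^bsub>\<Gamma>\<^esub> X = Y"
proof -
  obtain w M w' M' where X: "X = q (w, M)" "M \<in> \<Gamma>0" and Y: "Y = q (w', M')" "M' \<in> \<Gamma>0"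
    using assms by (auto simp: lcosets_eq)
  let ?N = "M' ** matrix_inv M"
  let ?u = "matrix_inv (C M') *v (w' - \<delta> ?N *v w)"
  show ?thesis
  proof (rule ex1I[of _ "gmat \<delta> ?u (B *v ?u) ?N"])
    show "gmat \<delta> ?u (B *v ?u) ?N \<in> \<Xi> \<and> gmat \<delta> ?u (B *v ?u) ?N <#\<^bsub>\<Gamma>\<^esub> X = Y"
    proof
      show "gmat \<delta> ?u (B *v ?u) ?N \<in> \<Xi>"
        unfolding Xi_eq using X(2) Y(2) by (auto simp: gmat_eq_iff)
      have "C (?N ** M) *v ?u + \<delta> ?N *v w = w'"
        using X(2) Y(2) by (simp add: mult_cancel_\<Gamma>0 C_cancel del: \<delta>_mult)
      then show "gmat \<delta> ?u (B *v ?u) ?N <#\<^bsub>\<Gamma>\<^esub> X = Y"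
        using X Y by (simp add: action_Xi_q mult_cancel_\<Gamma>0 del: \<delta>_mult)
    qed
    fix t assume t: "t \<in> \<Xi> \<and> t <#\<^bsub>\<Gamma>\<^esub> X = Y"
    then obtain u N where tN: "t = gmat \<delta> u (B *v u) N" "N \<in> \<Gamma>0" by (auto simp: Xi_eq)
    have NM: "N ** M = M'" and "C (N ** M) *v u + \<delta> N *v w = w'"
      using t X Y tN by (auto simp: action_Xi_q q_eq_iff)
    moreover from NM have N: "N = ?N" using X(2) by (auto simp: mult_cancel_\<Gamma>0)
    ultimately have "C M' *v u = w' - \<delta> ?N *v w" unfolding N[symmetric] by (simp add: algebra_simps)
    then have "u = ?u" using Y(2) by (metis C_cancel(1))
    then show "t = gmat \<delta> ?u (B *v ?u) ?N" using tN N by simp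
  qed
qed

lemma sigma_in_coset:
  assumes "X \<in> lcosets\<^bsub>\<Gamma>\<^esub> H"
  shows "sigma \<Gamma>0 \<delta> A B X \<in> X"
proof -
  obtain w M where X: "X = q (w, M)" "M \<in> \<Gamma>0"
    using assms by (auto simp: lcosets_eq)
  let ?u = "matrix_inv (C M) *v w"
  \<comment> \<open>The base coset is \<open>q (0, mat 1)\<close>; the action formula sends it to
    \<open>q (C M *v ?u, M)\<close>, which is \<open>X\<close> by the choice of
    \<open>?u\<close>.\<close>
  have "sigma \<Gamma>0 \<delta> A B X <#\<^bsub>\<Gamma>\<^esub> H = X"
    using X action_Xi_q[OF X(2) \<Gamma>0_one, of ?u 0] by (simp add: sigma_q C_cancel flip: H_q)
  moreover have "sigma \<Gamma>0 \<delta> A B X \<in> carrier \<Gamma>" using X by (simp add: sigma_q)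
  ultimately show ?thesis using \<Gamma>.lcos_self subgroup_graph_group by blast
qed

lemma sigma_H: "sigma \<Gamma>0 \<delta> A B H = \<one>\<^bsub>\<Gamma>\<^esub>"
  by (simp add: H_q sigma_q \<Gamma>_one)

lemma transitive_section_sigma: "transitive_section \<Gamma> H (sigma \<Gamma>0 \<delta> A B)"
  unfolding transitive_section_def
  by (simp add: \<Gamma>.is_group subgroup_graph_group sigma_in_coset sigma_H sigma_image unique_translation)

end

section \<open>Loops\<close>

lemma loop_ldiv:
  assumes "loop L" "a \<in> carrier L" "y \<in> carrier L" "a \<otimes>\<^bsub>L\<^esub> y = b"
  shows "ldiv L a b = y"
proof -
  have "b \<in> carrier L" using assms by (auto simp: loop_def)
  with assms have "\<exists>!y. y \<in> carrier L \<and> a \<otimes>\<^bsub>L\<^esub> y = b" by (auto simp: loop_def)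
  then show ?thesis unfolding ldiv_def using assms by (intro the1_equality) auto
qed

lemma loop_rdiv:
  assumes "loop L" "a \<in> carrier L" "x \<in> carrier L" "x \<otimes>\<^bsub>L\<^esub> a = b"
  shows "rdiv L b a = x"
proof -
  have "b \<in> carrier L" using assms by (auto simp: loop_def)
  with assms have "\<exists>!x. x \<in> carrier L \<and> x \<otimes>\<^bsub>L\<^esub> a = b" by (auto simp: loop_def)
  then show ?thesis unfolding rdiv_def using assms by (intro the1_equality) auto
qed

lemma loop_division:
  assumes "loop L" "a \<in> carrier L" "b \<in> carrier L"
  shows "ldiv L a b \<in> carrier L" "a \<otimes>\<^bsub>L\<^esub> ldiv L a b = b"
    "rdiv L b a \<in> carrier L" "rdiv L b a \<otimes>\<^bsub>L\<^esub> a = b"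
proof -
  obtain y x where "y \<in> carrier L" "a \<otimes>\<^bsub>L\<^esub> y = b" "x \<in> carrier L" "x \<otimes>\<^bsub>L\<^esub> a = b"
    using assms unfolding loop_def by metis
  with loop_ldiv[OF assms(1,2)] loop_rdiv[OF assms(1,2)]
  show "ldiv L a b \<in> carrier L" "a \<otimes>\<^bsub>L\<^esub> ldiv L a b = b"
    "rdiv L b a \<in> carrier L" "rdiv L b a \<otimes>\<^bsub>L\<^esub> a = b" by auto
qed

text \<open>Divisions given as explicit functions replace the two unique existence statements: the
  fifth hypothesis provides solutions, the last one their uniqueness, and all of it is
  equational.\<close>

lemma loopI:
  assumes "\<one>\<^bsub>L\<^esub> \<in> carrier L"
    and "\<And>x y. x \<in> carrier L \<Longrightarrow> y \<in> carrier L \<Longrightarrow> x \<otimes>\<^bsub>L\<^esub> y \<in> carrier L"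
    and "\<And>x. x \<in> carrier L \<Longrightarrow> \<one>\<^bsub>L\<^esub> \<otimes>\<^bsub>L\<^esub> x = x"
    and "\<And>x. x \<in> carrier L \<Longrightarrow> x \<otimes>\<^bsub>L\<^esub> \<one>\<^bsub>L\<^esub> = x"
    and "\<And>a b. a \<in> carrier L \<Longrightarrow> b \<in> carrier L \<Longrightarrow>
      ld a b \<in> carrier L \<and> a \<otimes>\<^bsub>L\<^esub> ld a b = b \<and> rd b a \<in> carrier L \<and> rd b a \<otimes>\<^bsub>L\<^esub> a = b"
    and "\<And>a y. a \<in> carrier L \<Longrightarrow> y \<in> carrier L \<Longrightarrow> y = ld a (a \<otimes>\<^bsub>L\<^esub> y) \<and> y = rd (y \<otimes>\<^bsub>L\<^esub> a) a"
  shows "loop L"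
  unfolding loop_def
proof (intro conjI ballI)
  fix a b assume ab: "a \<in> carrier L" "b \<in> carrier L"
  show "\<exists>!y. y \<in> carrier L \<and> a \<otimes>\<^bsub>L\<^esub> y = b"
    by (rule ex1I[of _ "ld a b"]) (use assms(5,6) ab in blast)+
  show "\<exists>!x. x \<in> carrier L \<and> x \<otimes>\<^bsub>L\<^esub> a = b"
    by (rule ex1I[of _ "rd b a"]) (use assms(5,6) ab in blast)+
qed (use assms in auto)

lemma (in group) group_imp_loop: "loop G"
  by (rule loopI[where ld = "\<lambda>a b. inv a \<otimes> b" and rd = "\<lambda>b a. b \<otimes> inv a"])
    (auto simp: m_assoc inv_solve_left inv_solve_right, simp flip: m_assoc)

text \<open>Right division of the unit already supplies left inverses, so a loop lacks nothing but
  associativity.\<close>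

lemma group_iff_loop_assoc:
  assumes "loop L"
  shows "group L \<longleftrightarrow> (\<forall>x\<in>carrier L. \<forall>y\<in>carrier L. \<forall>z\<in>carrier L.
    x \<otimes>\<^bsub>L\<^esub> y \<otimes>\<^bsub>L\<^esub> z = x \<otimes>\<^bsub>L\<^esub> (y \<otimes>\<^bsub>L\<^esub> z))"
proof
  assume "group L"
  then interpret group L .
  show "\<forall>x\<in>carrier L. \<forall>y\<in>carrier L. \<forall>z\<in>carrier L. x \<otimes>\<^bsub>L\<^esub> y \<otimes>\<^bsub>L\<^esub> z = x \<otimes>\<^bsub>L\<^esub> (y \<otimes>\<^bsub>L\<^esub> z)"
    by (simp add: m_assoc)
next
  assume assoc: "\<forall>x\<in>carrier L. \<forall>y\<in>carrier L. \<forall>z\<in>carrier L.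
    x \<otimes>\<^bsub>L\<^esub> y \<otimes>\<^bsub>L\<^esub> z = x \<otimes>\<^bsub>L\<^esub> (y \<otimes>\<^bsub>L\<^esub> z)"
  show "group L"
  proof (rule groupI)
    fix x assume x: "x \<in> carrier L"
    have "\<one>\<^bsub>L\<^esub> \<in> carrier L" using assms by (simp add: loop_def)
    then show "\<exists>y\<in>carrier L. y \<otimes>\<^bsub>L\<^esub> x = \<one>\<^bsub>L\<^esub>"
      using x loop_division(3,4)[OF assms] by blast
  qed (use assms assoc in \<open>simp_all add: loop_def\<close>)
qed

text \<open>Transport of structure along a bijection. The divisions are carried along with the
  axioms, so those of the coset loop can be computed from formulas on pairs.\<close>

lemma loop_image:
  assumes G: "loop G" and inj: "inj_on h (carrier G)" and car: "carrier L = h ` carrier G"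
    and mult: "\<And>x y. x \<in> carrier G \<Longrightarrow> y \<in> carrier G \<Longrightarrow> h x \<otimes>\<^bsub>L\<^esub> h y = h (x \<otimes>\<^bsub>G\<^esub> y)"
    and one: "\<one>\<^bsub>L\<^esub> = h \<one>\<^bsub>G\<^esub>"
  shows "loop L"
    and "\<And>x y. x \<in> carrier G \<Longrightarrow> y \<in> carrier G \<Longrightarrow> ldiv L (h x) (h y) = h (ldiv G x y)"
    and "\<And>x y. x \<in> carrier G \<Longrightarrow> y \<in> carrier G \<Longrightarrow> rdiv L (h y) (h x) = h (rdiv G y x)"
proof -
  have closed: "x \<otimes>\<^bsub>G\<^esub> y \<in> carrier G" if "x \<in> carrier G" "y \<in> carrier G" for x y
    using G that by (simp add: loop_def)
  note div = loop_division[OF G]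
  define k where "k = the_inv_into (carrier G) h"
  have kh: "k (h x) = x" if "x \<in> carrier G" for x
    unfolding k_def using inj that by (rule the_inv_into_f_f)
  show L: "loop L"
  proof (rule loopI[where ld = "\<lambda>a b. h (ldiv G (k a) (k b))" and rd = "\<lambda>b a. h (rdiv G (k b) (k a))"])
    fix a y assume "a \<in> carrier L" "y \<in> carrier L"
    then obtain a' y' where "a = h a'" "y = h y'" "a' \<in> carrier G" "y' \<in> carrier G"
      by (auto simp: car)
    then show "y = h (ldiv G (k a) (k (a \<otimes>\<^bsub>L\<^esub> y))) \<and> y = h (rdiv G (k (y \<otimes>\<^bsub>L\<^esub> a)) (k a))"
      by (simp add: mult closed kh loop_ldiv[OF G] loop_rdiv[OF G])
  qed (use G in \<open>auto simp: car mult one closed kh div loop_def\<close>)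
  show "ldiv L (h x) (h y) = h (ldiv G x y)" if "x \<in> carrier G" "y \<in> carrier G" for x y
    using that by (intro loop_ldiv[OF L]) (auto simp: car mult div)
  show "rdiv L (h y) (h x) = h (rdiv G y x)" if "x \<in> carrier G" "y \<in> carrier G" for x y
    using that by (intro loop_rdiv[OF L]) (auto simp: car mult div)
qed

text \<open>The natural map runs from the twisted product to the coset loop, opposite to the
  isomorphism wanted. Only closure of \<open>G\<close> is assumed: the inverse map is later used to
  give the twisted product its loop axioms.\<close>

lemma isoI_inverse:
  assumes "bij_betw h (carrier G) (carrier L)"
    and "\<And>x y. x \<in> carrier G \<Longrightarrow> y \<in> carrier G \<Longrightarrow> x \<otimes>\<^bsub>G\<^esub> y \<in> carrier G"
    and "\<And>x y. x \<in> carrier G \<Longrightarrow> y \<in> carrier G \<Longrightarrow> h (x \<otimes>\<^bsub>G\<^esub> y) = h x \<otimes>\<^bsub>L\<^esub> h y"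
  shows "the_inv_into (carrier G) h \<in> iso L G"
proof -
  let ?k = "the_inv_into (carrier G) h"
  have bij: "bij_betw ?k (carrier L) (carrier G)" by (rule bij_betw_the_inv_into[OF assms(1)])
  have inj: "inj_on h (carrier G)" and im: "h ` carrier G = carrier L"
    using assms(1) by (auto simp: bij_betw_def)
  have "?k (x \<otimes>\<^bsub>L\<^esub> y) = ?k x \<otimes>\<^bsub>G\<^esub> ?k y" if xy: "x \<in> carrier L" "y \<in> carrier L" for x y
  proof -
    obtain a b where ab: "x = h a" "y = h b" "a \<in> carrier G" "b \<in> carrier G" using xy im by blast
    then have "x \<otimes>\<^bsub>L\<^esub> y = h (a \<otimes>\<^bsub>G\<^esub> b)" by (simp add: assms(3))
    then show ?thesis using ab by (simp add: the_inv_into_f_f[OF inj] assms(2))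
  qed
  then show ?thesis using bij by (auto simp: iso_def hom_def bij_betw_def)
qed

text \<open>In a group the three coset identities required of a normal subloop follow from
  associativity together with the equality of left and right cosets.\<close>

lemma (in group) semidirectI:
  assumes "N \<lhd> G" "subgroup K G" "carrier G = N <#> K" "N \<inter> K = {\<one>}"
  shows "semidirect G N K"
proof -
  interpret N: normal N G by fact
  have sub: "subloop S G" if "subgroup S G" for S
    using that by (auto simp: subloop_def group.group_imp_loop subgroup.subgroup_is_group subgroup.mem_carrier)
  have N: "N \<subseteq> carrier G" by (rule N.subset)
  have "(x <# N) #> y = (x \<otimes> y) <# N" "x <# (N #> y) = (x \<otimes> y) <# N" "x <# (y <# N) = (x \<otimes> y) <# N"
    if "x \<in> carrier G" "y \<in> carrier G" for x y
    using that N N.coset_eq by (metis coset_mult_assoc m_closed, metis lcos_m_assoc, metis lcos_m_assoc)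
  then have "normal_subloop N G"
    unfolding normal_subloop_def
    using sub[OF N.is_subgroup] N.coset_eq by simp
  then show ?thesis
    unfolding semidirect_def using assms sub[OF assms(2)] group_imp_loop by simp
qed

section \<open>The loop in coordinates\<close>

context loop_setup
begin

section \<open>The product and both divisions on pairs\<close>

definition Q :: "(('k^'n) \<times> ('k^'n^'n)) monoid" where
  "Q = \<lparr>carrier = UNIV \<times> \<Gamma>0,
    mult = (\<lambda>(w1, M1) (w2, M2). (C (M1 ** M2) *v (matrix_inv (C M1) *v w1) + \<delta> M1 *v w2, M1 ** M2)),
    one = (0, mat 1)\<rparr>"

text \<open>Both divisions solve
  \<open>w = C M *v (matrix_inv (C M1) *v w1) + \<delta> M1 *v w2\<close> with
  \<open>M = M1 ** M2\<close>. Here the unknown is the second factor, with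
  \<open>M2 = matrix_inv M1 ** M\<close>; for \<open>qrdiv\<close> it is the first, with
  \<open>M1 = M ** matrix_inv M2\<close>. In either case the unknown vector has an invertible
  coefficient.\<close>

definition qldiv :: "('k^'n) \<times> ('k^'n^'n) \<Rightarrow> ('k^'n) \<times> ('k^'n^'n) \<Rightarrow> ('k^'n) \<times> ('k^'n^'n)" where
  "qldiv = (\<lambda>(w1, M1) (w, M). (matrix_inv (\<delta> M1) *v (w - C M *v (matrix_inv (C M1) *v w1)), matrix_inv M1 ** M))"

definition qrdiv :: "('k^'n) \<times> ('k^'n^'n) \<Rightarrow> ('k^'n) \<times> ('k^'n^'n) \<Rightarrow> ('k^'n) \<times> ('k^'n^'n)" where
  "qrdiv = (\<lambda>(w, M) (w2, M2).
    (C (M ** matrix_inv M2) *v (matrix_inv (C M) *v (w - \<delta> (M ** matrix_inv M2) *v w2)), M ** matrix_inv M2))"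

lemma Q_simps: "carrier Q = UNIV \<times> \<Gamma>0" "\<one>\<^bsub>Q\<^esub> = (0, mat 1)"
  "(w1, M1) \<otimes>\<^bsub>Q\<^esub> (w2, M2) = (C (M1 ** M2) *v (matrix_inv (C M1) *v w1) + \<delta> M1 *v w2, M1 ** M2)"
  by (simp_all add: Q_def)

lemma loop_Q: "loop Q"
proof (rule loopI[where ld = qldiv and rd = qrdiv])
  fix a b assume "a \<in> carrier Q" "b \<in> carrier Q"
  then show "qldiv a b \<in> carrier Q \<and> a \<otimes>\<^bsub>Q\<^esub> qldiv a b = b \<and>
    qrdiv b a \<in> carrier Q \<and> qrdiv b a \<otimes>\<^bsub>Q\<^esub> a = b"
    by (cases a; cases b) (simp add: Q_simps qldiv_def qrdiv_def mult_cancel_\<Gamma>0 C_cancel del: \<delta>_mult \<delta>_inv)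
next
  fix a y assume "a \<in> carrier Q" "y \<in> carrier Q"
  then show "y = qldiv a (a \<otimes>\<^bsub>Q\<^esub> y) \<and> y = qrdiv (y \<otimes>\<^bsub>Q\<^esub> a) a"
    by (cases a; cases y) (simp add: Q_simps qldiv_def qrdiv_def mult_cancel_\<Gamma>0 C_cancel del: \<delta>_mult \<delta>_inv)
qed (auto simp: Q_simps C_cancel mult_cancel_\<Gamma>0)

lemma Q_division:
  assumes "a \<in> carrier Q" "b \<in> carrier Q"
  shows "ldiv Q a b = qldiv a b" "rdiv Q b a = qrdiv b a"
  using assms
  by (auto intro!: loop_ldiv[OF loop_Q] loop_rdiv[OF loop_Q]
      simp: Q_simps qldiv_def qrdiv_def mult_cancel_\<Gamma>0 C_cancel simp del: \<delta>_mult \<delta>_inv)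

abbreviation "L \<equiv> L_Xi \<Gamma>0 \<delta> A B"

lemma L_carrier: "carrier L = q ` (UNIV \<times> \<Gamma>0)" and L_carrier': "carrier L = q ` carrier Q"
  by (simp_all add: L_Xi_def section_loop_def lcosets_eq Q_simps)

lemma L_lcosets: "carrier L = lcosets\<^bsub>\<Gamma>\<^esub> H"
  by (simp add: L_Xi_def section_loop_def)

lemma L_one: "\<one>\<^bsub>L\<^esub> = q \<one>\<^bsub>Q\<^esub>" and L_one': "\<one>\<^bsub>L\<^esub> = H"
  by (simp_all add: L_Xi_def section_loop_def H_q Q_simps)

lemma L_mult_def: "X \<otimes>\<^bsub>L\<^esub> Y = sigma \<Gamma>0 \<delta> A B X <#\<^bsub>\<Gamma>\<^esub> Y"
  by (simp add: L_Xi_def section_loop_def)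

lemma L_mult: "a \<in> carrier Q \<Longrightarrow> b \<in> carrier Q \<Longrightarrow> q a \<otimes>\<^bsub>L\<^esub> q b = q (a \<otimes>\<^bsub>Q\<^esub> b)"
  by (cases a; cases b) (simp add: Q_simps L_mult_def sigma_q action_Xi_q)

lemma inj_q_Q: "inj_on q (carrier Q)"
  using inj_q by (simp add: Q_simps)

lemmas L_image = loop_image[OF loop_Q inj_q_Q L_carrier' L_mult L_one]

lemma loop_L: "loop L" by (rule L_image(1))

lemma Q_closed: "a \<in> carrier Q \<Longrightarrow> b \<in> carrier Q \<Longrightarrow> a \<otimes>\<^bsub>Q\<^esub> b \<in> carrier Q"
  using loop_Q by (simp add: loop_def)

section \<open>The twisted product on vectors and matrices\<close>

abbreviation "P \<equiv> twisted_product \<Gamma>0 \<delta> A B"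

lemma P_simps: "carrier P = UNIV \<times> \<Gamma>0" "\<one>\<^bsub>P\<^esub> = (0, mat 1)"
  "(u1, M1) \<otimes>\<^bsub>P\<^esub> (u2, M2) = (u1 + psi \<delta> A B M1 M2 *v u2, M1 ** M2)"
  by (simp_all add: twisted_product_def)

text \<open>So \<psi> is the linear map \<open>\<delta> M1\<close> of the second vector, read in
  coordinates \<open>u\<close> with \<open>w = C M *v u\<close>: it leads from the fibre over
  \<open>M2\<close> to the fibre over \<open>M1 ** M2\<close>.\<close>

lemma psi_eq: "psi \<delta> A B M1 M2 = matrix_inv (C (M1 ** M2)) ** (\<delta> M1 ** C M2)"
  by (simp add: psi_def C_def)

lemma psi_vector: "psi \<delta> A B M1 M2 *v x = matrix_inv (C (M1 ** M2)) *v (\<delta> M1 *v (C M2 *v x))"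
  by (simp add: psi_eq matrix_vector_mul_assoc)

lemma psi_invertible: "M1 \<in> \<Gamma>0 \<Longrightarrow> M2 \<in> \<Gamma>0 \<Longrightarrow> invertible (psi \<delta> A B M1 M2)"
  unfolding psi_eq by (intro invertible_mult invertible_matrix_inv) auto

text \<open>A left factor with matrix \<open>mat 1\<close> merely adds its vector. Hence these
  elements form a copy of the additive group and translate every fibre.\<close>

lemma psi_one: "M \<in> \<Gamma>0 \<Longrightarrow> psi \<delta> A B (mat 1) M = mat 1"
  by (simp add: psi_eq matrix_inv_left)

definition P_to_L where "P_to_L = (\<lambda>(u, M). q (C M *v u, M))"

lemma P_to_L_mult:
  "a \<in> carrier P \<Longrightarrow> b \<in> carrier P \<Longrightarrow> P_to_L (a \<otimes>\<^bsub>P\<^esub> b) = P_to_L a \<otimes>\<^bsub>L\<^esub> P_to_L b"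
  by (cases a; cases b)
    (simp add: P_to_L_def P_simps L_mult Q_simps psi_vector matrix_vector_right_distrib C_cancel)

lemma bij_P_to_L: "bij_betw P_to_L (carrier P) (carrier L)"
proof (rule bij_betw_imageI)
  show "inj_on P_to_L (carrier P)"
    by (auto simp: inj_on_def P_to_L_def P_simps q_eq_iff invertible_vector_cancel)
  show "P_to_L ` carrier P = carrier L"
  proof
    show "P_to_L ` carrier P \<subseteq> carrier L" by (auto simp: P_to_L_def P_simps L_carrier)
    show "carrier L \<subseteq> P_to_L ` carrier P"
    proof
      fix X assume "X \<in> carrier L"
      then obtain w M where "X = q (w, M)" "M \<in> \<Gamma>0" by (auto simp: L_carrier)
      then have "X = P_to_L (matrix_inv (C M) *v w, M)" "(matrix_inv (C M) *v w, M) \<in> carrier P"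
        by (simp_all add: P_to_L_def C_cancel P_simps)
      then show "X \<in> P_to_L ` carrier P" by blast
    qed
  qed
qed

lemma P_closed: "a \<in> carrier P \<Longrightarrow> b \<in> carrier P \<Longrightarrow> a \<otimes>\<^bsub>P\<^esub> b \<in> carrier P"
  by (cases a; cases b) (simp add: P_simps)

lemma iso_P_to_L: "the_inv_into (carrier P) P_to_L \<in> iso L P"
  by (rule isoI_inverse[OF bij_P_to_L P_closed P_to_L_mult])

text \<open>The axioms are inherited from \<open>L\<close> through the inverse bijection, which
  avoids solving equations that contain \<psi>.\<close>

lemma loop_P: "loop P"
proof (rule loop_image(1)[OF loop_L])
  let ?k = "the_inv_into (carrier P) P_to_L"
  have bij: "bij_betw ?k (carrier L) (carrier P)" by (rule bij_betw_the_inv_into[OF bij_P_to_L])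
  then show "inj_on ?k (carrier L)" "carrier P = ?k ` carrier L" by (auto simp: bij_betw_def)
  show "?k x \<otimes>\<^bsub>P\<^esub> ?k y = ?k (x \<otimes>\<^bsub>L\<^esub> y)" if "x \<in> carrier L" "y \<in> carrier L" for x y
    using iso_P_to_L that by (simp add: iso_def hom_def)
  have "\<one>\<^bsub>L\<^esub> = P_to_L \<one>\<^bsub>P\<^esub>" by (simp add: L_one Q_simps P_simps P_to_L_def)
  then show "\<one>\<^bsub>P\<^esub> = ?k \<one>\<^bsub>L\<^esub>"
    using bij_P_to_L by (simp add: the_inv_into_f_f bij_betw_def P_simps)
qed

lemma iso_vectors: "(\<lambda>u. (u, mat 1)) \<in> iso additive_group (P\<lparr>carrier := UNIV \<times> {mat 1}\<rparr>)"
  by (auto simp: iso_def hom_def additive_group_def bij_betw_def inj_on_def P_simps psi_one)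

lemma iso_matrices: "(\<lambda>M. (0, M)) \<in> iso (GL\<lparr>carrier := \<Gamma>0\<rparr>) (P\<lparr>carrier := {0} \<times> \<Gamma>0\<rparr>)"
  by (auto simp: iso_def hom_def GL_simps bij_betw_def inj_on_def P_simps)

lemma loop_restrict_image:
  assumes "loop G" "inj_on h (carrier G)" "h ` carrier G = S" "h \<one>\<^bsub>G\<^esub> = \<one>\<^bsub>L'\<^esub>"
    and "\<And>x y. x \<in> carrier G \<Longrightarrow> y \<in> carrier G \<Longrightarrow> h x \<otimes>\<^bsub>L'\<^esub> h y = h (x \<otimes>\<^bsub>G\<^esub> y)"
  shows "loop (L'\<lparr>carrier := S\<rparr>)"
  by (rule loop_image(1)[of G h]) (use assms in auto)

text \<open>Multiplying a fibre \<open>UNIV \<times> {M}\<close> by an element, on either side,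
  yields a whole fibre again. Every coset identity then reduces to the associative product of the
  matrix parts.\<close>

lemma semidirect_P: "semidirect P (UNIV \<times> {mat 1}) ({0} \<times> \<Gamma>0)"
proof -
  let ?N = "UNIV \<times> {mat 1} :: (('k^'n) \<times> ('k^'n^'n)) set"
  have "group (additive_group :: ('k^'n) monoid)"
    by (rule groupI) (auto simp: additive_group_def add.assoc intro: exI[of _ "- _"])
  then have "loop (P\<lparr>carrier := ?N\<rparr>)"
    by (intro loop_restrict_image[OF group.group_imp_loop, of additive_group "\<lambda>u. (u, mat 1)"])
      (auto simp: additive_group_def inj_on_def P_simps psi_one)
  then have N: "subloop ?N P" by (auto simp: subloop_def P_simps)
  have "group (GL\<lparr>carrier := \<Gamma>0\<rparr>)" by (rule subgroup.subgroup_is_group[OF subgroup_\<Gamma>0 group_GL])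
  then have "loop (P\<lparr>carrier := {0} \<times> \<Gamma>0\<rparr>)"
    by (intro loop_restrict_image[OF group.group_imp_loop, of "GL\<lparr>carrier := \<Gamma>0\<rparr>" "\<lambda>M. (0, M)"])
      (auto simp: GL_simps inj_on_def P_simps)
  then have K: "subloop ({0} \<times> \<Gamma>0) P" by (auto simp: subloop_def P_simps)
  have left: "x <#\<^bsub>P\<^esub> (UNIV \<times> {M}) = UNIV \<times> {snd x ** M}" if "x \<in> carrier P" "M \<in> \<Gamma>0" for x M
  proof -
    obtain u N where x: "x = (u, N)" "N \<in> \<Gamma>0" using \<open>x \<in> carrier P\<close> by (auto simp: P_simps)
    \<comment> \<open>The witness solves \<open>u + psi \<delta> A B N M *v t = y\<close> for
      \<open>t\<close>; here the invertibility of \<psi> is essential.\<close>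
    have "(y, N ** M) \<in> x <#\<^bsub>P\<^esub> (UNIV \<times> {M})" for y
      unfolding l_coset_def x
      by (rule UN_I[of "(matrix_inv (psi \<delta> A B N M) *v (y - u), M)"])
        (simp_all add: P_simps matrix_inv_vector psi_invertible x that)
    then show ?thesis by (auto simp: l_coset_def P_simps x)
  qed
  have right: "(UNIV \<times> {M}) #>\<^bsub>P\<^esub> x = UNIV \<times> {M ** snd x}" if "x \<in> carrier P" "M \<in> \<Gamma>0" for x M
  proof -
    obtain u N where x: "x = (u, N)" "N \<in> \<Gamma>0" using \<open>x \<in> carrier P\<close> by (auto simp: P_simps)
    have "(y, M ** N) \<in> (UNIV \<times> {M}) #>\<^bsub>P\<^esub> x" for y
      unfolding r_coset_def x
      by (rule UN_I[of "(y - psi \<delta> A B M N *v u, M)"]) (simp_all add: P_simps)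
    then show ?thesis by (auto simp: r_coset_def P_simps x)
  qed
  have "normal_subloop ?N P"
    unfolding normal_subloop_def
    using N by (auto simp: left right P_simps psi_one matrix_mul_assoc)
  moreover have "carrier P = ?N <#>\<^bsub>P\<^esub> ({0} \<times> \<Gamma>0)"
    by (auto simp: set_mult_def P_simps)
  moreover have "?N \<inter> ({0} \<times> \<Gamma>0) = {\<one>\<^bsub>P\<^esub>}" by (auto simp: P_simps)
  ultimately show ?thesis using loop_P K by (simp add: semidirect_def)
qed

section \<open>Associativity and the inverse properties\<close>

definition psi_const where
  "psi_const \<longleftrightarrow> (\<forall>N\<in>\<Gamma>0. \<forall>M\<in>\<Gamma>0. \<forall>x.
    matrix_inv (C (N ** M)) *v (\<delta> N *v (C M *v x)) = matrix_inv (C N) *v (\<delta> N *v (C (mat 1) *v x)))"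

lemma psi_constD:
  assumes psi_const "N \<in> \<Gamma>0" "M \<in> \<Gamma>0" "M' \<in> \<Gamma>0"
  shows "matrix_inv (C (N ** M)) *v (\<delta> N *v (C M *v x)) = matrix_inv (C (N ** M')) *v (\<delta> N *v (C M' *v x))"
  using assms by (simp add: psi_const_def del: \<delta>_mult)

lemma group_L_iff: "group L \<longleftrightarrow> psi_const"
proof -
  have "group L \<longleftrightarrow> (\<forall>x\<in>carrier L. \<forall>y\<in>carrier L. \<forall>z\<in>carrier L.
      x \<otimes>\<^bsub>L\<^esub> y \<otimes>\<^bsub>L\<^esub> z = x \<otimes>\<^bsub>L\<^esub> (y \<otimes>\<^bsub>L\<^esub> z))"
    by (rule group_iff_loop_assoc[OF loop_L])
  also have "\<dots> \<longleftrightarrow> (\<forall>a\<in>carrier Q. \<forall>b\<in>carrier Q. \<forall>c\<in>carrier Q.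
      a \<otimes>\<^bsub>Q\<^esub> b \<otimes>\<^bsub>Q\<^esub> c = a \<otimes>\<^bsub>Q\<^esub> (b \<otimes>\<^bsub>Q\<^esub> c))"
    by (simp add: L_carrier' L_mult Q_closed inj_on_eq_iff[OF inj_q_Q])
  also have "\<dots> \<longleftrightarrow> psi_const"
  proof
    assume *: "\<forall>a\<in>carrier Q. \<forall>b\<in>carrier Q. \<forall>c\<in>carrier Q.
      a \<otimes>\<^bsub>Q\<^esub> b \<otimes>\<^bsub>Q\<^esub> c = a \<otimes>\<^bsub>Q\<^esub> (b \<otimes>\<^bsub>Q\<^esub> c)"
    show psi_const unfolding psi_const_def
    proof (intro ballI allI)
      fix N M x assume NM: "N \<in> \<Gamma>0" "M \<in> \<Gamma>0"
      \<comment> \<open>With the vector 0 in both outer factors, only the contribution of the middle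
        vector is left on either side.\<close>
      have "C (N ** M) *v (matrix_inv (C N) *v (\<delta> N *v (C (mat 1) *v x))) = \<delta> N *v (C M *v x)"
        using *[rule_format, of "(0, N)" "(C (mat 1) *v x, mat 1)" "(0, M)"] NM
        by (simp add: Q_simps C_cancel)
      then show "matrix_inv (C (N ** M)) *v (\<delta> N *v (C M *v x)) = matrix_inv (C N) *v (\<delta> N *v (C (mat 1) *v x))"
        using NM by (metis C_cancel(1) \<Gamma>0_mult)
    qed
  next
    assume psi: psi_const
    \<comment> \<open>The coefficients of the outer vectors agree in both bracketings: that of the
      first is \<open>C (M1 ** M2 ** M3)\<close> applied after \<open>matrix_inv (C M1)\<close>,
      since the intermediate factors cancel, and that of the third is
      \<open>\<delta> (M1 ** M2)\<close>. Only the middle vector needs \<psi> to be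
      constant.\<close>
    have "C (M1 ** M2 ** M3) *v (matrix_inv (C (M1 ** M2)) *v (\<delta> M1 *v w)) =
        \<delta> M1 *v (C (M2 ** M3) *v (matrix_inv (C M2) *v w))"
      if "M1 \<in> \<Gamma>0" "M2 \<in> \<Gamma>0" "M3 \<in> \<Gamma>0" for M1 M2 M3 w
      using psi_constD[OF psi, of M1 M2 "M2 ** M3" "matrix_inv (C M2) *v w"] that
      by (simp add: C_cancel matrix_mul_assoc del: \<delta>_mult)
    note assoc = this
    show "\<forall>a\<in>carrier Q. \<forall>b\<in>carrier Q. \<forall>c\<in>carrier Q.
      a \<otimes>\<^bsub>Q\<^esub> b \<otimes>\<^bsub>Q\<^esub> c = a \<otimes>\<^bsub>Q\<^esub> (b \<otimes>\<^bsub>Q\<^esub> c)"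
    proof (intro ballI)
      fix a b c assume "a \<in> carrier Q" "b \<in> carrier Q" "c \<in> carrier Q"
      then obtain w1 M1 w2 M2 w3 M3 where "a = (w1, M1)" "b = (w2, M2)" "c = (w3, M3)"
        "M1 \<in> \<Gamma>0" "M2 \<in> \<Gamma>0" "M3 \<in> \<Gamma>0" by (auto simp: Q_simps)
      then show "a \<otimes>\<^bsub>Q\<^esub> b \<otimes>\<^bsub>Q\<^esub> c = a \<otimes>\<^bsub>Q\<^esub> (b \<otimes>\<^bsub>Q\<^esub> c)"
        using assoc[of M1 M2 M3 w2]
        by (simp add: Q_simps matrix_vector_right_distrib C_cancel matrix_mul_assoc)
          (simp add: matrix_vector_mul_assoc)
    qed
  qed
  finally show ?thesis .
qed

text \<open>Testing the identity on the elements \<open>(0, K)\<close> gives a linear equation for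
  the inverse of \<open>(w, M)\<close> for each \<open>K\<close>. The case \<open>K = mat 1\<close>
  determines the vector of the inverse, and \<open>K = N\<close> then is the claim.\<close>

lemma left_inverse_imp_psi_const:
  assumes "left_inverse_property L"
  shows psi_const
  unfolding psi_const_def
proof (intro ballI allI)
  fix M N x assume MN: "M \<in> \<Gamma>0" "N \<in> \<Gamma>0"
  \<comment> \<open>This choice makes \<open>matrix_inv (C M') *v w'\<close> equal to
    \<open>- x\<close> for the inverse \<open>(w', M')\<close>.\<close>
  define w where "w = \<delta> M *v (C (mat 1) *v x)"
  have "\<exists>b\<in>carrier Q. q b \<otimes>\<^bsub>L\<^esub> q (w, M) = \<one>\<^bsub>L\<^esub> \<and>
      (\<forall>c\<in>carrier Q. q b \<otimes>\<^bsub>L\<^esub> (q (w, M) \<otimes>\<^bsub>L\<^esub> q c) = q c)"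
    using assms[unfolded left_inverse_property_def L_carrier', rule_format, of "q (w, M)"] MN
    by (auto simp: Q_simps)
  then obtain w' M' where M': "M' \<in> \<Gamma>0" and one: "(w', M') \<otimes>\<^bsub>Q\<^esub> (w, M) = \<one>\<^bsub>Q\<^esub>"
    and inv: "\<And>c. c \<in> carrier Q \<Longrightarrow> (w', M') \<otimes>\<^bsub>Q\<^esub> ((w, M) \<otimes>\<^bsub>Q\<^esub> c) = c"
    using MN by (auto simp: L_one L_mult Q_closed inj_on_eq_iff[OF inj_q_Q] Q_simps(1,2))
      (metis (no_types, lifting) L_mult Q_closed SigmaI UNIV_I Q_simps(1,2) inj_on_eq_iff[OF inj_q_Q] \<Gamma>0_one)
  have M'_eq: "M' = matrix_inv M"
    using one MN by (simp add: Q_simps) (metis mult_cancel_\<Gamma>0(6) matrix_mul_lid)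
  have eq: "C K *v (matrix_inv (C M') *v w') = - (\<delta> M' *v (C (M ** K) *v (matrix_inv (C M) *v w)))"
    if "K \<in> \<Gamma>0" for K
    using inv[of "(0, K)"] that MN
    by (simp add: Q_simps M'_eq mult_cancel_\<Gamma>0 del: \<delta>_mult \<delta>_inv) (simp add: eq_neg_iff_add_eq_0)
  have "C (mat 1) *v (matrix_inv (C M') *v w') = - (C (mat 1) *v x)"
    using eq[of "mat 1"] MN by (simp add: C_cancel M'_eq w_def mult_cancel_\<Gamma>0)
  then have "matrix_inv (C M') *v w' = - x"
    by (metis C_cancel(1) \<Gamma>0_one matrix_vector_mult_uminus)
  then have "C N *v x = \<delta> M' *v (C (M ** N) *v (matrix_inv (C M) *v w))"
    using eq[OF MN(2)] by (simp add: matrix_vector_mult_uminus)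
  then have "\<delta> M *v (C N *v x) = C (M ** N) *v (matrix_inv (C M) *v w)"
    using MN by (simp add: M'_eq mult_cancel_\<Gamma>0)
  then show "matrix_inv (C (M ** N)) *v (\<delta> M *v (C N *v x)) = matrix_inv (C M) *v (\<delta> M *v (C (mat 1) *v x))"
    using MN by (simp add: C_cancel w_def)
qed

text \<open>The test elements \<open>(0, K)\<close> now stand on the left. The case
  \<open>K = mat 1\<close> determines \<open>\<delta> M *v w'\<close>, and \<open>K = N\<close>
  turns this into the claim.\<close>

lemma right_inverse_imp_psi_const:
  assumes "right_inverse_property L"
  shows psi_const
  unfolding psi_const_def
proof (intro ballI allI)
  fix N M x assume MN: "N \<in> \<Gamma>0" "M \<in> \<Gamma>0"
  define w where "w = C M *v x"
  have "\<exists>b\<in>carrier Q. q (w, M) \<otimes>\<^bsub>L\<^esub> q b = \<one>\<^bsub>L\<^esub> \<and>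
      (\<forall>c\<in>carrier Q. (q c \<otimes>\<^bsub>L\<^esub> q (w, M)) \<otimes>\<^bsub>L\<^esub> q b = q c)"
    using assms[unfolded right_inverse_property_def L_carrier', rule_format, of "q (w, M)"] MN
    by (auto simp: Q_simps)
  then obtain w' M' where M': "M' \<in> \<Gamma>0" and one: "(w, M) \<otimes>\<^bsub>Q\<^esub> (w', M') = \<one>\<^bsub>Q\<^esub>"
    and inv: "\<And>c. c \<in> carrier Q \<Longrightarrow> (c \<otimes>\<^bsub>Q\<^esub> (w, M)) \<otimes>\<^bsub>Q\<^esub> (w', M') = c"
    using MN by (auto simp: L_one L_mult Q_closed inj_on_eq_iff[OF inj_q_Q] Q_simps(1,2))
      (metis (no_types, lifting) L_mult Q_closed SigmaI UNIV_I Q_simps(1,2) inj_on_eq_iff[OF inj_q_Q] \<Gamma>0_one)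
  have M'_eq: "M' = matrix_inv M"
    using one MN by (simp add: Q_simps) (metis mult_cancel_\<Gamma>0(3) matrix_mul_rid)
  have eq: "C K *v (matrix_inv (C (K ** M)) *v (\<delta> K *v w)) = - (\<delta> K *v (\<delta> M *v w'))"
    if "K \<in> \<Gamma>0" for K
    using inv[of "(0, K)"] that MN
    by (simp add: Q_simps M'_eq mult_cancel_\<Gamma>0 eq_neg_iff_add_eq_0 flip: matrix_vector_mul_assoc)
  have "\<delta> M *v w' = - (C (mat 1) *v x)"
    using eq[of "mat 1"] MN by (simp add: w_def C_cancel)
  then have "C N *v (matrix_inv (C (N ** M)) *v (\<delta> N *v w)) = \<delta> N *v (C (mat 1) *v x)"
    using eq[OF MN(1)] by (simp add: matrix_vector_mult_uminus)
  then show "matrix_inv (C (N ** M)) *v (\<delta> N *v (C M *v x)) = matrix_inv (C N) *v (\<delta> N *v (C (mat 1) *v x))"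
    using MN by (metis C_cancel(1) w_def)
qed

section \<open>The space behind \<Theta> and the criterion for a constant \<psi>\<close>

text \<open>The preimage under \<open>A\<close> of the maximal subspace that describes \<Theta>: a
  vector \<open>t\<close> lies in it exactly if \<open>gmat \<delta> t (A *v t) (mat 1)\<close> lies
  in \<Theta>.\<close>

definition W where "W = {t. \<forall>M\<in>\<Gamma>0. \<delta> M *v (A *v t) = A *v (M *v t)}"

text \<open>This is the defining condition for \<open>matrix_inv M\<close> in place of
  \<open>M\<close>. In this form it says that \<open>C M\<close> and \<open>C (mat 1)\<close> agree
  on \<open>t\<close> for all \<open>M\<close>.\<close>

lemma W_alt: "t \<in> W \<longleftrightarrow> (\<forall>M\<in>\<Gamma>0. \<delta> M *v (A *v (matrix_inv M *v t)) = A *v t)"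
proof
  assume t: "t \<in> W"
  show "\<forall>M\<in>\<Gamma>0. \<delta> M *v (A *v (matrix_inv M *v t)) = A *v t"
  proof
    fix M assume M: "M \<in> \<Gamma>0"
    then have "matrix_inv (\<delta> M) *v (A *v t) = A *v (matrix_inv M *v t)"
      using t by (auto simp: W_def dest!: bspec[of _ _ "matrix_inv M"])
    then show "\<delta> M *v (A *v (matrix_inv M *v t)) = A *v t"
      using M by (metis \<delta>_closed mult_cancel_\<Gamma>0(8))
  qed
next
  assume *: "\<forall>M\<in>\<Gamma>0. \<delta> M *v (A *v (matrix_inv M *v t)) = A *v t"
  show "t \<in> W" unfolding W_def
  proof (intro CollectI ballI)
    fix M assume M: "M \<in> \<Gamma>0"
    have "matrix_inv (matrix_inv M) = M" using M by (intro matrix_inv_unique) (simp add: mult_cancel_\<Gamma>0)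
    then have "matrix_inv (\<delta> M) *v (A *v (M *v t)) = A *v t"
      using *[rule_format, of "matrix_inv M"] M by simp
    then show "\<delta> M *v (A *v t) = A *v (M *v t)"
      using M by (metis \<delta>_closed mult_cancel_\<Gamma>0(8))
  qed
qed

lemma C_one_vector: "C (mat 1) *v x = B *v x - A *v x"
  by (simp add: C_vector' matrix_inv_mat_1)

lemma W_diff: "s \<in> W \<Longrightarrow> t \<in> W \<Longrightarrow> s - t \<in> W"
  by (simp add: W_def matrix_vector_mult_diff_distrib)

lemma W_zero: "0 \<in> W" by (simp add: W_def)

lemma W_minus: "t \<in> W \<Longrightarrow> - t \<in> W" using W_diff[OF W_zero] by simp

lemma W_add: "s \<in> W \<Longrightarrow> t \<in> W \<Longrightarrow> s + t \<in> W" using W_diff[OF _ W_minus] by force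

lemma W_mult: "M \<in> \<Gamma>0 \<Longrightarrow> t \<in> W \<Longrightarrow> M *v t \<in> W"
  unfolding W_def
proof (intro CollectI ballI, elim CollectE)
  fix N assume MN: "M \<in> \<Gamma>0" "N \<in> \<Gamma>0" and t: "\<forall>M\<in>\<Gamma>0. \<delta> M *v (A *v t) = A *v (M *v t)"
  have "\<delta> N *v (A *v (M *v t)) = \<delta> (N ** M) *v (A *v t)"
    using MN t[rule_format, OF MN(1)] by (simp flip: matrix_vector_mul_assoc)
  also have "\<dots> = A *v (N *v (M *v t))"
    using MN t[rule_format, of "N ** M"] by (simp add: matrix_vector_mul_assoc)
  finally show "\<delta> N *v (A *v (M *v t)) = A *v (N *v (M *v t))" .
qed

text \<open>The vector \<open>N *v z\<close> is the value of
  \<open>psi \<delta> A B N (mat 1)\<close> at \<open>x\<close>. One finds \<open>x = t + z\<close>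
  and \<open>C (N ** M) *v (N *v z) = \<delta> N *v (C (mat 1) *v t + C M *v z)\<close>. Compared
  with \<open>\<delta> N *v (C M *v x)\<close>, this leaves the single condition
  \<open>C M *v t = C (mat 1) *v t\<close>; for all \<open>M\<close> together it means that
  \<open>t\<close> lies in \<open>W\<close>.\<close>

lemma psi_const_pointwise:
  assumes NM: "N \<in> \<Gamma>0" "M \<in> \<Gamma>0" and z: "z = matrix_inv N *v (matrix_inv (C N) *v (\<delta> N *v (C (mat 1) *v x)))"
    and t: "t = matrix_inv (C (mat 1)) *v (matrix_inv (\<delta> N) *v (B *v (N *v z)) - B *v z)"
  shows "matrix_inv (C (N ** M)) *v (\<delta> N *v (C M *v x)) = matrix_inv (C N) *v (\<delta> N *v (C (mat 1) *v x)) \<longleftrightarrow>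
    \<delta> M *v (A *v (matrix_inv M *v t)) = A *v t"
proof -
  have Ct: "C (mat 1) *v t = matrix_inv (\<delta> N) *v (B *v (N *v z)) - B *v z"
    unfolding t by (simp add: C_cancel)
  have Nz: "N *v z = matrix_inv (C N) *v (\<delta> N *v (C (mat 1) *v x))"
    using NM by (simp add: z mult_cancel_\<Gamma>0)
  have "C N *v (N *v z) = \<delta> N *v (C (mat 1) *v x)"
    using NM by (simp add: Nz C_cancel)
  then have "B *v (N *v z) - \<delta> N *v (A *v z) = \<delta> N *v (C (mat 1) *v x)"
    using NM by (simp add: C_vector)
  then have "matrix_inv (\<delta> N) *v (B *v (N *v z)) - A *v z = C (mat 1) *v x"
    using NM by (metis \<delta>_closed mult_cancel_\<Gamma>0(7) matrix_vector_mult_diff_distrib)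
  \<comment> \<open>Subtracting and adding \<open>B *v z\<close> splits the left side of the
    previous equation into \<open>C (mat 1) *v t\<close> and \<open>C (mat 1) *v z\<close>.\<close>
  then have "C (mat 1) *v x = C (mat 1) *v (t + z)"
    unfolding matrix_vector_right_distrib Ct by (simp add: C_one_vector)
  then have x: "x = t + z" by (simp add: invertible_vector_cancel)
  have "B *v (N *v z) = \<delta> N *v (C (mat 1) *v t + B *v z)"
    using NM by (simp add: Ct mult_cancel_\<Gamma>0)
  then have "C (N ** M) *v (N *v z) = \<delta> N *v (C (mat 1) *v t + C M *v z)"
    using NM by (simp add: C_vector' matrix_inv_mult mult_cancel_\<Gamma>0 matrix_vector_right_distrib
        matrix_vector_mult_diff_distrib flip: matrix_vector_mul_assoc)
  then have "matrix_inv (C (N ** M)) *v (\<delta> N *v (C M *v x)) = N *v z \<longleftrightarrow>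
      \<delta> N *v (C M *v x) = \<delta> N *v (C (mat 1) *v t + C M *v z)"
    using NM by (metis C_cancel \<Gamma>0_mult)
  also have "\<dots> \<longleftrightarrow> C M *v t = C (mat 1) *v t"
    using NM by (simp add: invertible_vector_cancel x matrix_vector_right_distrib)
  also have "\<dots> \<longleftrightarrow> \<delta> M *v (A *v (matrix_inv M *v t)) = A *v t"
    by (simp add: C_vector' matrix_inv_mat_1)
  finally show ?thesis by (simp add: Nz)
qed

text \<open>The value is the vector \<open>y\<close> with
  \<open>B *v y - A *v y = B *v (M *v x) - \<delta> M *v (B *v x)\<close>. The right side measures
  how far \<open>B\<close> is from intertwining \<open>M\<close> and \<open>\<delta> M\<close>;
  passing to \<open>y\<close> makes \<open>gmat \<delta> y (A *v y) (mat 1)\<close> an element of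
  both \<open>H\<close> and the normal closure of \<open>TB\<close>.\<close>

definition B_defect where
  "B_defect M x = matrix_inv (C (mat 1)) *v (B *v (M *v x) - \<delta> M *v (B *v x))"

text \<open>For fixed \<open>N\<close> the vectors \<open>x\<close> and \<open>z\<close> of the
  pointwise criterion correspond bijectively, so the condition may be quantified over
  \<open>z\<close>. Putting \<open>N = matrix_inv M\<close> and \<open>z = M *v x\<close> then
  produces the negative of the defect, and \<open>W\<close> is closed under negation.\<close>

lemma psi_const_iff: "psi_const \<longleftrightarrow> (\<forall>M\<in>\<Gamma>0. \<forall>x. B_defect M x \<in> W)"
proof -
  let ?t = "\<lambda>N z. matrix_inv (C (mat 1)) *v (matrix_inv (\<delta> N) *v (B *v (N *v z)) - B *v z)"
  let ?z = "\<lambda>N x. matrix_inv N *v (matrix_inv (C N) *v (\<delta> N *v (C (mat 1) *v x)))"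
  let ?x = "\<lambda>N z. matrix_inv (C (mat 1)) *v (matrix_inv (\<delta> N) *v (C N *v (N *v z)))"
  have "psi_const \<longleftrightarrow> (\<forall>N\<in>\<Gamma>0. \<forall>x. ?t N (?z N x) \<in> W)"
    unfolding psi_const_def W_alt using psi_const_pointwise[OF _ _ refl refl] by auto
  also have "\<dots> \<longleftrightarrow> (\<forall>N\<in>\<Gamma>0. \<forall>z. ?t N z \<in> W)"
  proof -
    have "?z N (?x N z) = z" if "N \<in> \<Gamma>0" for N z
      using that by (simp add: C_cancel mult_cancel_\<Gamma>0)
    then show ?thesis by metis
  qed
  also have "\<dots> \<longleftrightarrow> (\<forall>M\<in>\<Gamma>0. \<forall>x. B_defect M x \<in> W)"
  proof -
    have *: "?t (matrix_inv M) (M *v x) = - B_defect M x" if "M \<in> \<Gamma>0" for M x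
    proof -
      have "matrix_inv (matrix_inv (\<delta> M)) = \<delta> M"
        using that by (intro matrix_inv_unique) (simp add: mult_cancel_\<Gamma>0)
      then show ?thesis using that
        by (simp add: B_defect_def mult_cancel_\<Gamma>0 flip: matrix_vector_mult_uminus)
    qed
    have **: "?t N z = - B_defect (matrix_inv N) (N *v z)" if "N \<in> \<Gamma>0" for N z
      using that by (simp add: B_defect_def mult_cancel_\<Gamma>0 flip: matrix_vector_mult_uminus)
    show ?thesis using * ** by (metis W_minus \<Gamma>0_inv minus_minus)
  qed
  finally show ?thesis .
qed

end

section \<open>Normal closures and left multiplication groups\<close>

lemma restrict_coset_simps:
  "x <#\<^bsub>G\<lparr>carrier := S\<rparr>\<^esub> K = x <#\<^bsub>G\<^esub> K" "K #>\<^bsub>G\<lparr>carrier := S\<rparr>\<^esub> x = K #>\<^bsub>G\<^esub> x"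
  "K <#>\<^bsub>G\<lparr>carrier := S\<rparr>\<^esub> K' = K <#>\<^bsub>G\<^esub> K'"
  by (simp_all add: l_coset_def r_coset_def set_mult_def)

lemma set_multI: "a \<in> K \<Longrightarrow> b \<in> K' \<Longrightarrow> a \<otimes>\<^bsub>G\<^esub> b \<in> K <#>\<^bsub>G\<^esub> K'"
  by (auto simp: set_mult_def)

lemma (in group) normal_Inter:
  assumes "\<And>N. N \<in> \<N> \<Longrightarrow> N \<lhd> G" "\<N> \<noteq> {}"
  shows "\<Inter>\<N> \<lhd> G"
  using assms subgroups_Inter[of \<N>] by (auto simp: normal_inv_iff)

lemma (in group) carrier_normal: "carrier G \<lhd> G"
  by (auto simp: normal_inv_iff subgroup_self)

lemma (in group) normal_closure_normal: "S \<subseteq> carrier G \<Longrightarrow> normal_closure G S \<lhd> G"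
  unfolding normal_closure_def by (rule normal_Inter) (use carrier_normal in auto)

lemma normal_closure_superset: "S \<subseteq> normal_closure G S"
  by (auto simp: normal_closure_def)

lemma normal_closure_least: "N \<lhd> G \<Longrightarrow> S \<subseteq> N \<Longrightarrow> normal_closure G S \<subseteq> N"
  by (auto simp: normal_closure_def)

lemma (in group) lcos_eq_iff:
  assumes "subgroup K G" "x \<in> carrier G" "y \<in> carrier G"
  shows "x <# K = y <# K \<longleftrightarrow> inv x \<otimes> y \<in> K"
proof
  assume "x <# K = y <# K"
  then have "y \<in> x <# K" using lcos_self assms by blast
  then show "inv x \<otimes> y \<in> K" using subgroup.lcos_module_imp[OF assms(1) is_group assms(2)] by blast
next
  assume "inv x \<otimes> y \<in> K"
  then have "y \<in> x <# K" using subgroup.lcos_module_rev[OF assms(1) is_group] assms by blast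
  then show "x <# K = y <# K" using l_repr_independence assms by blast
qed

context loop_setup
begin

abbreviation "TB' \<equiv> normal_closure \<Gamma> TB"
abbreviation "\<Delta>' \<equiv> TB' <#>\<^bsub>\<Gamma>\<^esub> Gam0' \<Gamma>0 \<delta>"
abbreviation "\<Theta> \<equiv> normal_core \<Gamma> H"

section \<open>The normal closure of \<open>TB\<close> and the group \<Delta>'\<close>

definition S :: "'k^'n \<Rightarrow> 'k^'n \<Rightarrow> bool" where
  "S a b \<longleftrightarrow> gmat \<delta> a b (mat 1) \<in> TB'"

lemma TB'_normal: "TB' \<lhd> \<Gamma>"
  by (rule \<Gamma>.normal_closure_normal[OF subgroup.subset[OF subgroup_graph_group]])

text \<open>All translations form a normal subgroup that contains \<open>TB\<close>, so the normal
  closure contains nothing else.\<close>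

lemma TB'_eq: "TB' = {gmat \<delta> a b (mat 1) | a b. S a b}"
proof -
  have "{gmat \<delta> a b (mat 1) | a b. True} \<lhd> \<Gamma>"
    using translation_normal_iff[where P = "\<lambda>a b. True"] by simp
  then have "TB' \<subseteq> {gmat \<delta> a b (mat 1) | a b. True}"
    by (rule normal_closure_least) (auto simp: graph_group_def)
  then show ?thesis unfolding S_def by blast
qed

lemma S_zero: "S 0 0" and S_diff: "S a b \<Longrightarrow> S c d \<Longrightarrow> S (a - c) (b - d)"
  and S_mult: "M \<in> \<Gamma>0 \<Longrightarrow> S a b \<Longrightarrow> S (M *v a) (\<delta> M *v b)"
  using TB'_normal unfolding TB'_eq translation_normal_iff by blast+

lemma S_minus: "S a b \<Longrightarrow> S (- a) (- b)" using S_diff[OF S_zero] by simp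

lemma S_add: "S a b \<Longrightarrow> S c d \<Longrightarrow> S (a + c) (b + d)" using S_diff[OF _ S_minus] by force

lemma S_B: "S x (B *v x)"
  using normal_closure_superset[of TB \<Gamma>] by (auto simp: S_def graph_group_def)

text \<open>The element of \<open>TB\<close> at \<open>M *v x\<close> and the conjugate by
  \<open>M\<close> of the one at \<open>x\<close> share their first vector; their quotient keeps
  only the difference of the second vectors.\<close>

lemma S_defect: "M \<in> \<Gamma>0 \<Longrightarrow> S 0 (B *v (M *v x) - \<delta> M *v (B *v x))"
  using S_diff[OF S_B S_mult[OF _ S_B], of M "M *v x" x] by simp

lemma Delta'_eq: "\<Delta>' = {gmat \<delta> a b M | a b M. S a b \<and> M \<in> \<Gamma>0}"
proof
  show "\<Delta>' \<subseteq> {gmat \<delta> a b M | a b M. S a b \<and> M \<in> \<Gamma>0}"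
    unfolding TB'_eq by (auto simp: set_mult_def Gam0'_def \<Gamma>_simps(2) gmat_eq_iff)
  show "{gmat \<delta> a b M | a b M. S a b \<and> M \<in> \<Gamma>0} \<subseteq> \<Delta>'"
  proof clarify
    fix a b M assume "S a b" "M \<in> \<Gamma>0"
    then have "gmat \<delta> a b M = gmat \<delta> a b (mat 1) \<otimes>\<^bsub>\<Gamma>\<^esub> gmat \<delta> 0 0 M"
      by (simp add: \<Gamma>_simps(2))
    moreover have "gmat \<delta> a b (mat 1) \<in> TB'" "gmat \<delta> 0 0 M \<in> Gam0' \<Gamma>0 \<delta>"
      using \<open>S a b\<close> \<open>M \<in> \<Gamma>0\<close> by (auto simp: S_def Gam0'_def)
    ultimately show "gmat \<delta> a b M \<in> \<Delta>'" unfolding set_mult_def by blast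
  qed
qed

lemma gmat_Delta': "M \<in> \<Gamma>0 \<Longrightarrow> gmat \<delta> a b M \<in> \<Delta>' \<longleftrightarrow> S a b"
  by (auto simp: Delta'_eq gmat_eq_iff)

lemma subgroup_Delta': "subgroup \<Delta>' \<Gamma>"
proof (rule \<Gamma>.subgroupI)
  show "\<Delta>' \<subseteq> carrier \<Gamma>" by (auto simp: Delta'_eq)
  show "\<Delta>' \<noteq> {}" using gmat_Delta'[OF \<Gamma>0_one, of 0 0] S_zero by blast
next
  fix x assume "x \<in> \<Delta>'"
  then obtain a b M where x: "x = gmat \<delta> a b M" "S a b" "M \<in> \<Gamma>0" by (auto simp: Delta'_eq)
  then show "inv\<^bsub>\<Gamma>\<^esub> x \<in> \<Delta>'"
    using S_minus[OF S_mult[of "matrix_inv M" a b]] by (simp add: gmat_inv gmat_Delta')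
next
  fix x y assume "x \<in> \<Delta>'" "y \<in> \<Delta>'"
  then obtain a b M c d N where x: "x = gmat \<delta> a b M" "S a b" "M \<in> \<Gamma>0"
    and y: "y = gmat \<delta> c d N" "S c d" "N \<in> \<Gamma>0" by (auto simp: Delta'_eq)
  then show "x \<otimes>\<^bsub>\<Gamma>\<^esub> y \<in> \<Delta>'"
    using S_add[OF x(2) S_mult[OF x(3) y(2)]] by (simp add: \<Gamma>_simps(2) gmat_Delta')
qed

lemma subgroup_Gam0': "subgroup (Gam0' \<Gamma>0 \<delta>) \<Gamma>"
proof (rule \<Gamma>.subgroupI)
  fix x assume "x \<in> Gam0' \<Gamma>0 \<delta>"
  then show "inv\<^bsub>\<Gamma>\<^esub> x \<in> Gam0' \<Gamma>0 \<delta>" by (auto simp: Gam0'_def gmat_inv gmat_eq_iff)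
next
  fix x y assume "x \<in> Gam0' \<Gamma>0 \<delta>" "y \<in> Gam0' \<Gamma>0 \<delta>"
  then show "x \<otimes>\<^bsub>\<Gamma>\<^esub> y \<in> Gam0' \<Gamma>0 \<delta>" by (auto simp: Gam0'_def \<Gamma>_simps(2) gmat_eq_iff)
next
  have "gmat \<delta> 0 0 (mat 1) \<in> Gam0' \<Gamma>0 \<delta>" unfolding Gam0'_def using \<Gamma>0_one by blast
  then show "Gam0' \<Gamma>0 \<delta> \<noteq> {}" by blast
qed (auto simp: Gam0'_def)

lemma Xi_subset_Delta': "\<Xi> \<subseteq> \<Delta>'"
  using S_B by (auto simp: Xi_eq gmat_Delta')

text \<open>The generated group contains the matrices with both vectors 0 as well as
  \<open>TB\<close>. Since conjugation acts on translations through the matrix part alone,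
  invariance under those matrices is normality in \<Gamma>; so its translations form a normal
  subgroup above \<open>TB\<close>, hence above \<open>TB'\<close>.\<close>

lemma generate_Xi: "generate \<Gamma> \<Xi> = \<Delta>'"
proof
  show "generate \<Gamma> \<Xi> \<subseteq> \<Delta>'"
    by (rule \<Gamma>.generate_subgroup_incl[OF Xi_subset_Delta' subgroup_Delta'])
  define K where "K = generate \<Gamma> \<Xi>"
  have "\<Xi> \<subseteq> carrier \<Gamma>" using Xi_subset_Delta' subgroup.subset[OF subgroup_Delta'] by blast
  then interpret K: subgroup K \<Gamma> unfolding K_def by (rule \<Gamma>.generate_is_subgroup)
  have XiK: "\<Xi> \<subseteq> K" unfolding K_def by (auto intro: generate.incl)
  have Gam0K: "gmat \<delta> 0 0 M \<in> K" if "M \<in> \<Gamma>0" for M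
  proof -
    have "gmat \<delta> 0 (B *v 0) M \<in> \<Xi>" unfolding Xi_eq using that by blast
    then show ?thesis using XiK by auto
  qed
  let ?P = "\<lambda>a b. gmat \<delta> a b (mat 1) \<in> K"
  let ?N = "{gmat \<delta> a b (mat 1) | a b. ?P a b}"
  have "?N \<lhd> \<Gamma>"
    unfolding translation_normal_iff
  proof (intro conjI allI impI ballI)
    show "?P 0 0" using Gam0K by simp
    show "?P (a - c) (b - d)" if "?P a b" "?P c d" for a b c d
      using K.m_closed[OF that(1) K.m_inv_closed[OF that(2)]]
      by (simp add: gmat_inv \<Gamma>_simps(2) matrix_inv_mat_1)
    show "?P (M *v a) (\<delta> M *v b)" if "M \<in> \<Gamma>0" "?P a b" for M a b
      using K.m_closed[OF K.m_closed[OF Gam0K[OF that(1)] that(2)] K.m_inv_closed[OF Gam0K[OF that(1)]]]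
      by (simp add: gmat_conj that(1))
  qed
  moreover have "TB \<subseteq> ?N"
  proof
    fix x assume "x \<in> TB"
    then obtain u where u: "x = gmat \<delta> u (B *v u) (mat 1)" by (auto simp: graph_group_def)
    then have "x \<in> \<Xi>" unfolding Xi_eq using \<Gamma>0_one by blast
    then show "x \<in> ?N" using XiK u by blast
  qed
  ultimately have "TB' \<subseteq> ?N" by (rule normal_closure_least)
  then have "?P a b" if "S a b" for a b using that by (auto simp: S_def gmat_eq_iff)
  then have "gmat \<delta> a b M \<in> K" if "S a b" "M \<in> \<Gamma>0" for a b M
    using K.m_closed[OF _ Gam0K[OF that(2)], of "gmat \<delta> a b (mat 1)"] that by (simp add: \<Gamma>_simps(2))
  then show "\<Delta>' \<subseteq> generate \<Gamma> \<Xi>" unfolding K_def[symmetric] by (auto simp: Delta'_eq)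
qed

lemma semidirect_Delta': "semidirect (\<Gamma>\<lparr>carrier := \<Delta>'\<rparr>) TB' (Gam0' \<Gamma>0 \<delta>)"
proof (rule group.semidirectI)
  show "group (\<Gamma>\<lparr>carrier := \<Delta>'\<rparr>)"
    by (rule subgroup.subgroup_is_group[OF subgroup_Delta' group_\<Gamma>])
  have "TB' \<subseteq> \<Delta>'"
  proof
    fix x assume "x \<in> TB'"
    then obtain a b where "x = gmat \<delta> a b (mat 1)" "S a b" unfolding TB'_eq by blast
    then show "x \<in> \<Delta>'" by (simp add: gmat_Delta')
  qed
  then show "TB' \<lhd> \<Gamma>\<lparr>carrier := \<Delta>'\<rparr>"
    by (rule \<Gamma>.normal_restrict_supergroup[OF subgroup_Delta' TB'_normal])
  have "Gam0' \<Gamma>0 \<delta> \<subseteq> \<Delta>'"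
  proof
    fix x assume "x \<in> Gam0' \<Gamma>0 \<delta>"
    then obtain M where "x = gmat \<delta> 0 0 M" "M \<in> \<Gamma>0" by (auto simp: Gam0'_def)
    then show "x \<in> \<Delta>'" using S_zero by (simp add: gmat_Delta')
  qed
  then show "subgroup (Gam0' \<Gamma>0 \<delta>) (\<Gamma>\<lparr>carrier := \<Delta>'\<rparr>)"
    by (rule \<Gamma>.subgroup_incl[OF subgroup_Gam0' subgroup_Delta'])
  show "carrier (\<Gamma>\<lparr>carrier := \<Delta>'\<rparr>) = TB' <#>\<^bsub>\<Gamma>\<lparr>carrier := \<Delta>'\<rparr>\<^esub> Gam0' \<Gamma>0 \<delta>"
    by (simp add: restrict_coset_simps)
  show "TB' \<inter> Gam0' \<Gamma>0 \<delta> = {\<one>\<^bsub>\<Gamma>\<lparr>carrier := \<Delta>'\<rparr>\<^esub>}"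
    using S_zero by (auto simp: TB'_eq Gam0'_def gmat_eq_iff \<Gamma>_one)
qed

text \<open>The defects \<open>B *v (M0 *v x) - \<delta> M0 *v (B *v x)\<close> now range over all
  vectors, so \<open>TB'\<close> contains every pair \<open>(0, y)\<close>. Adding pairs
  \<open>(x, B *v x)\<close> reaches everything.\<close>

lemma no_eigenvalue_Delta':
  assumes M0: "M0 \<in> \<Gamma>0" and ne: "\<not> has_eigenvalue (matrix_inv M0 ** matrix_inv B ** \<delta> M0 ** B) 1"
  shows "TB' = {gmat \<delta> u v (mat 1) | u v. True}" "\<Delta>' = carrier \<Gamma>"
proof -
  have inv: "invertible (B ** M0 - \<delta> M0 ** B)"
    by (rule not_eigenvalue_1_invertible[OF _ B_inv ne]) (use M0 in simp)
  have "S 0 y" for y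
    using S_defect[OF M0, of "matrix_inv (B ** M0 - \<delta> M0 ** B) *v y"] matrix_inv_vector(2)[OF inv, of y]
    by (simp add: matrix_vector_mul_assoc matrix_mul_assoc matrix_vector_mult_diff_rdistrib matrix_diff_mult)
  then have "S x y" for x y using S_add[OF S_B[of x], of 0 "y - B *v x"] by simp
  then show "TB' = {gmat \<delta> u v (mat 1) | u v. True}" "\<Delta>' = carrier \<Gamma>"
    unfolding Delta'_eq by (simp_all add: TB'_eq \<Gamma>_simps)
qed

section \<open>The largest normal subgroup inside \<open>H\<close>\<close>

text \<open>A normal subgroup inside \<open>H\<close> contains the conjugate
  \<open>(M *v a, \<delta> M *v (A *v a))\<close> of each of its pairs \<open>(a, A *v a)\<close>.
  As this must again lie on the graph of \<open>A\<close>, the vector \<open>a\<close> is in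
  \<open>W\<close>. The subgroup belonging to all of \<open>W\<close> is itself normal, so the union
  defining \<Theta> is one of its members.\<close>

lemma Theta_eq: "\<Theta> = {gmat \<delta> a b (mat 1) | a b. b = A *v a \<and> a \<in> W}" (is "_ = ?T")
  and Theta_normal: "\<Theta> \<lhd> \<Gamma>"
proof -
  have T: "?T \<lhd> \<Gamma>"
    unfolding translation_normal_iff
    using W_zero W_diff W_mult by (auto simp: matrix_vector_mult_diff_distrib W_def)
  moreover have "?T \<subseteq> H" by (auto simp: graph_group_def)
  moreover have "N \<subseteq> ?T" if N: "N \<lhd> \<Gamma>" "N \<subseteq> H" for N
  proof
    fix x assume x: "x \<in> N"
    then obtain a where a: "x = gmat \<delta> a (A *v a) (mat 1)" using N by (auto simp: graph_group_def)
    have "\<delta> M *v (A *v a) = A *v (M *v a)" if M: "M \<in> \<Gamma>0" for M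
    proof -
      have "gmat \<delta> (M *v a) (\<delta> M *v (A *v a)) (mat 1) \<in> N"
        using N(1)[unfolded \<Gamma>.normal_inv_iff, THEN conjunct2, rule_format, of "gmat \<delta> 0 0 M" x] x M
        by (simp add: a gmat_conj)
      then show ?thesis using N(2) by (auto simp: graph_group_def gmat_eq_iff)
    qed
    then show "x \<in> ?T" using a by (auto simp: W_def)
  qed
  ultimately show "\<Theta> = ?T" unfolding normal_core_def by blast
  with T show "\<Theta> \<lhd> \<Gamma>" by simp
qed

lemma Theta_subset: "\<Theta> \<subseteq> H"
  unfolding Theta_eq by (auto simp: graph_group_def)

text \<open>The condition on \<open>v\<close> is linear for each \<open>M\<close>, so the set of all
  its solutions is the maximal subspace; it is the image of \<open>W\<close> under
  \<open>A\<close>.\<close>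

lemma Theta_subspace:
  "\<exists>V. greatest_subspace (\<lambda>v. \<forall>M\<in>\<Gamma>0. \<delta> M *v v = (A ** M ** matrix_inv A) *v v) V \<and>
    \<Theta> = {gmat \<delta> v (A *v v) (mat 1) | v. A *v v \<in> V}"
proof (intro exI conjI)
  let ?V = "{v. \<forall>M\<in>\<Gamma>0. \<delta> M *v v = (A ** M ** matrix_inv A) *v v}"
  show "greatest_subspace (\<lambda>v. \<forall>M\<in>\<Gamma>0. \<delta> M *v v = (A ** M ** matrix_inv A) *v v) ?V"
    by (auto simp: greatest_subspace_def vec.subspace_def matrix_vector_right_distrib vec.scale)
  have "A *v v \<in> ?V \<longleftrightarrow> v \<in> W" for v
    by (simp add: W_def matrix_inv_vector[OF A_inv] flip: matrix_vector_mul_assoc)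
  then show "\<Theta> = {gmat \<delta> v (A *v v) (mat 1) | v. A *v v \<in> ?V}"
    by (auto simp: Theta_eq)
qed

section \<open>When the loop is a group\<close>

lemma TB_normal_iff: "TB \<lhd> \<Gamma> \<longleftrightarrow> (\<forall>M\<in>\<Gamma>0. \<forall>x. B_defect M x = 0)"
proof -
  have "B_defect M x = 0 \<longleftrightarrow> \<delta> M *v (B *v x) = B *v (M *v x)" for M x
    using invertible_vector_cancel[OF invertible_matrix_inv[OF C_invertible[OF \<Gamma>0_one]],
        of "B *v (M *v x) - \<delta> M *v (B *v x)" 0]
    unfolding B_defect_def by (metis eq_iff_diff_eq_0 matrix_vector_mult_0_right)
  then show ?thesis by (simp add: graph_group_normal_iff)
qed

lemma matrix_inv_intertwine:
  fixes X Y D :: "'a::field^'m^'m"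
  assumes "invertible D"
  shows "matrix_inv D ** X = Y ** matrix_inv D \<longleftrightarrow> X ** D = D ** Y"
proof
  assume "matrix_inv D ** X = Y ** matrix_inv D"
  then have "D ** (matrix_inv D ** X) ** D = D ** (Y ** matrix_inv D) ** D" by simp
  also have "D ** (matrix_inv D ** X) ** D = (D ** matrix_inv D) ** X ** D" by (simp only: matrix_mul_assoc)
  also have "D ** (Y ** matrix_inv D) ** D = D ** Y ** (matrix_inv D ** D)" by (simp only: matrix_mul_assoc)
  finally show "X ** D = D ** Y" by (simp add: assms matrix_inv_left matrix_inv_right)
next
  assume "X ** D = D ** Y"
  then have "matrix_inv D ** (X ** D) ** matrix_inv D = matrix_inv D ** (D ** Y) ** matrix_inv D" by simp
  also have "matrix_inv D ** (X ** D) ** matrix_inv D = matrix_inv D ** X ** (D ** matrix_inv D)"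
    by (simp only: matrix_mul_assoc)
  also have "matrix_inv D ** (D ** Y) ** matrix_inv D = (matrix_inv D ** D) ** Y ** matrix_inv D"
    by (simp only: matrix_mul_assoc)
  finally show "matrix_inv D ** X = Y ** matrix_inv D" by (simp add: assms matrix_inv_left matrix_inv_right)
qed

text \<open>Both sides say that \<open>\<delta> M ** B = B ** M\<close> for all \<open>M\<close>;
  the set on the left is nonempty because \<open>mat 1\<close> belongs to
  \<open>\<Gamma>0\<close>.\<close>

lemma conjugates_eq_iff:
  "{matrix_inv M ** matrix_inv B ** \<delta> M | M. M \<in> \<Gamma>0} = {matrix_inv B} \<longleftrightarrow> TB \<lhd> \<Gamma>"
proof -
  have "{matrix_inv M ** matrix_inv B ** \<delta> M | M. M \<in> \<Gamma>0} = {matrix_inv B} \<longleftrightarrow>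
      (\<forall>M\<in>\<Gamma>0. matrix_inv M ** matrix_inv B ** \<delta> M = matrix_inv B)"
  proof
    assume *: "\<forall>M\<in>\<Gamma>0. matrix_inv M ** matrix_inv B ** \<delta> M = matrix_inv B"
    then have "(\<lambda>M. matrix_inv M ** matrix_inv B ** \<delta> M) ` \<Gamma>0 = (\<lambda>M. matrix_inv B) ` \<Gamma>0"
      by (intro image_cong) auto
    also have "\<dots> = {matrix_inv B}" by (rule image_constant[OF \<Gamma>0_one])
    finally show "{matrix_inv M ** matrix_inv B ** \<delta> M | M. M \<in> \<Gamma>0} = {matrix_inv B}"
      unfolding Setcompr_eq_image .
  qed blast
  also have "\<dots> \<longleftrightarrow> (\<forall>M\<in>\<Gamma>0. \<delta> M ** B = B ** M)"
  proof (rule ball_cong[OF refl])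
    fix M assume M: "M \<in> \<Gamma>0"
    have "matrix_inv M ** matrix_inv B ** \<delta> M = matrix_inv B \<longleftrightarrow> matrix_inv B ** \<delta> M = M ** matrix_inv B"
      using M by (metis matrix_mul_assoc mult_cancel_\<Gamma>0(3,4))
    also have "\<dots> \<longleftrightarrow> \<delta> M ** B = B ** M"
      by (rule matrix_inv_intertwine[OF B_inv])
    finally show "matrix_inv M ** matrix_inv B ** \<delta> M = matrix_inv B \<longleftrightarrow> \<delta> M ** B = B ** M" .
  qed
  also have "\<dots> \<longleftrightarrow> TB \<lhd> \<Gamma>"
    by (simp add: graph_group_normal_iff matrix_eq flip: matrix_vector_mul_assoc)
  finally show ?thesis .
qed

lemma TB_normal_imp_group: "TB \<lhd> \<Gamma> \<Longrightarrow> group L"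
  by (simp add: TB_normal_iff group_L_iff psi_const_iff W_zero)

text \<open>If \<open>L\<close> is a group, every defect \<open>y\<close> lies in \<open>W\<close>,
  which puts \<open>gmat \<delta> y (A *v y) (mat 1)\<close> into \<Theta>. The same element lies in
  \<open>TB'\<close>, so the trivial intersection forces \<open>y = 0\<close>.\<close>

lemma group_imp_TB_normal:
  assumes "\<Theta> \<inter> \<Delta>' = {\<one>\<^bsub>\<Gamma>\<^esub>}" "group L"
  shows "TB \<lhd> \<Gamma>"
  unfolding TB_normal_iff
proof (intro ballI allI)
  fix M x assume M: "M \<in> \<Gamma>0"
  let ?y = "B_defect M x"
  have y: "?y \<in> W" using assms(2) M by (simp add: group_L_iff psi_const_iff)
  have "C (mat 1) *v ?y = B *v (M *v x) - \<delta> M *v (B *v x)"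
    by (simp add: B_defect_def C_cancel)
  then have "S 0 (B *v ?y - A *v ?y)" using S_defect[OF M, of x] by (simp add: C_one_vector)
  then have "S ?y (A *v ?y)" using S_diff[OF S_B[of ?y], of 0 "B *v ?y - A *v ?y"] by simp
  then have "gmat \<delta> ?y (A *v ?y) (mat 1) \<in> \<Theta> \<inter> \<Delta>'"
    using y by (auto simp: Theta_eq gmat_Delta')
  then show "?y = 0" using assms(1) by (simp add: \<Gamma>_one gmat_eq_iff)
qed

text \<open>A product of the elements of \<open>TB\<close> at \<open>x\<close> and of \<Theta> at
  \<open>y\<close> has vectors \<open>a\<close>, \<open>b\<close> with
  \<open>B *v a - b = C (mat 1) *v y\<close>. So \<open>y\<close> can be recovered from the pair,
  and membership is a condition on it.\<close>

lemma TB_Theta_eq: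
  "TB <#>\<^bsub>\<Gamma>\<^esub> \<Theta> = {gmat \<delta> a b (mat 1) | a b. matrix_inv (C (mat 1)) *v (B *v a - b) \<in> W}"
proof -
  have "TB <#>\<^bsub>\<Gamma>\<^esub> \<Theta> = {gmat \<delta> (x + y) (B *v x + A *v y) (mat 1) | x y. y \<in> W}"
  proof (intro equalityI subsetI)
    fix g assume "g \<in> TB <#>\<^bsub>\<Gamma>\<^esub> \<Theta>"
    then show "g \<in> {gmat \<delta> (x + y) (B *v x + A *v y) (mat 1) | x y. y \<in> W}"
      unfolding Theta_eq by (auto simp: set_mult_def graph_group_def \<Gamma>_simps(2) gmat_eq_iff) blast
  next
    fix g assume "g \<in> {gmat \<delta> (x + y) (B *v x + A *v y) (mat 1) | x y. y \<in> W}"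
    then obtain x y where g: "g = gmat \<delta> x (B *v x) (mat 1) \<otimes>\<^bsub>\<Gamma>\<^esub> gmat \<delta> y (A *v y) (mat 1)" "y \<in> W"
      by (auto simp: \<Gamma>_simps(2))
    show "g \<in> TB <#>\<^bsub>\<Gamma>\<^esub> \<Theta>"
      unfolding g(1)
    proof (rule set_multI)
      show "gmat \<delta> x (B *v x) (mat 1) \<in> TB" unfolding graph_group_alt by blast
      show "gmat \<delta> y (A *v y) (mat 1) \<in> \<Theta>" unfolding Theta_eq using g(2) by blast
    qed
  qed
  also have "\<dots> = {gmat \<delta> a b (mat 1) | a b. matrix_inv (C (mat 1)) *v (B *v a - b) \<in> W}"
  proof (intro equalityI subsetI; elim CollectE exE conjE)
    fix g x y assume g: "g = gmat \<delta> (x + y) (B *v x + A *v y) (mat 1)" "y \<in> W"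
    have "B *v (x + y) - (B *v x + A *v y) = C (mat 1) *v y"
      by (simp add: C_one_vector matrix_vector_right_distrib)
    then show "g \<in> {gmat \<delta> a b (mat 1) | a b. matrix_inv (C (mat 1)) *v (B *v a - b) \<in> W}"
      using g C_cancel(1)[OF \<Gamma>0_one, of y] by (auto simp: gmat_eq_iff)
  next
    fix g a b assume g: "g = gmat \<delta> a b (mat 1)" and W: "matrix_inv (C (mat 1)) *v (B *v a - b) \<in> W"
    define y where "y = matrix_inv (C (mat 1)) *v (B *v a - b)"
    have "B *v y - A *v y = B *v a - b"
      unfolding C_one_vector[symmetric] by (simp add: y_def C_cancel)
    then have "b = B *v (a - y) + A *v y" by (simp add: matrix_vector_mult_diff_distrib algebra_simps)
    then have "g = gmat \<delta> ((a - y) + y) (B *v (a - y) + A *v y) (mat 1)" by (simp add: g)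
    then show "g \<in> {gmat \<delta> (x + y) (B *v x + A *v y) (mat 1) | x y. y \<in> W}"
      using W unfolding y_def[symmetric] by blast
  qed
  finally show ?thesis .
qed

text \<open>Conjugating the pair \<open>(a, b)\<close> by \<open>M\<close> changes its vector
  \<open>y = ?D a b\<close> into \<open>B_defect M a - B_defect M y + M *v y\<close>, which lies in
  \<open>W\<close> if all defects do. Conversely, conjugates of elements of \<open>TB\<close> have
  the defects themselves as their vectors.\<close>

lemma group_iff_TB_Theta_normal: "group L \<longleftrightarrow> (TB <#>\<^bsub>\<Gamma>\<^esub> \<Theta>) \<lhd> \<Gamma>"
proof -
  let ?D = "\<lambda>a b. matrix_inv (C (mat 1)) *v (B *v a - b)"
  have "?D (M *v a) (\<delta> M *v b) \<in> W"
    if M: "M \<in> \<Gamma>0" and D: "?D a b \<in> W" and defect: "B_defect M a \<in> W" "B_defect M (?D a b) \<in> W" for M a b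
  proof -
    define y where "y = ?D a b"
    have "b = B *v a - C (mat 1) *v y" by (simp add: C_cancel y_def)
    moreover have "\<delta> M *v (A *v y) = A *v (M *v y)" using M D by (simp add: W_def y_def)
    ultimately have "\<delta> M *v b = \<delta> M *v (B *v a) - \<delta> M *v (B *v y) + A *v (M *v y)"
      by (simp add: matrix_vector_mult_diff_distrib C_one_vector)
    then have "B *v (M *v a) - \<delta> M *v b = (B *v (M *v a) - \<delta> M *v (B *v a)) -
        (B *v (M *v y) - \<delta> M *v (B *v y)) + C (mat 1) *v (M *v y)"
      by (simp add: C_one_vector)
    then have "?D (M *v a) (\<delta> M *v b) = B_defect M a - B_defect M y + M *v y"
      by (simp only: matrix_vector_right_distrib matrix_vector_mult_diff_distrib B_defect_def C_cancel(1)[OF \<Gamma>0_one])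
    then show ?thesis using W_add[OF W_diff[OF defect] W_mult[OF M D]] by (simp add: y_def)
  qed
  moreover have "?D (M *v x) (\<delta> M *v (B *v x)) = B_defect M x" for M x
    by (simp add: B_defect_def)
  moreover have "?D 0 0 \<in> W" "?D x (B *v x) \<in> W" for x by (simp_all add: W_zero)
  moreover have "?D (a - c) (b - d) \<in> W" if "?D a b \<in> W" "?D c d \<in> W" for a b c d
    using W_diff[OF that] by (simp add: matrix_vector_mult_diff_distrib algebra_simps)
  ultimately show ?thesis
    unfolding TB_Theta_eq translation_normal_iff group_L_iff psi_const_iff by metis
qed

lemma not_group_no_inverse_property:
  "\<not> group L \<Longrightarrow> \<not> left_inverse_property L \<and> \<not> right_inverse_property L"
  using left_inverse_imp_psi_const right_inverse_imp_psi_const group_L_iff by blast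

section \<open>The group generated by the left translations\<close>

text \<open>The permutation representation of \<Gamma> on the cosets of \<open>H\<close>, cut off
  outside the coset space because the elements of \<open>BijGroup\<close> are extensional.\<close>

definition \<rho> where "\<rho> x = (\<lambda>X\<in>carrier L. x <#\<^bsub>\<Gamma>\<^esub> X)"

lemma lcoset_subset: "X \<in> carrier L \<Longrightarrow> X \<subseteq> carrier \<Gamma>"
  unfolding L_lcosets using subgroup.lcosets_carrier[OF subgroup_graph_group group_\<Gamma>] .

lemma action_assoc:
  "X \<in> carrier L \<Longrightarrow> x \<in> carrier \<Gamma> \<Longrightarrow> y \<in> carrier \<Gamma> \<Longrightarrow>
    x <#\<^bsub>\<Gamma>\<^esub> (y <#\<^bsub>\<Gamma>\<^esub> X) = (x \<otimes>\<^bsub>\<Gamma>\<^esub> y) <#\<^bsub>\<Gamma>\<^esub> X"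
  using \<Gamma>.lcos_m_assoc lcoset_subset by blast

lemma action_closed: "X \<in> carrier L \<Longrightarrow> x \<in> carrier \<Gamma> \<Longrightarrow> x <#\<^bsub>\<Gamma>\<^esub> X \<in> carrier L"
proof -
  assume "X \<in> carrier L" and x: "x \<in> carrier \<Gamma>"
  then obtain y where "X = y <#\<^bsub>\<Gamma>\<^esub> H" and y: "y \<in> carrier \<Gamma>" by (auto simp: L_lcosets LCOSETS_def)
  then have "x <#\<^bsub>\<Gamma>\<^esub> X = (x \<otimes>\<^bsub>\<Gamma>\<^esub> y) <#\<^bsub>\<Gamma>\<^esub> H" using x by (simp add: lcoset_lcoset)
  moreover have "x \<otimes>\<^bsub>\<Gamma>\<^esub> y \<in> carrier \<Gamma>" using x y by (rule \<Gamma>.m_closed)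
  ultimately show ?thesis unfolding L_lcosets LCOSETS_def by blast
qed

lemma action_one: "X \<in> carrier L \<Longrightarrow> \<one>\<^bsub>\<Gamma>\<^esub> <#\<^bsub>\<Gamma>\<^esub> X = X"
  using \<Gamma>.lcos_mult_one lcoset_subset by blast

lemma rho_Bij: "x \<in> carrier \<Gamma> \<Longrightarrow> \<rho> x \<in> Bij (carrier L)"
proof -
  assume x: "x \<in> carrier \<Gamma>"
  have "bij_betw (\<rho> x) (carrier L) (carrier L)"
    by (rule bij_betw_byWitness[where f' = "\<rho> (inv\<^bsub>\<Gamma>\<^esub> x)"])
      (use x in \<open>auto simp: \<rho>_def action_closed action_assoc action_one\<close>)
  then show ?thesis by (simp add: Bij_def \<rho>_def)
qed

lemma rho_hom: "\<rho> \<in> hom \<Gamma> (BijGroup (carrier L))"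
proof (rule homI)
  show "\<rho> x \<in> carrier (BijGroup (carrier L))" if "x \<in> carrier \<Gamma>" for x
    using rho_Bij[OF that] by (simp add: BijGroup_def)
  show "\<rho> (x \<otimes>\<^bsub>\<Gamma>\<^esub> y) = \<rho> x \<otimes>\<^bsub>BijGroup (carrier L)\<^esub> \<rho> y"
    if "x \<in> carrier \<Gamma>" "y \<in> carrier \<Gamma>" for x y
    using that rho_Bij
    by (auto simp: BijGroup_def \<rho>_def compose_def fun_eq_iff action_closed action_assoc)
qed

sublocale rho: group_hom \<Gamma> "BijGroup (carrier L)" \<rho>
  by (intro group_hom.intro group_hom_axioms.intro group_\<Gamma> group_BijGroup rho_hom)

lemma left_translations_eq: "left_translations L = \<rho> ` \<Xi>"
  unfolding left_translations_def sigma_image[symmetric] image_image L_lcosets[symmetric]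
  unfolding \<rho>_def by (intro image_cong restrict_ext refl) (simp add: L_mult_def)

text \<open>The left translations are the images of \<Xi> under the homomorphism \<rho>, so the
  group they generate is the image of the one generated by \<Xi>.\<close>

lemma left_mult_group_eq: "left_mult_group L = \<rho> ` \<Delta>'"
proof
  have "subgroup (\<rho> ` \<Delta>') (BijGroup (carrier L))"
    by (rule rho.subgroup_img_is_subgroup[OF subgroup_Delta'])
  then show "left_mult_group L \<subseteq> \<rho> ` \<Delta>'"
    unfolding left_mult_group_def left_translations_eq
    by (intro rho.H.generate_subgroup_incl image_mono Xi_subset_Delta')
  have Xi: "\<Xi> \<subseteq> carrier \<Gamma>" using Xi_subset_Delta' subgroup.subset[OF subgroup_Delta'] by blast
  have "\<rho> x \<in> left_mult_group L" if "x \<in> generate \<Gamma> \<Xi>" for x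
    using that
  proof induction
    case one
    then show ?case by (simp add: left_mult_group_def generate.one)
  next
    case (incl h)
    then show ?case by (simp add: left_mult_group_def left_translations_eq generate.incl)
  next
    case (inv h)
    then have "\<rho> (inv\<^bsub>\<Gamma>\<^esub> h) = inv\<^bsub>BijGroup (carrier L)\<^esub> (\<rho> h)"
      using Xi by (intro rho.hom_inv) blast
    then show ?case
      using inv by (auto simp: left_mult_group_def left_translations_eq intro: generate.inv)
  next
    case (eng h1 h2)
    then show ?case
      using \<Gamma>.generate_in_carrier[OF Xi] by (auto simp: left_mult_group_def intro!: generate.eng)
  qed
  then show "\<rho> ` \<Delta>' \<subseteq> left_mult_group L" by (auto simp: generate_Xi)
qed

text \<open>Fixing all cosets forces \<open>N = mat 1\<close> from the matrix part. The vector part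
  at \<open>w = 0\<close> then says that \<open>\<delta> M *v (A *v (matrix_inv M *v u))\<close>
  equals \<open>v\<close> for all \<open>M\<close>: the case \<open>M = mat 1\<close> gives
  \<open>v = A *v u\<close>, the rest gives membership in \<open>W\<close>.\<close>

lemma rho_eq_one_iff: "x \<in> carrier \<Gamma> \<Longrightarrow> \<rho> x = \<one>\<^bsub>BijGroup (carrier L)\<^esub> \<longleftrightarrow> x \<in> \<Theta>"
proof -
  assume "x \<in> carrier \<Gamma>"
  then obtain u v N where x: "x = gmat \<delta> u v N" "N \<in> \<Gamma>0" by (rule \<Gamma>_cases)
  have "\<rho> x = \<one>\<^bsub>BijGroup (carrier L)\<^esub> \<longleftrightarrow> (\<forall>X\<in>carrier L. x <#\<^bsub>\<Gamma>\<^esub> X = X)"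
    unfolding \<rho>_def BijGroup_def by (auto simp: fun_eq_iff)
  also have "\<dots> \<longleftrightarrow> (\<forall>w. \<forall>M\<in>\<Gamma>0.
      v + \<delta> N *v w - \<delta> (N ** M) *v (A *v (matrix_inv (N ** M) *v u)) = w \<and> N ** M = M)"
    using x(2) by (simp add: L_carrier x(1) action_q q_eq_iff del: \<delta>_mult)
  also have "\<dots> \<longleftrightarrow> N = mat 1 \<and> v = A *v u \<and> u \<in> W" (is "?L \<longleftrightarrow> ?R")
  proof
    assume L: ?L
    then have N: "N = mat 1" by (metis \<Gamma>0_one matrix_mul_rid)
    have v: "v = \<delta> M *v (A *v (matrix_inv M *v u))" if "M \<in> \<Gamma>0" for M
      using L[rule_format, OF that, of 0] by (simp add: N)
    then show ?R using v[of "mat 1"] N by (auto simp: W_alt matrix_inv_mat_1)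
  qed (simp add: W_alt)
  also have "\<dots> \<longleftrightarrow> x \<in> \<Theta>" by (auto simp: x(1) Theta_eq gmat_eq_iff)
  finally show ?thesis .
qed

text \<open>First isomorphism theorem for \<rho> restricted to \<Delta>', whose kernel is the part
  of \<Theta> inside \<Delta>'. The unit of the loop is the coset \<open>H\<close>, fixed by
  \<open>x\<close> exactly if \<open>x\<close> lies in \<open>H\<close>.\<close>

lemma left_mult_group_iso:
  "\<exists>h \<in> iso ((\<Gamma>\<lparr>carrier := \<Delta>'\<rparr>) Mod (\<Theta> \<inter> \<Delta>'))
      ((BijGroup (carrier L))\<lparr>carrier := left_mult_group L\<rparr>).
    (\<forall>x\<in>\<Delta>'. h ((\<Theta> \<inter> \<Delta>') #>\<^bsub>\<Gamma>\<^esub> x) = (\<lambda>X\<in>carrier L. x <#\<^bsub>\<Gamma>\<^esub> X)) \<and>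
    h ` carrier ((\<Gamma>\<lparr>carrier := H \<inter> \<Delta>'\<rparr>) Mod (\<Theta> \<inter> \<Delta>')) =
      {f \<in> left_mult_group L. f \<one>\<^bsub>L\<^esub> = \<one>\<^bsub>L\<^esub>}"
proof (intro bexI conjI ballI)
  let ?G = "\<Gamma>\<lparr>carrier := \<Delta>'\<rparr>" and ?B = "(BijGroup (carrier L))\<lparr>carrier := left_mult_group L\<rparr>"
  let ?h = "\<lambda>X. the_elem (\<rho> ` X)"
  have D: "\<Delta>' \<subseteq> carrier \<Gamma>" by (rule subgroup.subset[OF subgroup_Delta'])
  have "subgroup (left_mult_group L) (BijGroup (carrier L))"
    unfolding left_mult_group_eq by (rule rho.subgroup_img_is_subgroup[OF subgroup_Delta'])
  then have B: "group ?B" by (rule subgroup.subgroup_is_group[OF _ group_BijGroup])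
  have G: "group ?G" by (rule subgroup.subgroup_is_group[OF subgroup_Delta' group_\<Gamma>])
  have "\<rho> \<in> hom ?G ?B" using D by (auto simp: hom_def left_mult_group_eq subset_iff)
  then interpret R: group_hom ?G ?B \<rho>
    using B G by (simp add: group_hom_def group_hom_axioms_def)
  have ker: "kernel ?G ?B \<rho> = \<Theta> \<inter> \<Delta>'"
    using D rho_eq_one_iff by (auto simp: kernel_def)
  show "?h \<in> iso (?G Mod (\<Theta> \<inter> \<Delta>')) ?B"
    unfolding ker[symmetric] by (rule R.FactGroup_iso_set) (simp add: left_mult_group_eq)
  have h: "?h ((\<Theta> \<inter> \<Delta>') #>\<^bsub>\<Gamma>\<^esub> x) = \<rho> x" if x: "x \<in> \<Delta>'" for x
  proof -
    have "\<rho> (k \<otimes>\<^bsub>\<Gamma>\<^esub> x) = \<rho> x" if k: "k \<in> \<Theta> \<inter> \<Delta>'" for k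
    proof -
      have "k \<in> carrier \<Gamma>" "x \<in> carrier \<Gamma>" "k \<in> \<Theta>" using k x D by blast+
      then show ?thesis using rho_eq_one_iff[of k] by simp
    qed
    moreover have "\<one>\<^bsub>\<Gamma>\<^esub> \<in> \<Theta> \<inter> \<Delta>'"
      using subgroup.one_closed[OF subgroup_Delta'] subgroup.one_closed[OF normal_imp_subgroup[OF Theta_normal]]
      by simp
    moreover have "(\<lambda>k. \<rho> (k \<otimes>\<^bsub>\<Gamma>\<^esub> x)) ` (\<Theta> \<inter> \<Delta>') = (\<lambda>k. \<rho> x) ` (\<Theta> \<inter> \<Delta>')"
      using calculation by (intro image_cong refl)
    ultimately have "(\<lambda>k. \<rho> (k \<otimes>\<^bsub>\<Gamma>\<^esub> x)) ` (\<Theta> \<inter> \<Delta>') = {\<rho> x}"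
      using image_constant[of "\<one>\<^bsub>\<Gamma>\<^esub>" "\<Theta> \<inter> \<Delta>'" "\<rho> x"] by (simp only:)
    moreover have "(\<Theta> \<inter> \<Delta>') #>\<^bsub>\<Gamma>\<^esub> x = (\<lambda>k. k \<otimes>\<^bsub>\<Gamma>\<^esub> x) ` (\<Theta> \<inter> \<Delta>')"
      unfolding r_coset_def by blast
    ultimately have "\<rho> ` ((\<Theta> \<inter> \<Delta>') #>\<^bsub>\<Gamma>\<^esub> x) = {\<rho> x}"
      by (simp only: image_image)
    then show ?thesis by simp
  qed
  then show "?h ((\<Theta> \<inter> \<Delta>') #>\<^bsub>\<Gamma>\<^esub> x) = (\<lambda>X\<in>carrier L. x <#\<^bsub>\<Gamma>\<^esub> X)" if "x \<in> \<Delta>'" for x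
    using that by (simp add: \<rho>_def)
  have "carrier ((\<Gamma>\<lparr>carrier := H \<inter> \<Delta>'\<rparr>) Mod (\<Theta> \<inter> \<Delta>')) = (\<lambda>x. (\<Theta> \<inter> \<Delta>') #>\<^bsub>\<Gamma>\<^esub> x) ` (H \<inter> \<Delta>')"
    by (auto simp: FactGroup_def RCOSETS_def restrict_coset_simps)
  then have "?h ` carrier ((\<Gamma>\<lparr>carrier := H \<inter> \<Delta>'\<rparr>) Mod (\<Theta> \<inter> \<Delta>')) = \<rho> ` (H \<inter> \<Delta>')"
    using h by (simp add: image_image)
  also have "\<dots> = {f \<in> left_mult_group L. f \<one>\<^bsub>L\<^esub> = \<one>\<^bsub>L\<^esub>}"
  proof -
    have HL: "H \<in> carrier L" using L_one' loop_L by (simp add: loop_def)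
    have "x <#\<^bsub>\<Gamma>\<^esub> H = H \<longleftrightarrow> x \<in> H" if "x \<in> carrier \<Gamma>" for x
      using that \<Gamma>.lcos_self[OF that subgroup_graph_group] \<Gamma>.lcos_eq_iff[OF subgroup_graph_group \<Gamma>.one_closed that]
        \<Gamma>.lcos_mult_one[OF subgroup.subset[OF subgroup_graph_group]] by auto
    then have "\<rho> x \<one>\<^bsub>L\<^esub> = \<one>\<^bsub>L\<^esub> \<longleftrightarrow> x \<in> H" if "x \<in> \<Delta>'" for x
      using that D HL by (auto simp: \<rho>_def L_one')
    then show ?thesis unfolding left_mult_group_eq by auto
  qed
  finally show "?h ` carrier ((\<Gamma>\<lparr>carrier := H \<inter> \<Delta>'\<rparr>) Mod (\<Theta> \<inter> \<Delta>')) =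
      {f \<in> left_mult_group L. f \<one>\<^bsub>L\<^esub> = \<one>\<^bsub>L\<^esub>}" .
qed

section \<open>Sharply transitive sections of \<Gamma> and of \<Delta>'\<close>

lemma sharply_transitive_Gamma_iff:
  "sharply_transitive_section \<Gamma> H (sigma \<Gamma>0 \<delta> A B) \<longleftrightarrow> \<Delta>' = carrier \<Gamma>"
  by (simp add: sharply_transitive_section_def transitive_section_sigma sigma_image generate_Xi)

lemma sigma_self:
  assumes "s \<in> \<Xi>"
  shows "sigma \<Gamma>0 \<delta> A B (s <#\<^bsub>\<Gamma>\<^esub> H) = s"
proof -
  obtain X where X: "X \<in> lcosets\<^bsub>\<Gamma>\<^esub> H" "s = sigma \<Gamma>0 \<delta> A B X"
    using assms sigma_image by blast
  then obtain x where x: "X = x <#\<^bsub>\<Gamma>\<^esub> H" "x \<in> carrier \<Gamma>" by (auto simp: LCOSETS_def)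
  have "s <#\<^bsub>\<Gamma>\<^esub> H = X"
    using sigma_in_coset[OF X(1)] \<Gamma>.l_repr_independence[OF _ x(2) subgroup_graph_group] X(2) x(1) by metis
  then show ?thesis using X by simp
qed

text \<open>Since \<Xi> lies in \<Delta>' and is transitive, every coset of \<open>H\<close> in
  \<Gamma> meets \<Delta>'. Thus \<open>X \<mapsto> X <#> H\<close> identifies the two coset spaces,
  and the old section is composed with this identification.\<close>

lemma sharply_transitive_Delta':
  "sharply_transitive_section (\<Gamma>\<lparr>carrier := \<Delta>'\<rparr>) (H \<inter> \<Delta>') (\<lambda>X. sigma \<Gamma>0 \<delta> A B (X <#>\<^bsub>\<Gamma>\<^esub> H))"
proof -
  let ?G = "\<Gamma>\<lparr>carrier := \<Delta>'\<rparr>" and ?K = "H \<inter> \<Delta>'" and ?s = "\<lambda>X. sigma \<Gamma>0 \<delta> A B (X <#>\<^bsub>\<Gamma>\<^esub> H)"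
  have D: "\<Delta>' \<subseteq> carrier \<Gamma>" by (rule subgroup.subset[OF subgroup_Delta'])
  have Hc: "H \<subseteq> carrier \<Gamma>" by (rule subgroup.subset[OF subgroup_graph_group])
  have K: "subgroup ?K \<Gamma>" by (rule \<Gamma>.subgroups_Inter_pair[OF subgroup_graph_group subgroup_Delta'])
  have KH: "?K <#>\<^bsub>\<Gamma>\<^esub> H = H"
  proof
    show "?K <#>\<^bsub>\<Gamma>\<^esub> H \<subseteq> H"
      using subgroup.m_closed[OF subgroup_graph_group] by (auto simp: set_mult_def)
    show "H \<subseteq> ?K <#>\<^bsub>\<Gamma>\<^esub> H"
    proof
      fix x assume x: "x \<in> H"
      then have "\<one>\<^bsub>\<Gamma>\<^esub> \<otimes>\<^bsub>\<Gamma>\<^esub> x = x" using Hc by (intro \<Gamma>.l_one) blast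
      then show "x \<in> ?K <#>\<^bsub>\<Gamma>\<^esub> H"
        using set_multI[OF subgroup.one_closed[OF K] x, of \<Gamma>] by simp
    qed
  qed
  have xKH: "(x <#\<^bsub>\<Gamma>\<^esub> ?K) <#>\<^bsub>\<Gamma>\<^esub> H = x <#\<^bsub>\<Gamma>\<^esub> H" if "x \<in> carrier \<Gamma>" for x
    using that Hc KH
    by (metis (no_types) \<Gamma>.set_mult_assoc K empty_subsetI insert_subset l_coset_eq_set_mult subgroup.subset)
  have cosets: "lcosets\<^bsub>?G\<^esub> ?K = (\<lambda>x. x <#\<^bsub>\<Gamma>\<^esub> ?K) ` \<Delta>'"
    by (auto simp: LCOSETS_def restrict_coset_simps)
  have lcos: "x <#\<^bsub>\<Gamma>\<^esub> H \<in> lcosets\<^bsub>\<Gamma>\<^esub> H" if "x \<in> \<Delta>'" for x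
    using that D by (auto simp: LCOSETS_def)
  \<comment> \<open>The quotient of two elements of \<Delta>' lies in \<Delta>' anyway, so both
    equalities mean that it lies in \<open>H\<close>.\<close>
  have coset_iff: "x <#\<^bsub>\<Gamma>\<^esub> ?K = y <#\<^bsub>\<Gamma>\<^esub> ?K \<longleftrightarrow> x <#\<^bsub>\<Gamma>\<^esub> H = y <#\<^bsub>\<Gamma>\<^esub> H"
    if "x \<in> \<Delta>'" "y \<in> \<Delta>'" for x y
    using that D \<Gamma>.lcos_eq_iff[OF K, of x y] \<Gamma>.lcos_eq_iff[OF subgroup_graph_group, of x y]
      subgroup.m_closed[OF subgroup_Delta' subgroup.m_inv_closed[OF subgroup_Delta' that(1)] that(2)] by blast
  have image: "?s ` (lcosets\<^bsub>?G\<^esub> ?K) = \<Xi>"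
  proof
    show "?s ` (lcosets\<^bsub>?G\<^esub> ?K) \<subseteq> \<Xi>"
      unfolding sigma_image[symmetric] cosets using D lcos by (auto simp: xKH subset_iff)
    show "\<Xi> \<subseteq> ?s ` (lcosets\<^bsub>?G\<^esub> ?K)"
    proof
      fix s assume s: "s \<in> \<Xi>"
      then have "s \<in> \<Delta>'" "?s (s <#\<^bsub>\<Gamma>\<^esub> ?K) = s"
        using Xi_subset_Delta' D by (auto simp: xKH subset_iff sigma_self)
      then show "s \<in> ?s ` (lcosets\<^bsub>?G\<^esub> ?K)" unfolding cosets by force
    qed
  qed
  have "transitive_section ?G ?K ?s"
    unfolding transitive_section_def
  proof (intro conjI ballI)
    show "group ?G" by (rule subgroup.subgroup_is_group[OF subgroup_Delta' group_\<Gamma>])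
    show "subgroup ?K ?G" by (rule \<Gamma>.subgroup_incl[OF K subgroup_Delta']) simp
    show "?s ?K = \<one>\<^bsub>?G\<^esub>" by (simp add: KH sigma_H)
  next
    fix X assume "X \<in> lcosets\<^bsub>?G\<^esub> ?K"
    then obtain x where x: "X = x <#\<^bsub>\<Gamma>\<^esub> ?K" "x \<in> \<Delta>'" by (auto simp: cosets)
    let ?t = "sigma \<Gamma>0 \<delta> A B (x <#\<^bsub>\<Gamma>\<^esub> H)"
    have t: "?t \<in> x <#\<^bsub>\<Gamma>\<^esub> H" "?t \<in> \<Delta>'"
      using sigma_in_coset[OF lcos[OF x(2)]] subsetD[OF Xi_subset_Delta'] sigma_image imageI[OF lcos[OF x(2)]]
      by metis+
    then have "x <#\<^bsub>\<Gamma>\<^esub> H = ?t <#\<^bsub>\<Gamma>\<^esub> H"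
      using \<Gamma>.l_repr_independence[OF t(1) _ subgroup_graph_group] x D by blast
    then have "x <#\<^bsub>\<Gamma>\<^esub> ?K = ?t <#\<^bsub>\<Gamma>\<^esub> ?K" using coset_iff x(2) t(2) by blast
    then have "?t \<in> X" using \<Gamma>.lcos_self[OF _ K] t(2) D x(1) by blast
    then show "?s X \<in> X" using x D by (simp add: xKH subset_iff)
  next
    fix X Y assume "X \<in> lcosets\<^bsub>?G\<^esub> ?K" "Y \<in> lcosets\<^bsub>?G\<^esub> ?K"
    then obtain x y where x: "X = x <#\<^bsub>\<Gamma>\<^esub> ?K" "x \<in> \<Delta>'" and y: "Y = y <#\<^bsub>\<Gamma>\<^esub> ?K" "y \<in> \<Delta>'"
      by (auto simp: cosets)
    have "t <#\<^bsub>\<Gamma>\<^esub> X = Y \<longleftrightarrow> t <#\<^bsub>\<Gamma>\<^esub> (x <#\<^bsub>\<Gamma>\<^esub> H) = y <#\<^bsub>\<Gamma>\<^esub> H" if t: "t \<in> \<Xi>" for t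
    proof -
      have tD: "t \<in> \<Delta>'" using t Xi_subset_Delta' by blast
      have "t <#\<^bsub>\<Gamma>\<^esub> X = (t \<otimes>\<^bsub>\<Gamma>\<^esub> x) <#\<^bsub>\<Gamma>\<^esub> ?K"
        using x tD D \<Gamma>.lcos_m_assoc[OF subgroup.subset[OF K], of t x] by blast
      moreover have "t <#\<^bsub>\<Gamma>\<^esub> (x <#\<^bsub>\<Gamma>\<^esub> H) = (t \<otimes>\<^bsub>\<Gamma>\<^esub> x) <#\<^bsub>\<Gamma>\<^esub> H"
        using x tD D lcoset_lcoset by blast
      ultimately show ?thesis
        using y coset_iff[OF subgroup.m_closed[OF subgroup_Delta' tD x(2)] y(2)] by simp
    qed
    then have eq: "t \<in> \<Xi> \<and> t <#\<^bsub>\<Gamma>\<^esub> X = Y \<longleftrightarrow> t \<in> \<Xi> \<and> t <#\<^bsub>\<Gamma>\<^esub> (x <#\<^bsub>\<Gamma>\<^esub> H) = y <#\<^bsub>\<Gamma>\<^esub> H" for t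
      by (intro conj_cong refl)
    show "\<exists>!t. t \<in> ?s ` (lcosets\<^bsub>?G\<^esub> ?K) \<and> t <#\<^bsub>?G\<^esub> X = Y"
      unfolding image restrict_coset_simps eq
      by (rule unique_translation[OF lcos[OF x(2)] lcos[OF y(2)]])
  qed
  moreover have "generate ?G \<Xi> = carrier ?G"
    using \<Gamma>.generate_consistent[OF Xi_subset_Delta' subgroup_Delta'] by (simp add: generate_Xi)
  ultimately show ?thesis by (simp add: sharply_transitive_section_def image)
qed

end

section \<open>Function algebras closed under inversion\<close>

text \<open>Continuous and analytic functions are treated together: all that matters is closure under the
  field operations, since the loop operations are rational in the coordinates.\<close>

locale function_algebra =
  fixes S :: "'x set" and F :: "('x \<Rightarrow> 'k::field) \<Rightarrow> bool"
  assumes const: "F (\<lambda>_. c)"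
    and add: "F f \<Longrightarrow> F g \<Longrightarrow> F (\<lambda>x. f x + g x)"
    and mult: "F f \<Longrightarrow> F g \<Longrightarrow> F (\<lambda>x. f x * g x)"
    and inverse: "F f \<Longrightarrow> (\<And>x. x \<in> S \<Longrightarrow> f x \<noteq> 0) \<Longrightarrow> F (\<lambda>x. inverse (f x))"
    and cong: "F f \<Longrightarrow> (\<And>x. x \<in> S \<Longrightarrow> f x = g x) \<Longrightarrow> F g"
begin

definition Fv :: "('x \<Rightarrow> 'k^'m) \<Rightarrow> bool" where "Fv f \<longleftrightarrow> (\<forall>i. F (\<lambda>x. f x $ i))"
definition Fm :: "('x \<Rightarrow> 'k^'m^'l) \<Rightarrow> bool" where "Fm f \<longleftrightarrow> (\<forall>i j. F (\<lambda>x. f x $ i $ j))"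

lemma diff: "F f \<Longrightarrow> F g \<Longrightarrow> F (\<lambda>x. f x - g x)"
  using add[OF _ mult[OF const[of "-1"]], of f g] by simp

lemma sum: "(\<And>i. i \<in> I \<Longrightarrow> F (f i)) \<Longrightarrow> F (\<lambda>x. \<Sum>i\<in>I. f i x)"
  by (induction I rule: infinite_finite_induct) (auto intro: const add)

lemma prod: "(\<And>i. i \<in> I \<Longrightarrow> F (f i)) \<Longrightarrow> F (\<lambda>x. \<Prod>i\<in>I. f i x)"
  by (induction I rule: infinite_finite_induct) (auto intro: const mult)

lemma det: "Fm G \<Longrightarrow> F (\<lambda>x. det (G x))"
  unfolding det_def Fm_def by (intro sum mult const prod) auto

lemma Fm_const: "Fm (\<lambda>_. A)"
  by (simp add: Fm_def const)

lemma Fv_add: "Fv f \<Longrightarrow> Fv g \<Longrightarrow> Fv (\<lambda>x. f x + g x)"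
  by (simp add: Fv_def add)

lemma Fv_diff: "Fv f \<Longrightarrow> Fv g \<Longrightarrow> Fv (\<lambda>x. f x - g x)"
  by (simp add: Fv_def diff)

lemma Fm_diff: "Fm f \<Longrightarrow> Fm g \<Longrightarrow> Fm (\<lambda>x. f x - g x)"
  by (simp add: Fm_def diff)

lemma Fm_mult: "Fm f \<Longrightarrow> Fm g \<Longrightarrow> Fm (\<lambda>x. f x ** g x)"
  unfolding Fm_def matrix_matrix_mult_def by (simp, intro allI sum mult) auto

lemma Fm_vector: "Fm f \<Longrightarrow> Fv g \<Longrightarrow> Fv (\<lambda>x. f x *v g x)"
  unfolding Fm_def Fv_def matrix_vector_mult_def by (simp, intro allI sum mult) auto

lemma Fv_cong:
  assumes "Fv f" "\<And>x. x \<in> S \<Longrightarrow> f x = g x"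
  shows "Fv g"
  unfolding Fv_def
proof
  fix i show "F (\<lambda>x. g x $ i)"
    by (rule cong[of "\<lambda>x. f x $ i"]) (use assms in \<open>auto simp: Fv_def\<close>)
qed

lemma Fm_cong:
  assumes "Fm f" "\<And>x. x \<in> S \<Longrightarrow> f x = g x"
  shows "Fm g"
  unfolding Fm_def
proof (intro allI)
  fix i j show "F (\<lambda>x. g x $ i $ j)"
    by (rule cong[of "\<lambda>x. f x $ i $ j"]) (use assms in \<open>auto simp: Fm_def\<close>)
qed

text \<open>Column \<open>j\<close> of the inverse solves \<open>G x *v c = axis j 1\<close>.
  Cramer's rule expresses its entry \<open>i\<close> as a determinant, with column \<open>i\<close>
  replaced, divided by \<open>det (G x)\<close>, which does not vanish on \<open>S\<close>.\<close>

lemma Fm_inv: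
  fixes G :: "'x \<Rightarrow> 'k^'m^'m"
  assumes G: "Fm G" and inv: "\<And>x. x \<in> S \<Longrightarrow> invertible (G x)"
  shows "Fm (\<lambda>x. matrix_inv (G x))"
  unfolding Fm_def
proof (intro allI)
  fix i j
  let ?D = "\<lambda>x. det (\<chi> a b. if b = i then axis j 1 $ a else G x $ a $ b)"
  have "F (\<lambda>x. if b = i then axis j 1 $ a else G x $ a $ b)" for a b
    using G by (cases "b = i") (auto simp: Fm_def const)
  then have "Fm (\<lambda>x. \<chi> a b. if b = i then axis j 1 $ a else G x $ a $ b)"
    unfolding Fm_def vec_lambda_beta by blast
  then have "F ?D" by (rule det)
  then have "F (\<lambda>x. ?D x * inverse (det (G x)))"
    by (rule mult[OF _ inverse[OF det[OF G]]]) (auto simp: inv invertible_det_nz[symmetric])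
  moreover have "?D x * inverse (det (G x)) = matrix_inv (G x) $ i $ j" if "x \<in> S" for x
  proof -
    let ?c = "column j (matrix_inv (G x))"
    have "(G x *v ?c) $ a = (G x ** matrix_inv (G x)) $ a $ j" for a
      by (simp add: matrix_vector_mult_def matrix_matrix_mult_def column_def)
    then have "G x *v ?c = axis j 1"
      using inv[OF that] by (simp add: matrix_inv_right vec_eq_iff mat_def axis_def)
    then have "?c = (\<chi> k. det (\<chi> a b. if b = k then axis j 1 $ a else G x $ a $ b) / det (G x))"
      using inv[OF that] by (subst cramer[symmetric]) (auto simp: invertible_det_nz)
    then have "?c $ i = ?D x / det (G x)" by simp
    then show ?thesis by (simp add: column_def divide_inverse)
  qed
  ultimately show "F (\<lambda>x. matrix_inv (G x) $ i $ j)" by (rule cong)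
qed

end

context loop_setup
begin

text \<open>Regularity of a map into the coordinate loop. The entries of
  \<open>\<delta> (snd (p x))\<close> are listed separately because \<delta> is an arbitrary
  endomorphism, so their regularity cannot be deduced from that of the matrix.\<close>

definition Q_fun where
  "Q_fun Z F p \<longleftrightarrow> (\<forall>x\<in>Z. snd (p x) \<in> \<Gamma>0) \<and> function_algebra.Fv F (\<lambda>x. fst (p x)) \<and>
    function_algebra.Fm F (\<lambda>x. snd (p x)) \<and> function_algebra.Fm F (\<lambda>x. \<delta> (snd (p x)))"

text \<open>The vector part is built by sums, products and inverses of matrices from the available
  entries. The condition on \<delta> is preserved since \<delta> turns products and inverses into
  products and inverses on \<open>\<Gamma>0\<close>.\<close>

lemma Q_fun_operations:
  assumes "function_algebra Z F" and p: "Q_fun Z F p" and r: "Q_fun Z F r"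
  shows "Q_fun Z F (\<lambda>x. p x \<otimes>\<^bsub>Q\<^esub> r x)" "Q_fun Z F (\<lambda>x. qldiv (p x) (r x))"
    "Q_fun Z F (\<lambda>x. qrdiv (r x) (p x))"
proof -
  interpret function_algebra Z F by fact
  note Q_fun_def [simp]
  define a M b N where "a = (\<lambda>x. fst (p x))" "M = (\<lambda>x. snd (p x))" "b = (\<lambda>x. fst (r x))" "N = (\<lambda>x. snd (r x))"
  have pr: "p = (\<lambda>x. (a x, M x))" "r = (\<lambda>x. (b x, N x))" by (simp_all add: a_M_b_N_def)
  have G: "\<And>x. x \<in> Z \<Longrightarrow> M x \<in> \<Gamma>0" "\<And>x. x \<in> Z \<Longrightarrow> N x \<in> \<Gamma>0"
    and Fs: "Fv a" "Fm M" "Fm (\<lambda>x. \<delta> (M x))" "Fv b" "Fm N" "Fm (\<lambda>x. \<delta> (N x))"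
    using p r by (simp_all add: pr)
  have C: "Fm (\<lambda>x. C (K x))" "Fm (\<lambda>x. matrix_inv (C (K x)))" "Fm (\<lambda>x. matrix_inv (K x))"
      "Fm (\<lambda>x. matrix_inv (\<delta> (K x)))"
    if "\<And>x. x \<in> Z \<Longrightarrow> K x \<in> \<Gamma>0" "Fm K" "Fm (\<lambda>x. \<delta> (K x))" for K
  proof -
    show "Fm (\<lambda>x. matrix_inv (K x))" "Fm (\<lambda>x. matrix_inv (\<delta> (K x)))" using that by (auto intro!: Fm_inv)
    then show "Fm (\<lambda>x. C (K x))" unfolding C_def using that by (intro Fm_diff Fm_mult Fm_const) auto
    then show "Fm (\<lambda>x. matrix_inv (C (K x)))" using that by (intro Fm_inv) auto
  qed
  have hom: "Fm (\<lambda>x. \<delta> (M x ** N x))" "Fm (\<lambda>x. \<delta> (matrix_inv (M x) ** N x))"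
      "Fm (\<lambda>x. \<delta> (N x ** matrix_inv (M x)))"
  proof -
    have inv: "Fm (\<lambda>x. matrix_inv (\<delta> (M x)))" by (rule C(4)[OF G(1) Fs(2,3)])
    show "Fm (\<lambda>x. \<delta> (M x ** N x))" by (rule Fm_cong[OF Fm_mult[OF Fs(3,6)]]) (use G in simp)
    show "Fm (\<lambda>x. \<delta> (matrix_inv (M x) ** N x))" by (rule Fm_cong[OF Fm_mult[OF inv Fs(6)]]) (use G in simp)
    show "Fm (\<lambda>x. \<delta> (N x ** matrix_inv (M x)))" by (rule Fm_cong[OF Fm_mult[OF Fs(6) inv]]) (use G in simp)
  qed
  have K: "Fm (\<lambda>x. M x ** N x)" "Fm (\<lambda>x. matrix_inv (M x) ** N x)" "Fm (\<lambda>x. N x ** matrix_inv (M x))"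
    by (intro Fm_mult C(3) Fs G; assumption)+
  show "Q_fun Z F (\<lambda>x. p x \<otimes>\<^bsub>Q\<^esub> r x)"
    using G by (simp add: pr Q_simps hom(1) K(1) del: \<delta>_mult)
      (intro Fv_add Fm_vector C Fs hom K; simp)
  show "Q_fun Z F (\<lambda>x. qldiv (p x) (r x))"
    using G by (simp add: pr qldiv_def hom(2) K(2) del: \<delta>_mult \<delta>_inv)
      (intro Fv_diff Fm_vector C Fs hom K; simp)
  show "Q_fun Z F (\<lambda>x. qrdiv (r x) (p x))"
    using G by (simp add: pr qrdiv_def hom(3) K(3) del: \<delta>_mult \<delta>_inv)
      (intro Fv_diff Fm_vector C Fs hom K; simp)
qed

end

section \<open>Topological loops over a topological field\<close>

lemma function_algebra_continuous:
  assumes "topological_field T"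
  shows "function_algebra (topspace X) (continuous_map X T)"
proof
  have T: "topspace T = UNIV" "continuous_map (prod_topology T T) T (\<lambda>(x, y). x + y)"
    "continuous_map (prod_topology T T) T (\<lambda>(x, y). x * y)"
    "continuous_map (subtopology T (UNIV - {0})) T inverse"
    using assms by (auto simp: topological_field_def)
  show "continuous_map X T (\<lambda>_. c)" for c by (simp add: T)
  show "continuous_map X T (\<lambda>x. f x + g x)" if "continuous_map X T f" "continuous_map X T g" for f g
    using continuous_map_compose[OF continuous_map_pairedI[OF that] T(2)] by (simp add: o_def)
  show "continuous_map X T (\<lambda>x. f x * g x)" if "continuous_map X T f" "continuous_map X T g" for f g
    using continuous_map_compose[OF continuous_map_pairedI[OF that] T(3)] by (simp add: o_def)
  show "continuous_map X T (\<lambda>x. inverse (f x))"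
    if "continuous_map X T f" "\<And>x. x \<in> topspace X \<Longrightarrow> f x \<noteq> 0" for f
  proof -
    have "continuous_map X (subtopology T (UNIV - {0})) f"
      using that by (auto simp: continuous_map_in_subtopology)
    then show ?thesis using continuous_map_compose[OF _ T(4)] by (force simp: o_def)
  qed
  show "continuous_map X T g" if "continuous_map X T f" "\<And>x. x \<in> topspace X \<Longrightarrow> f x = g x" for f g
    using that continuous_map_eq by blast
qed

lemma topspace_matrix_topology: "topspace T = UNIV \<Longrightarrow> topspace (matrix_topology T) = UNIV"
  by (simp add: matrix_topology_def topspace_pullback_topology)

lemma continuous_map_matrix_topology:
  assumes "topspace T = UNIV"
  shows "continuous_map X (matrix_topology T) f \<longleftrightarrow> (\<forall>i j. continuous_map X T (\<lambda>x. f x $ i $ j))"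
proof
  let ?e = "\<lambda>M (i, j). M $ i $ j"
  assume f: "continuous_map X (matrix_topology T) f"
  have "continuous_map (matrix_topology T) (product_topology (\<lambda>_. T) UNIV) (id \<circ> ?e)"
    unfolding matrix_topology_def by (intro continuous_map_pullback) simp
  with f have "continuous_map X (product_topology (\<lambda>_. T) UNIV) (?e \<circ> f)"
    by (intro continuous_map_compose[of X "matrix_topology T"]) auto
  then show "\<forall>i j. continuous_map X T (\<lambda>x. f x $ i $ j)"
    by (auto simp: continuous_map_componentwise_UNIV o_def)
next
  assume "\<forall>i j. continuous_map X T (\<lambda>x. f x $ i $ j)"
  then show "continuous_map X (matrix_topology T) f"
    unfolding matrix_topology_def
    by (intro continuous_map_pullback') (auto simp: continuous_map_componentwise_UNIV o_def)
qed

lemma openin_quotient_topology: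
  "openin (quotient_topology X q) U \<longleftrightarrow> U \<subseteq> q ` topspace X \<and> openin X {x \<in> topspace X. q x \<in> U}"
proof -
  have "istopology (\<lambda>U. U \<subseteq> q ` topspace X \<and> openin X {x \<in> topspace X. q x \<in> U})"
    unfolding istopology_def
  proof (intro conjI allI impI)
    fix S T assume "S \<subseteq> q ` topspace X \<and> openin X {x \<in> topspace X. q x \<in> S}"
      "T \<subseteq> q ` topspace X \<and> openin X {x \<in> topspace X. q x \<in> T}"
    moreover have "{x \<in> topspace X. q x \<in> S \<inter> T} = {x \<in> topspace X. q x \<in> S} \<inter> {x \<in> topspace X. q x \<in> T}"
      by blast
    ultimately show "S \<inter> T \<subseteq> q ` topspace X" "openin X {x \<in> topspace X. q x \<in> S \<inter> T}"
      by auto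
  next
    fix \<K> assume *: "\<forall>K\<in>\<K>. K \<subseteq> q ` topspace X \<and> openin X {x \<in> topspace X. q x \<in> K}"
    have "{x \<in> topspace X. q x \<in> \<Union>\<K>} = \<Union>((\<lambda>K. {x \<in> topspace X. q x \<in> K}) ` \<K>)" by blast
    then show "openin X {x \<in> topspace X. q x \<in> \<Union>\<K>}" using * by auto
    show "\<Union>\<K> \<subseteq> q ` topspace X" using * by blast
  qed
  then show ?thesis unfolding quotient_topology_def by simp
qed

lemma topspace_quotient_topology: "topspace (quotient_topology X q) = q ` topspace X"
proof -
  have "{x \<in> topspace X. q x \<in> q ` topspace X} = topspace X" by blast
  then have "openin (quotient_topology X q) (q ` topspace X)"
    by (simp add: openin_quotient_topology)
  moreover have "topspace (quotient_topology X q) \<subseteq> q ` topspace X"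
    using openin_topspace[of "quotient_topology X q"] unfolding openin_quotient_topology by (rule conjunct1)
  ultimately show ?thesis by (intro equalityI openin_subset)
qed

lemma quotient_map_quotient_topology: "quotient_map X (quotient_topology X q) q"
  unfolding quotient_map_def by (simp add: topspace_quotient_topology openin_quotient_topology)

context loop_setup
begin

abbreviation "\<kappa> \<equiv> coset_coords \<Gamma>0 \<delta> A"

lemma kappa_def: "\<kappa> = the_inv_into (UNIV \<times> \<Gamma>0) q"
proof -
  have "(\<lambda>(v, M). gmat \<delta> 0 v M <#\<^bsub>\<Gamma>\<^esub> H) = q" by (auto simp: q_def)
  then show ?thesis by (simp add: coset_coords_def)
qed

lemma kappa_q [simp]: "M \<in> \<Gamma>0 \<Longrightarrow> \<kappa> (q (w, M)) = (w, M)"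
  unfolding kappa_def by (rule the_inv_into_f_f[OF inj_q]) simp

lemma kappa_q': "p \<in> carrier Q \<Longrightarrow> \<kappa> (q p) = p"
  by (cases p) (simp add: Q_simps)

lemma kappa_carrier: "X \<in> carrier L \<Longrightarrow> \<kappa> X \<in> carrier Q" and q_kappa: "X \<in> carrier L \<Longrightarrow> q (\<kappa> X) = X"
  by (auto simp: L_carrier' kappa_q')

lemma L_operations:
  assumes "X \<in> carrier L" "Y \<in> carrier L"
  shows "X \<otimes>\<^bsub>L\<^esub> Y = q (\<kappa> X \<otimes>\<^bsub>Q\<^esub> \<kappa> Y)" "ldiv L X Y = q (qldiv (\<kappa> X) (\<kappa> Y))" "rdiv L Y X = q (qrdiv (\<kappa> Y) (\<kappa> X))"
  using assms kappa_carrier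
  by (simp_all add: L_mult[symmetric] Q_division[symmetric] L_image(2,3)[symmetric] q_kappa)

text \<open>The coordinates of a coset are continuous on the quotient because, composed with the
  quotient map, they are rational in matrix entries. Conversely, continuous coordinates yield a
  continuous map to cosets through the representatives \<open>gmat \<delta> 0 w M\<close>. With
  continuity in both directions, the product of two quotient maps never has to be shown to be a
  quotient map.\<close>

lemma topological_loop_L:
  assumes T: "topological_field T"
  shows "topological_loop L (coset_topology T \<Gamma>0 \<delta> A)"
proof -
  let ?X = "subtopology (matrix_topology T) (carrier \<Gamma>)" and ?Y = "coset_topology T \<Gamma>0 \<delta> A"
  let ?c = "\<lambda>x. x <#\<^bsub>\<Gamma>\<^esub> H"
  have univ: "topspace T = UNIV" using T by (simp add: topological_field_def)
  have X: "topspace ?X = carrier \<Gamma>" by (simp add: topspace_matrix_topology[OF univ])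
  have quot: "quotient_map ?X ?Y ?c"
    unfolding coset_topology_def by (rule quotient_map_quotient_topology)
  have Y: "topspace ?Y = carrier L"
    unfolding coset_topology_def topspace_quotient_topology X by (auto simp: L_lcosets LCOSETS_def)
  note alg = function_algebra_continuous[OF T]
  have coords: "Q_fun (topspace ?Y) (continuous_map ?Y T) \<kappa>"
  proof -
    interpret X: function_algebra "topspace ?X" "continuous_map ?X T" by (rule alg)
    interpret Y: function_algebra "topspace ?Y" "continuous_map ?Y T" by (rule alg)
    define u v :: "'k^(unit + ('n + 'n))^(unit + ('n + 'n)) \<Rightarrow> 'k^'n"
      where "u = (\<lambda>x. \<chi> a. x $ Inr (Inl a) $ Inl ())" and "v = (\<lambda>x. \<chi> a. x $ Inr (Inr a) $ Inl ())"
    \<comment> \<open>\<open>D\<close> reads \<open>\<delta> M\<close> off the lower right block, so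
      its entries are continuous on \<Gamma> for an arbitrary endomorphism \<delta>.\<close>
    define M D :: "'k^(unit + ('n + 'n))^(unit + ('n + 'n)) \<Rightarrow> 'k^'n^'n"
      where "M = (\<lambda>x. \<chi> a b. x $ Inr (Inl a) $ Inr (Inl b))" and "D = (\<lambda>x. \<chi> a b. x $ Inr (Inr a) $ Inr (Inr b))"
    have "continuous_map ?X T (\<lambda>x. x $ i $ j)" for i j
      using continuous_map_matrix_topology[OF univ, of "matrix_topology T" "\<lambda>x. x"]
      by (intro continuous_map_from_subtopology) auto
    then have F: "X.Fv u" "X.Fv v" "X.Fm M" "X.Fm D"
      by (simp_all add: X.Fv_def X.Fm_def u_def v_def M_def D_def)
    have entries: "u (gmat \<delta> a b K) = a" "v (gmat \<delta> a b K) = b" "M (gmat \<delta> a b K) = K"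
      "D (gmat \<delta> a b K) = \<delta> K" for a b K
      by (simp_all add: u_def v_def M_def D_def gmat_entries)
    have inv: "X.Fm (\<lambda>x. matrix_inv (M x))"
      by (rule X.Fm_inv[OF F(3)]) (auto simp: X entries elim!: \<Gamma>_cases)
    have "X.Fv (\<lambda>x. fst (\<kappa> (?c x)))"
      by (rule X.Fv_cong[of "\<lambda>x. v x - D x *v (A *v (matrix_inv (M x) *v u x))"])
        (intro X.Fv_diff X.Fm_vector X.Fm_const F inv, auto simp: X entries gmat_lcoset_q elim!: \<Gamma>_cases)
    moreover have "X.Fm (\<lambda>x. snd (\<kappa> (?c x)))"
      by (rule X.Fm_cong[OF F(3)]) (auto simp: X entries gmat_lcoset_q elim!: \<Gamma>_cases)
    moreover have "X.Fm (\<lambda>x. \<delta> (snd (\<kappa> (?c x))))"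
      by (rule X.Fm_cong[OF F(4)]) (auto simp: X entries gmat_lcoset_q elim!: \<Gamma>_cases)
    moreover have "continuous_map ?Y T g" if "continuous_map ?X T (\<lambda>x. g (?c x))" for g
      using continuous_compose_quotient_map[OF quot, of T g] that by (simp add: o_def)
    moreover have "snd (\<kappa> x) \<in> \<Gamma>0" if "x \<in> carrier L" for x
      using kappa_carrier[OF that] by (auto simp: Q_simps)
    ultimately show ?thesis
      unfolding Q_fun_def X.Fv_def X.Fm_def Y.Fv_def Y.Fm_def by (simp add: Y)
  qed
  have into: "continuous_map Z ?Y (\<lambda>z. q (p z))" if p: "Q_fun (topspace Z) (continuous_map Z T) p" for Z and p :: "'z \<Rightarrow> _"
  proof -
    interpret Z: function_algebra "topspace Z" "continuous_map Z T" by (rule alg)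
    have F: "continuous_map Z T (\<lambda>z. fst (p z) $ i)" "continuous_map Z T (\<lambda>z. snd (p z) $ i $ j)"
      "continuous_map Z T (\<lambda>z. \<delta> (snd (p z)) $ i $ j)" for i j
      using p by (auto simp: Q_fun_def Z.Fv_def Z.Fm_def)
    have "continuous_map Z T (\<lambda>z. gmat \<delta> 0 (fst (p z)) (snd (p z)) $ i $ j)" for i j
      by (cases i; cases j; (cases "projr i")?; (cases "projr j")?) (auto simp: gmat_entries F univ)
    moreover have "snd (p z) \<in> \<Gamma>0" if "z \<in> topspace Z" for z using p that by (simp add: Q_fun_def)
    ultimately have "continuous_map Z ?X (\<lambda>z. gmat \<delta> 0 (fst (p z)) (snd (p z)))"
      by (auto simp: continuous_map_in_subtopology continuous_map_matrix_topology[OF univ])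
    then show ?thesis
      using continuous_map_compose[OF _ quotient_imp_continuous_map[OF quot]] by (fastforce simp: o_def q_def)
  qed
  let ?Z = "prod_topology ?Y ?Y"
  have proj: "Q_fun (topspace ?Z) (continuous_map ?Z T) (\<lambda>z. \<kappa> (\<pi> z))"
    if "continuous_map ?Z ?Y \<pi>" for \<pi>
  proof -
    interpret Z: function_algebra "topspace ?Z" "continuous_map ?Z T" by (rule alg)
    interpret Y: function_algebra "topspace ?Y" "continuous_map ?Y T" by (rule alg)
    have "continuous_map ?Z T (\<lambda>z. g (\<pi> z))" if "continuous_map ?Y T g" for g
      using continuous_map_compose[OF \<open>continuous_map ?Z ?Y \<pi>\<close> that] by (simp add: o_def)
    moreover have "\<pi> z \<in> topspace ?Y" if "z \<in> topspace ?Z" for z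
      using \<open>continuous_map ?Z ?Y \<pi>\<close> that by (meson continuous_map_image_subset_topspace image_subset_iff)
    ultimately show ?thesis
      using coords unfolding Q_fun_def Z.Fv_def Z.Fm_def Y.Fv_def Y.Fm_def by blast
  qed
  note ops = Q_fun_operations[OF alg proj[OF continuous_map_fst] proj[OF continuous_map_snd], THEN into]
  have "continuous_map ?Z ?Y (\<lambda>(x, y). x \<otimes>\<^bsub>L\<^esub> y)" "continuous_map ?Z ?Y (\<lambda>(x, y). ldiv L x y)"
    "continuous_map ?Z ?Y (\<lambda>(x, y). rdiv L y x)"
    by (rule continuous_map_eq[OF ops(1)] continuous_map_eq[OF ops(2)] continuous_map_eq[OF ops(3)];
        auto simp: Y L_operations)+
  then show ?thesis unfolding topological_loop_def by (simp add: loop_L Y)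
qed

end

section \<open>Power series in several variables\<close>

text \<open>For real families unconditional and absolute summability coincide, and the norm is at
  most the sum of the finitely many absolute coordinates.\<close>

lemma euclidean_summable_imp_abs_summable:
  fixes f :: "'a \<Rightarrow> 'f::euclidean_space"
  assumes "f summable_on A"
  shows "(\<lambda>k. norm (f k)) summable_on A"
proof (rule summable_on_comparison_test)
  obtain s where s: "(f has_sum s) A" using assms by (auto simp: summable_on_def)
  have "(\<lambda>x. f x \<bullet> b) summable_on A" for b
    using has_sum_bounded_linear[OF bounded_linear_inner_left s, of b] has_sum_imp_summable by blast
  then have "(\<lambda>x. \<bar>f x \<bullet> b\<bar>) summable_on A" for b
    using summable_on_iff_abs_summable_on_real by fastforce
  then have "(\<lambda>x. \<Sum>b\<in>F. \<bar>f x \<bullet> b\<bar>) summable_on A" for F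
    by (induction F rule: infinite_finite_induct) (auto intro: summable_on_add)
  then show "(\<lambda>x. \<Sum>b\<in>Basis. \<bar>f x \<bullet> b\<bar>) summable_on A" .
qed (auto intro: norm_le_l1)

text \<open>Absolute summability of both factors makes the double family summable; its value follows
  by summing over \<open>y\<close> and then over \<open>x\<close>.\<close>

lemma has_sum_product:
  fixes f :: "'a \<Rightarrow> 'f::{real_normed_field,euclidean_space}"
  assumes f: "(f has_sum s) A" and g: "(g has_sum t) B"
  shows "((\<lambda>(x, y). f x * g y) has_sum (s * t)) (A \<times> B)"
proof -
  have abs: "(\<lambda>k. norm (f k)) summable_on A" "(\<lambda>k. norm (g k)) summable_on B"
    using f g euclidean_summable_imp_abs_summable has_sum_imp_summable by blast+
  have "(\<lambda>k. norm ((\<lambda>(x, y). f x * g y) k)) summable_on A \<times> B"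
    unfolding Infinite_Sum.abs_summable_on_Sigma_iff
  proof (intro conjI ballI)
    show "(\<lambda>k. norm ((\<lambda>y. case (x, y) of (x, y) \<Rightarrow> f x * g y) k)) summable_on B" for x
      using abs(2) by (auto simp: norm_mult intro: summable_on_cmult_right)
    show "(\<lambda>k. norm ((\<lambda>x. \<Sum>\<^sub>\<infinity>y\<in>B. norm (case (x, y) of (x, y) \<Rightarrow> f x * g y)) k)) summable_on A"
      using abs by (auto simp: norm_mult infsum_cmult_right' abs_mult intro: summable_on_cmult_left)
  qed
  then have sum: "(\<lambda>(x, y). f x * g y) summable_on A \<times> B" by (rule Infinite_Sum.abs_summable_summable)
  then obtain u where u: "((\<lambda>(x, y). f x * g y) has_sum u) (A \<times> B)" by (auto simp: summable_on_def)
  have "((\<lambda>x. f x * t) has_sum u) A"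
    by (rule has_sum_SigmaD[OF u]) (use has_sum_cmult_right[OF g] in auto)
  moreover have "((\<lambda>x. f x * t) has_sum (s * t)) A" using f by (rule has_sum_cmult_left)
  ultimately show ?thesis using u has_sum_unique by blast
qed

text \<open>The \<open>n\<close>-th power of the series is expanded into words: a list of length
  \<open>n\<close> records the term chosen from each factor.\<close>

lemma has_sum_lists_length:
  fixes t :: "'a \<Rightarrow> 'f::{real_normed_field,euclidean_space}"
  assumes "(t has_sum T) M"
  shows "((\<lambda>l. prod_list (map t l)) has_sum T ^ n) {l \<in> lists M. length l = n}"
proof (induction n)
  case 0
  have "{l \<in> lists M. length l = 0} = {[]}" by auto
  then show ?case by (simp add: has_sum_finiteI)
next
  case (Suc n)
  have "bij_betw (\<lambda>(x, l). x # l) (M \<times> {l \<in> lists M. length l = n}) {l \<in> lists M. length l = Suc n}"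
    by (rule bij_betwI[where g = "\<lambda>l. (hd l, tl l)"]) (auto simp: length_Suc_conv in_lists_conv_set)
  moreover have "((\<lambda>p. prod_list (map t (case p of (x, l) \<Rightarrow> x # l))) has_sum T ^ Suc n)
      (M \<times> {l \<in> lists M. length l = n})"
    using has_sum_product[OF assms Suc] by (simp add: case_prod_unfold)
  ultimately show ?case by (subst (asm) has_sum_reindex_bij_betw)
qed

text \<open>The geometric series for \<open>T\<close>, fully expanded into words over
  \<open>M\<close> and grouped by length. The norms of the words of length \<open>n\<close> add up
  to \<open>q ^ n\<close>, so \<open>q < 1\<close> justifies the rearrangement.\<close>

lemma has_sum_lists:
  fixes t :: "'a \<Rightarrow> 'f::{real_normed_field,euclidean_space}"
  assumes T: "(t has_sum T) M" and q: "((\<lambda>x. norm (t x)) has_sum q) M" "q < 1"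
  shows "((\<lambda>l. prod_list (map t l)) has_sum inverse (1 - T)) (lists M)"
proof -
  let ?L = "\<lambda>n. {l \<in> lists M. length l = n}" and ?p = "\<lambda>p :: nat \<times> 'a list. prod_list (map t (snd p))"
  have norm: "norm (prod_list (map t l)) = prod_list (map (\<lambda>x. norm (t x)) l)" for l
    by (induction l) (auto simp: norm_mult)
  have q0: "0 \<le> q" using q(1) by (rule has_sum_nonneg) simp
  have "norm T \<le> q"
    using norm_infsum_bound[of t M] q(1) T by (simp add: has_sum_iff)
  have "(\<lambda>k. norm (?p k)) summable_on Sigma UNIV ?L"
    unfolding Infinite_Sum.abs_summable_on_Sigma_iff
  proof (intro conjI ballI)
    fix n
    show "(\<lambda>k. norm ((\<lambda>l. ?p (n, l)) k)) summable_on ?L n"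
      using has_sum_lists_length[OF q(1)] by (auto simp: norm dest: has_sum_imp_summable)
    have "(\<Sum>\<^sub>\<infinity>l\<in>?L n. norm (?p (n, l))) = q ^ n" for n
      using infsumI[OF has_sum_lists_length[OF q(1)]] by (simp add: norm)
    moreover have "(\<lambda>n. q ^ n) summable_on UNIV"
      by (rule norm_summable_imp_summable_on) (use q0 q(2) in simp)
    ultimately show "(\<lambda>k. norm ((\<lambda>n. \<Sum>\<^sub>\<infinity>l\<in>?L n. norm (?p (n, l))) k)) summable_on UNIV"
      using q0 by simp
  qed
  then have "?p summable_on Sigma UNIV ?L" by (rule Infinite_Sum.abs_summable_summable)
  then obtain s where s: "(?p has_sum s) (Sigma UNIV ?L)" by (auto simp: summable_on_def)
  have "((\<lambda>n. T ^ n) has_sum s) UNIV"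
    by (rule has_sum_SigmaD[OF s]) (use has_sum_lists_length[OF T] in auto)
  then have "(\<lambda>n. T ^ n) sums s" by (rule has_sum_imp_sums)
  moreover have "(\<lambda>n. T ^ n) sums (1 / (1 - T))"
    using \<open>norm T \<le> q\<close> q(2) by (intro geometric_sums) simp
  ultimately have "s = inverse (1 - T)" by (simp add: sums_unique2 inverse_eq_divide)
  moreover have "bij_betw snd (Sigma UNIV ?L) (lists M)"
    by (rule bij_betwI[where g = "\<lambda>l. (length l, l)"]) auto
  ultimately show ?thesis
    using s has_sum_reindex_bij_betw[of snd "Sigma UNIV ?L" "lists M" "\<lambda>l. prod_list (map t l)"]
    by simp
qed

section \<open>Local power series and their closure under the field operations\<close>

abbreviation multi_indices :: "'i set \<Rightarrow> ('i \<Rightarrow> nat) set" where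
  "multi_indices I \<equiv> I \<rightarrow>\<^sub>E UNIV"

definition monomial :: "'i set \<Rightarrow> ('i \<Rightarrow> 'f::real_normed_field) \<Rightarrow> ('i \<Rightarrow> nat) \<Rightarrow> ('i \<Rightarrow> 'f) \<Rightarrow> 'f" where
  "monomial I a \<alpha> x = (\<Prod>i\<in>I. (x i - a i) ^ \<alpha> i)"

definition polydisc :: "'i set \<Rightarrow> ('i \<Rightarrow> 'f::real_normed_field) \<Rightarrow> real \<Rightarrow> ('i \<Rightarrow> 'f) set" where
  "polydisc I a r = {x \<in> I \<rightarrow>\<^sub>E UNIV. \<forall>i\<in>I. norm (x i - a i) < r}"

text \<open>The openness contained in \<open>analytic_fun\<close>, separated from the expansion at a
  point so that the closure properties can be proved pointwise.\<close>

definition poly_open :: "'i set \<Rightarrow> ('i \<Rightarrow> 'f::real_normed_field) set \<Rightarrow> bool" where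
  "poly_open I W \<longleftrightarrow> W \<subseteq> I \<rightarrow>\<^sub>E UNIV \<and> (\<forall>a\<in>W. \<exists>r>0. polydisc I a r \<subseteq> W)"

definition analytic_at :: "'i set \<Rightarrow> (('i \<Rightarrow> 'f) \<Rightarrow> 'f) \<Rightarrow> ('i \<Rightarrow> 'f::real_normed_field) \<Rightarrow> bool" where
  "analytic_at I f a \<longleftrightarrow> (\<exists>r>0. \<exists>c. \<forall>x\<in>polydisc I a r.
    ((\<lambda>\<alpha>. c \<alpha> * monomial I a \<alpha> x) has_sum f x) (multi_indices I))"

lemma polydisc_mono: "r \<le> s \<Longrightarrow> polydisc I a r \<subseteq> polydisc I a s"
  by (auto simp: polydisc_def)

lemma center_in_polydisc: "a \<in> I \<rightarrow>\<^sub>E UNIV \<Longrightarrow> 0 < r \<Longrightarrow> a \<in> polydisc I a r"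
  by (simp add: polydisc_def)

lemma analytic_fun_alt: "analytic_fun I W f \<longleftrightarrow> W \<subseteq> I \<rightarrow>\<^sub>E UNIV \<and>
  (\<forall>a\<in>W. \<exists>r>0. \<exists>c. \<forall>x\<in>polydisc I a r. x \<in> W \<and>
    ((\<lambda>\<alpha>. c \<alpha> * monomial I a \<alpha> x) has_sum f x) (multi_indices I))"
  unfolding analytic_fun_def polydisc_def monomial_def Ball_def mem_Collect_eq imp_conjL ..

lemma analytic_fun_iff: "analytic_fun I W f \<longleftrightarrow> poly_open I W \<and> (\<forall>a\<in>W. analytic_at I f a)"
proof
  assume L: "analytic_fun I W f"
  have "(\<exists>r>0. polydisc I a r \<subseteq> W) \<and> analytic_at I f a" if a: "a \<in> W" for a
  proof -
    obtain r c where r: "r > 0" "\<forall>x\<in>polydisc I a r. x \<in> W \<and>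
        ((\<lambda>\<alpha>. c \<alpha> * monomial I a \<alpha> x) has_sum f x) (multi_indices I)"
      using bspec[OF conjunct2[OF L[unfolded analytic_fun_alt]] a] by (elim exE conjE)
    then have "polydisc I a r \<subseteq> W" by blast
    with r show ?thesis unfolding analytic_at_def by blast
  qed
  with L show "poly_open I W \<and> (\<forall>a\<in>W. analytic_at I f a)"
    unfolding poly_open_def analytic_fun_alt by simp
next
  assume R: "poly_open I W \<and> (\<forall>a\<in>W. analytic_at I f a)"
  show "analytic_fun I W f" unfolding analytic_fun_def
  proof (intro conjI ballI)
    show "W \<subseteq> I \<rightarrow>\<^sub>E UNIV" using R by (simp add: poly_open_def)
    fix a assume "a \<in> W"
    then obtain r s c where r: "r > 0" "polydisc I a r \<subseteq> W" and s: "s > 0"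
      "\<forall>x\<in>polydisc I a s. ((\<lambda>\<alpha>. c \<alpha> * monomial I a \<alpha> x) has_sum f x) (multi_indices I)"
      using R unfolding poly_open_def analytic_at_def by blast
    show "\<exists>r>0. \<exists>c. \<forall>x\<in>I \<rightarrow>\<^sub>E UNIV. (\<forall>i\<in>I. norm (x i - a i) < r) \<longrightarrow>
      x \<in> W \<and> ((\<lambda>\<alpha>. c \<alpha> * (\<Prod>i\<in>I. (x i - a i) ^ \<alpha> i)) has_sum f x) (multi_indices I)"
    proof (intro exI[of _ "min r s"] exI[of _ c] conjI ballI impI)
      fix x :: "'a \<Rightarrow> 'b" assume "x \<in> I \<rightarrow>\<^sub>E UNIV" "\<forall>i\<in>I. norm (x i - a i) < min r s"
      then have "x \<in> polydisc I a r" "x \<in> polydisc I a s" by (auto simp: polydisc_def)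
      then show "x \<in> W" "((\<lambda>\<alpha>. c \<alpha> * (\<Prod>i\<in>I. (x i - a i) ^ \<alpha> i)) has_sum f x) (multi_indices I)"
        using r s by (auto simp: monomial_def)
    qed (use r s in simp)
  qed
qed

lemma analytic_at_cong:
  assumes "analytic_at I f a" "0 < r" "\<And>x. x \<in> polydisc I a r \<Longrightarrow> f x = g x"
  shows "analytic_at I g a"
proof -
  obtain s c where s: "s > 0"
    "\<forall>x\<in>polydisc I a s. ((\<lambda>\<alpha>. c \<alpha> * monomial I a \<alpha> x) has_sum f x) (multi_indices I)"
    using assms(1) unfolding analytic_at_def by blast
  show ?thesis unfolding analytic_at_def
  proof (intro exI[of _ "min r s"] exI[of _ c] conjI ballI)
    fix x assume "x \<in> polydisc I a (min r s)"
    then have "x \<in> polydisc I a r" "x \<in> polydisc I a s" by (auto simp: polydisc_def)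
    then show "((\<lambda>\<alpha>. c \<alpha> * monomial I a \<alpha> x) has_sum g x) (multi_indices I)" using s assms(3) by auto
  qed (use s assms in simp)
qed

text \<open>Applied below with pairs of multi-indices for a product, and with lists of multi-indices for the
  geometric series of an inverse.\<close>

lemma analytic_at_regroup:
  fixes f :: "('i \<Rightarrow> 'f) \<Rightarrow> 'f::{real_normed_field,banach}"
  assumes r: "0 < r" and m: "\<And>k. k \<in> K \<Longrightarrow> m k \<in> multi_indices I"
    and sum: "\<And>x. x \<in> polydisc I a r \<Longrightarrow> ((\<lambda>k. d k * monomial I a (m k) x) has_sum f x) K"
  shows "analytic_at I f a"
  unfolding analytic_at_def
proof (intro exI[of _ r] exI[of _ "\<lambda>\<alpha>. infsum d {k \<in> K. m k = \<alpha>}"] conjI ballI)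
  fix x assume x: "x \<in> polydisc I a r"
  let ?t = "\<lambda>k. d k * monomial I a (m k) x" and ?K = "\<lambda>\<alpha>. {k \<in> K. m k = \<alpha>}"
  have "bij_betw snd (Sigma (multi_indices I) ?K) K"
    by (rule bij_betwI[where g = "\<lambda>k. (m k, k)"]) (use m in auto)
  then have "((\<lambda>p. ?t (snd p)) has_sum f x) (Sigma (multi_indices I) ?K)"
    using sum[OF x] has_sum_reindex_bij_betw[of snd _ K ?t] by blast
  then have "((\<lambda>\<alpha>. infsum ?t (?K \<alpha>)) has_sum f x) (multi_indices I)"
  proof (rule has_sum_SigmaD)
    fix \<alpha>
    have "?t summable_on ?K \<alpha>"
      by (rule summable_on_subset_banach[OF has_sum_imp_summable[OF sum[OF x]]]) blast
    then show "((\<lambda>y. ?t (snd (\<alpha>, y))) has_sum infsum ?t (?K \<alpha>)) (?K \<alpha>)"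
      unfolding snd_conv by (rule has_sum_infsum)
  qed
  moreover have "infsum ?t (?K \<alpha>) = infsum d (?K \<alpha>) * monomial I a \<alpha> x" for \<alpha>
    unfolding infsum_cmult_left'[symmetric] by (rule infsum_cong) auto
  ultimately show "((\<lambda>\<alpha>. infsum d (?K \<alpha>) * monomial I a \<alpha> x) has_sum f x) (multi_indices I)" by simp
qed (rule r)

lemma analytic_at_const: "analytic_at I (\<lambda>_. c :: 'f::{real_normed_field,banach}) a"
  by (rule analytic_at_regroup[of 1 "{()}" "\<lambda>_. \<lambda>i\<in>I. 0" _ _ "\<lambda>_. c"])
    (auto simp: monomial_def has_sum_finiteI)

lemma analytic_at_coordinate:
  fixes a :: "'i \<Rightarrow> 'f::{real_normed_field,banach}"
  assumes "finite I" "j \<in> I"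
  shows "analytic_at I (\<lambda>x. x j) a"
\<comment> \<open>The expansion has two terms: \<open>a j\<close> at the zero multi-index and
  \<open>x j - a j\<close> at the unit multi-index of \<open>j\<close>.\<close>
proof (rule analytic_at_regroup[of 1 UNIV "\<lambda>b. \<lambda>i\<in>I. if b \<and> i = j then 1 else 0" _ _ "\<lambda>b. if b then 1 else a j"])
  fix x :: "'i \<Rightarrow> 'f"
  have "monomial I a (\<lambda>i\<in>I. if i = j then 1 else 0) x = (\<Prod>i\<in>I. if i = j then x i - a i else 1)"
    unfolding monomial_def by (intro prod.cong) auto
  also have "\<dots> = x j - a j" using assms by simp
  finally show "((\<lambda>b. (if b then 1 else a j) * monomial I a (\<lambda>i\<in>I. if b \<and> i = j then 1 else 0) x) has_sum x j) UNIV"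
    by (intro has_sum_finiteI) (simp_all add: UNIV_bool monomial_def)
qed auto

lemma analytic_at_series:
  assumes "analytic_at I f a" "analytic_at I g a"
  obtains r c d where "r > 0"
    "\<And>x. x \<in> polydisc I a r \<Longrightarrow> ((\<lambda>\<alpha>. c \<alpha> * monomial I a \<alpha> x) has_sum f x) (multi_indices I)"
    "\<And>x. x \<in> polydisc I a r \<Longrightarrow> ((\<lambda>\<alpha>. d \<alpha> * monomial I a \<alpha> x) has_sum g x) (multi_indices I)"
proof -
  obtain r c where r: "r > 0"
    "\<And>x. x \<in> polydisc I a r \<Longrightarrow> ((\<lambda>\<alpha>. c \<alpha> * monomial I a \<alpha> x) has_sum f x) (multi_indices I)"
    using assms(1) unfolding analytic_at_def by blast
  obtain s d where s: "s > 0"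
    "\<And>x. x \<in> polydisc I a s \<Longrightarrow> ((\<lambda>\<alpha>. d \<alpha> * monomial I a \<alpha> x) has_sum g x) (multi_indices I)"
    using assms(2) unfolding analytic_at_def by blast
  show thesis
    by (rule that[of "min r s" c d])
      (use r s polydisc_mono[of "min r s" r I a] polydisc_mono[of "min r s" s I a] in auto)
qed

lemma analytic_at_add:
  assumes "analytic_at I f a" "analytic_at I g a"
  shows "analytic_at I (\<lambda>x. f x + g x) a"
proof -
  obtain r c d where "r > 0"
    "\<And>x. x \<in> polydisc I a r \<Longrightarrow> ((\<lambda>\<alpha>. c \<alpha> * monomial I a \<alpha> x) has_sum f x) (multi_indices I)"
    "\<And>x. x \<in> polydisc I a r \<Longrightarrow> ((\<lambda>\<alpha>. d \<alpha> * monomial I a \<alpha> x) has_sum g x) (multi_indices I)"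
    by (rule analytic_at_series[OF assms]) (rule that)
  then show ?thesis unfolding analytic_at_def
    by (intro exI[of _ r] conjI exI[of _ "\<lambda>\<alpha>. c \<alpha> + d \<alpha>"] ballI) (auto simp: ring_distribs intro: has_sum_add)
qed

lemma analytic_at_mult:
  fixes f :: "('i \<Rightarrow> 'f) \<Rightarrow> 'f::{real_normed_field,euclidean_space}"
  assumes "analytic_at I f a" "analytic_at I g a"
  shows "analytic_at I (\<lambda>x. f x * g x) a"
proof -
  obtain r c d where r: "r > 0"
    "\<And>x. x \<in> polydisc I a r \<Longrightarrow> ((\<lambda>\<alpha>. c \<alpha> * monomial I a \<alpha> x) has_sum f x) (multi_indices I)"
    "\<And>x. x \<in> polydisc I a r \<Longrightarrow> ((\<lambda>\<alpha>. d \<alpha> * monomial I a \<alpha> x) has_sum g x) (multi_indices I)"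
    by (rule analytic_at_series[OF assms]) (rule that)
  show ?thesis
  proof (rule analytic_at_regroup[OF r(1), of "multi_indices I \<times> multi_indices I"
        "\<lambda>(\<alpha>, \<beta>). \<lambda>i\<in>I. \<alpha> i + \<beta> i" _ _ "\<lambda>(\<alpha>, \<beta>). c \<alpha> * d \<beta>"])
    fix x assume x: "x \<in> polydisc I a r"
    have "monomial I a (\<lambda>i\<in>I. \<alpha> i + \<beta> i) x = monomial I a \<alpha> x * monomial I a \<beta> x" for \<alpha> \<beta>
      by (simp add: monomial_def prod.distrib[symmetric] power_add)
    then show "((\<lambda>k. (case k of (\<alpha>, \<beta>) \<Rightarrow> c \<alpha> * d \<beta>) * monomial I a (case k of (\<alpha>, \<beta>) \<Rightarrow> \<lambda>i\<in>I. \<alpha> i + \<beta> i) x)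
        has_sum f x * g x) (multi_indices I \<times> multi_indices I)"
      using has_sum_product[OF r(2)[OF x] r(3)[OF x]] by (simp add: case_prod_unfold mult_ac)
  qed auto
qed

text \<open>Factoring out the constant term gives \<open>f x = c z * (1 - T)\<close>, where
  \<open>T\<close> collects the terms with nonzero multi-index. On a small enough polydisc the norms
  of these terms sum to less than 1, and the geometric series over words of multi-indices is a power
  series for the inverse.\<close>

lemma analytic_at_inverse:
  fixes f :: "('i \<Rightarrow> 'f) \<Rightarrow> 'f::{real_normed_field,euclidean_space}"
  assumes I: "finite I" and a: "a \<in> I \<rightarrow>\<^sub>E UNIV" and f: "analytic_at I f a" and nz: "f a \<noteq> 0"
  shows "analytic_at I (\<lambda>x. inverse (f x)) a"
proof -
  obtain R c where R: "R > 0"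
    "\<And>x. x \<in> polydisc I a R \<Longrightarrow> ((\<lambda>\<alpha>. c \<alpha> * monomial I a \<alpha> x) has_sum f x) (multi_indices I)"
    using f unfolding analytic_at_def by blast
  \<comment> \<open>Halving leaves room: the point with every coordinate displaced by
    \<open>r\<close> still lies in the polydisc of radius \<open>R\<close>.\<close>
  define r where "r = R / 2"
  have r: "0 < r" "r < R" using R(1) by (auto simp: r_def)
  define z :: "'i \<Rightarrow> nat" where "z = (\<lambda>i\<in>I. 0)"
  define M where "M = multi_indices I - {z}"
  have zM: "multi_indices I = insert z M" "z \<notin> M" by (auto simp: M_def z_def)
  have mono_z: "monomial I a z x = 1" for x by (simp add: monomial_def z_def)
  have nonzero: "\<exists>i\<in>I. 0 < \<alpha> i" if "\<alpha> \<in> M" for \<alpha>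
  proof (rule ccontr)
    assume "\<not> ?thesis"
    then have "\<alpha> = z" using that by (auto simp: M_def z_def PiE_def extensional_def fun_eq_iff)
    then show False using that zM by simp
  qed
  have split: "((\<lambda>\<alpha>. c \<alpha> * monomial I a \<alpha> x) has_sum (f x - c z)) M" if "x \<in> polydisc I a R" for x
  proof -
    have sum: "((\<lambda>\<alpha>. c \<alpha> * monomial I a \<alpha> x) has_sum f x) (insert z M)"
      using R(2)[OF that] by (simp only: zM(1))
    then have "(\<lambda>\<alpha>. c \<alpha> * monomial I a \<alpha> x) summable_on M"
      by (intro summable_on_subset_banach[OF has_sum_imp_summable]) auto
    then obtain s where s: "((\<lambda>\<alpha>. c \<alpha> * monomial I a \<alpha> x) has_sum s) M"
      unfolding summable_on_def ..
    have "f x = c z + s"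
      using has_sum_unique[OF sum has_sum_insert[OF zM(2) s]] by (simp add: mono_z)
    then show ?thesis using s by simp
  qed
  have fa: "f a = c z"
  proof -
    have "monomial I a \<alpha> a = 0" if "\<alpha> \<in> M" for \<alpha>
      using nonzero[OF that] I by (auto simp: monomial_def power_0_left intro!: prod_zero)
    then have "((\<lambda>\<alpha>. c \<alpha> * monomial I a \<alpha> a) has_sum 0) M" by (intro has_sum_0) auto
    then show ?thesis using split[OF center_in_polydisc[OF a R(1)]] has_sum_unique by fastforce
  qed
  define N where "N \<alpha> = norm (c \<alpha>) * r ^ sum \<alpha> I" for \<alpha>
  have N: "N summable_on M"
  proof -
    \<comment> \<open>At this point each monomial has norm \<open>r ^ sum \<alpha> I\<close>, so
      absolute convergence there is summability of \<open>N\<close>.\<close>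
    define x0 :: "'i \<Rightarrow> 'f" where "x0 = (\<lambda>i\<in>I. a i + of_real r)"
    have "x0 \<in> polydisc I a R" using r by (auto simp: polydisc_def x0_def)
    then have "(\<lambda>k. norm ((\<lambda>\<alpha>. c \<alpha> * monomial I a \<alpha> x0) k)) summable_on M"
      using split euclidean_summable_imp_abs_summable has_sum_imp_summable by blast
    moreover have "norm (c \<alpha> * monomial I a \<alpha> x0) = N \<alpha>" for \<alpha>
      using r by (simp add: N_def monomial_def x0_def norm_mult norm_power prod_norm[symmetric] power_sum)
    ultimately show ?thesis by simp
  qed
  define S where "S = infsum N M"
  have S: "S \<ge> 0" unfolding S_def by (rule infsum_nonneg) (use r in \<open>simp add: N_def\<close>)
  have cz: "0 < norm (c z)" using nz fa by simp
  \<comment> \<open>The second bound makes \<open>\<rho> / r * S\<close> at most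
    \<open>norm (c z) * S / (2 * (S + 1))\<close>, which is below \<open>norm (c z)\<close>; the
    summand 1 keeps the denominator positive when \<open>S = 0\<close>.\<close>
  define \<rho> where "\<rho> = min r (r * norm (c z) / (2 * (S + 1)))"
  have \<rho>: "0 < \<rho>" "\<rho> \<le> r" using r cz S by (auto simp: \<rho>_def)
  have small: "\<rho> / r * S < norm (c z)"
  proof -
    have "\<rho> / r * S \<le> (r * norm (c z) / (2 * (S + 1))) / r * S"
      using r S by (intro mult_right_mono divide_right_mono) (auto simp: \<rho>_def)
    also have "\<dots> = norm (c z) * (S / (2 * (S + 1)))" using r by simp
    also have "\<dots> < norm (c z) * 1" using cz S by (intro mult_strict_left_mono) (auto simp: field_simps)
    finally show ?thesis by simp
  qed
  define b where "b \<alpha> = - c \<alpha> / c z" for \<alpha>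
  define m where "m l = (\<lambda>i\<in>I. \<Sum>\<alpha>\<leftarrow>l. \<alpha> i)" for l :: "('i \<Rightarrow> nat) list"
  have mono_m: "monomial I a (m l) x = prod_list (map (\<lambda>\<alpha>. monomial I a \<alpha> x) l)" for l x
  proof (induction l)
    case Nil
    then show ?case by (simp add: m_def monomial_def)
  next
    case (Cons \<alpha> l)
    have "monomial I a (m (\<alpha> # l)) x = monomial I a \<alpha> x * monomial I a (m l) x"
      by (simp add: monomial_def m_def prod.distrib[symmetric] power_add)
    then show ?case using Cons by simp
  qed
  show ?thesis
  proof (rule analytic_at_regroup[OF \<rho>(1), of "lists M" m _ _ "\<lambda>l. inverse (c z) * prod_list (map b l)"])
    show "m l \<in> multi_indices I" for l by (simp add: m_def)
    fix x assume x: "x \<in> polydisc I a \<rho>"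
    then have xR: "x \<in> polydisc I a R" using \<rho> r polydisc_mono[of \<rho> R I a] by auto
    define t where "t \<alpha> = b \<alpha> * monomial I a \<alpha> x" for \<alpha>
    have T: "(t has_sum (1 - f x / c z)) M"
    proof -
      have "((\<lambda>\<alpha>. (- 1 / c z) * (c \<alpha> * monomial I a \<alpha> x)) has_sum (- 1 / c z) * (f x - c z)) M"
        by (rule has_sum_cmult_right[OF split[OF xR]])
      moreover have "(- 1 / c z) * (f x - c z) = 1 - f x / c z" using cz by (simp add: field_simps)
      moreover have "(\<lambda>\<alpha>. (- 1 / c z) * (c \<alpha> * monomial I a \<alpha> x)) = t"
        by (simp add: fun_eq_iff t_def b_def)
      ultimately show ?thesis by simp
    qed
    have bound: "norm (t \<alpha>) \<le> \<rho> / r * N \<alpha> / norm (c z)" if \<alpha>: "\<alpha> \<in> M" for \<alpha>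
    proof -
      \<comment> \<open>As the multi-index is nonzero, one factor \<rho> can be kept while the other
        \<open>n\<close> are weakened to \<open>r\<close>; this gains \<rho> / r over
        \<open>N\<close>.\<close>
      obtain n where n: "sum \<alpha> I = Suc n"
        using nonzero[OF \<alpha>] I by (metis not0_implies_Suc not_gr_zero sum_eq_0_iff)
      have "norm (monomial I a \<alpha> x) \<le> (\<Prod>i\<in>I. \<rho> ^ \<alpha> i)"
        unfolding monomial_def prod_norm[symmetric] norm_power by (intro prod_mono conjI power_mono zero_le_power norm_ge_zero) (use x in \<open>auto simp: polydisc_def less_imp_le\<close>)
      also have "\<dots> = \<rho> * \<rho> ^ n" by (simp add: power_sum[symmetric] n)
      also have "\<dots> \<le> \<rho> * r ^ n" using \<rho> by (intro mult_left_mono power_mono) auto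
      also have "\<dots> = \<rho> / r * r ^ sum \<alpha> I" using r by (simp add: n)
      finally have "norm (c \<alpha>) * norm (monomial I a \<alpha> x) \<le> norm (c \<alpha>) * (\<rho> / r * r ^ sum \<alpha> I)"
        by (intro mult_left_mono) auto
      then have "norm (c \<alpha>) * norm (monomial I a \<alpha> x) / norm (c z) \<le> \<rho> / r * N \<alpha> / norm (c z)"
        by (intro divide_right_mono) (simp_all add: N_def mult_ac)
      then show ?thesis by (simp add: t_def b_def norm_mult norm_divide)
    qed
    have Nsum: "((\<lambda>\<alpha>. \<rho> / r * N \<alpha> / norm (c z)) has_sum (\<rho> / r * S / norm (c z))) M"
      unfolding S_def divide_inverse[of _ "norm (c z)"]
      by (intro has_sum_cmult_left has_sum_cmult_right has_sum_infsum N)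
    have "(\<lambda>k. norm (t k)) summable_on M"
      using T euclidean_summable_imp_abs_summable has_sum_imp_summable by blast
    then have q: "((\<lambda>\<alpha>. norm (t \<alpha>)) has_sum infsum (\<lambda>\<alpha>. norm (t \<alpha>)) M) M" by simp
    have "infsum (\<lambda>\<alpha>. norm (t \<alpha>)) M \<le> \<rho> / r * S / norm (c z)"
      by (rule has_sum_mono[OF q Nsum bound])
    also have "\<dots> < 1" using small cz by (simp only: divide_less_eq_1_pos)
    finally have "((\<lambda>l. prod_list (map t l)) has_sum inverse (1 - (1 - f x / c z))) (lists M)"
      by (rule has_sum_lists[OF T q])
    then have "((\<lambda>l. inverse (c z) * prod_list (map t l)) has_sum inverse (c z) * inverse (f x / c z)) (lists M)"
      by (intro has_sum_cmult_right) simp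
    moreover have "inverse (c z) * inverse (f x / c z) = inverse (f x)" using cz by (simp add: field_simps)
    moreover have "prod_list (map t l) = prod_list (map b l) * monomial I a (m l) x" for l
      unfolding mono_m t_def by (induction l) simp_all
    ultimately show "((\<lambda>l. inverse (c z) * prod_list (map b l) * monomial I a (m l) x) has_sum inverse (f x)) (lists M)"
      by (simp add: mult.assoc)
  qed
qed

text \<open>A function of the coordinates selected by \<open>e\<close> has the same series over the
  larger coordinate set, with exponent 0 at all other coordinates.\<close>

lemma analytic_at_lift:
  fixes f :: "('j \<Rightarrow> 'f) \<Rightarrow> 'f::{real_normed_field,banach}"
  assumes I: "finite I" and e: "inj_on e J" "e ` J \<subseteq> I"
    and f: "analytic_at J f (restrict (a \<circ> e) J)"
  shows "analytic_at I (\<lambda>x. f (restrict (x \<circ> e) J)) a"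
proof -
  obtain r c where r: "r > 0" "\<And>y. y \<in> polydisc J (restrict (a \<circ> e) J) r \<Longrightarrow>
    ((\<lambda>\<alpha>. c \<alpha> * monomial J (restrict (a \<circ> e) J) \<alpha> y) has_sum f y) (multi_indices J)"
    using f unfolding analytic_at_def by blast
  let ?m = "\<lambda>\<alpha>. \<lambda>i\<in>I. if i \<in> e ` J then \<alpha> (the_inv_into J e i) else 0"
  show ?thesis
  proof (rule analytic_at_regroup[OF r(1), of "multi_indices J" ?m _ _ c])
    fix x assume x: "x \<in> polydisc I a r"
    have "monomial I a (?m \<alpha>) x = monomial J (restrict (a \<circ> e) J) \<alpha> (restrict (x \<circ> e) J)" for \<alpha>
    proof -
      have "monomial I a (?m \<alpha>) x = (\<Prod>i\<in>e ` J. (x i - a i) ^ ?m \<alpha> i)"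
        unfolding monomial_def using I e(2) by (intro prod.mono_neutral_right) auto
      also have "\<dots> = (\<Prod>j\<in>J. (x (e j) - a (e j)) ^ \<alpha> j)"
        unfolding prod.reindex[OF e(1)] using e(2) by (intro prod.cong) (auto simp: the_inv_into_f_f[OF e(1)])
      finally show ?thesis by (simp add: monomial_def)
    qed
    moreover have "restrict (x \<circ> e) J \<in> polydisc J (restrict (a \<circ> e) J) r"
      using x e(2) by (auto simp: polydisc_def)
    ultimately show "((\<lambda>\<alpha>. c \<alpha> * monomial I a (?m \<alpha>) x) has_sum f (restrict (x \<circ> e) J)) (multi_indices J)"
      using r(2) by simp
  qed auto
qed

lemma analytic_fun_lift:
  fixes f :: "('j \<Rightarrow> 'f) \<Rightarrow> 'f::{real_normed_field,banach}"
  assumes "finite I" "inj_on e J" "e ` J \<subseteq> I" "analytic_fun J W f" "poly_open I V"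
    and "\<And>x. x \<in> V \<Longrightarrow> restrict (x \<circ> e) J \<in> W"
  shows "analytic_fun I V (\<lambda>x. f (restrict (x \<circ> e) J))"
  using assms by (auto simp: analytic_fun_iff intro: analytic_at_lift)

lemma analytic_fun_cong:
  assumes "analytic_fun I W f" "\<And>x. x \<in> W \<Longrightarrow> f x = g x"
  shows "analytic_fun I W g"
  unfolding analytic_fun_iff
proof (intro conjI ballI)
  show W: "poly_open I W" using assms(1) by (simp add: analytic_fun_iff)
  fix a assume a: "a \<in> W"
  then obtain r where "r > 0" "polydisc I a r \<subseteq> W" using W by (auto simp: poly_open_def)
  then show "analytic_at I g a"
    using assms a by (intro analytic_at_cong[of I f a r g]) (auto simp: analytic_fun_iff)
qed

lemma function_algebra_analytic:
  fixes W :: "('i \<Rightarrow> 'f::{real_normed_field,euclidean_space}) set"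
  assumes "finite I" "poly_open I W"
  shows "function_algebra W (analytic_fun I W)"
proof
  have W: "a \<in> I \<rightarrow>\<^sub>E UNIV" if "a \<in> W" for a using assms(2) that by (auto simp: poly_open_def)
  show "analytic_fun I W (\<lambda>_. c)" for c using assms by (simp add: analytic_fun_iff analytic_at_const)
  show "analytic_fun I W (\<lambda>x. f x + g x)" if "analytic_fun I W f" "analytic_fun I W g" for f g
    using that by (simp add: analytic_fun_iff analytic_at_add)
  show "analytic_fun I W (\<lambda>x. f x * g x)" if "analytic_fun I W f" "analytic_fun I W g" for f g
    using that by (simp add: analytic_fun_iff analytic_at_mult)
  show "analytic_fun I W (\<lambda>x. inverse (f x))" if "analytic_fun I W f" "\<And>x. x \<in> W \<Longrightarrow> f x \<noteq> 0" for f
    using that assms(1) W by (simp add: analytic_fun_iff analytic_at_inverse)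
qed (rule analytic_fun_cong)

section \<open>The matrix field in coordinates over the scalar field of the manifold\<close>

text \<open>With \<open>self_coord\<close> this is ordinary analyticity; with
  \<open>Re_Im_coord\<close> it is real analyticity of the real and the imaginary part.\<close>

definition coord_analytic ::
  "('k \<Rightarrow> 'c \<Rightarrow> 'f) \<Rightarrow> 'i set \<Rightarrow> ('i \<Rightarrow> 'f::real_normed_field) set \<Rightarrow> (('i \<Rightarrow> 'f) \<Rightarrow> 'k) \<Rightarrow> bool" where
  "coord_analytic C I W f \<longleftrightarrow> (\<forall>c. analytic_fun I W (\<lambda>z. C (f z) c))"

text \<open>The coordinates form a homeomorphism onto the whole coordinate space, which is what the
  single global chart on vectors requires.\<close>

definition analytic_coords :: "('k::real_normed_field \<Rightarrow> 'c::finite \<Rightarrow> 'f::{real_normed_field,euclidean_space}) \<Rightarrow> bool" where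
  "analytic_coords C \<longleftrightarrow> (\<exists>D. (\<forall>x. D (C x) = x) \<and> (\<forall>y. C (D y) = y) \<and>
    (\<forall>c. continuous_map euclidean euclidean (\<lambda>x. C x c)) \<and>
    continuous_map (product_topology (\<lambda>_. euclidean) UNIV) euclidean D)"

lemma function_algebra_self_coord:
  fixes W :: "('i \<Rightarrow> 'f::{real_normed_field,euclidean_space}) set"
  assumes "finite I" "poly_open I W"
  shows "function_algebra W (coord_analytic self_coord I W)"
proof -
  have "coord_analytic self_coord I W = analytic_fun I W"
    by (simp add: coord_analytic_def self_coord_def fun_eq_iff)
  then show ?thesis using function_algebra_analytic[OF assms] by simp
qed

text \<open>The inverse of a complex function is its conjugate divided by its squared modulus, so
  only real operations on the two parts occur.\<close>

lemma function_algebra_Re_Im_coord: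
  fixes W :: "('i \<Rightarrow> real) set"
  assumes "finite I" "poly_open I W"
  shows "function_algebra W (coord_analytic Re_Im_coord I W)"
proof -
  interpret R: function_algebra W "analytic_fun I W" by (rule function_algebra_analytic[OF assms])
  have eq: "coord_analytic Re_Im_coord I W f \<longleftrightarrow>
      analytic_fun I W (\<lambda>z. Re (f z)) \<and> analytic_fun I W (\<lambda>z. Im (f z))" for f
    by (auto simp: coord_analytic_def Re_Im_coord_def all_bool_eq)
  show ?thesis
  proof
    show "coord_analytic Re_Im_coord I W (\<lambda>x. inverse (f x))"
      if f: "coord_analytic Re_Im_coord I W f" "\<And>x. x \<in> W \<Longrightarrow> f x \<noteq> 0" for f
    proof -
      let ?n = "\<lambda>x. Re (f x) * Re (f x) + Im (f x) * Im (f x)"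
      have nz: "?n x \<noteq> 0" if "x \<in> W" for x
        using f(2)[OF that] by (simp add: complex_eq_iff)
      have n: "analytic_fun I W (\<lambda>x. inverse (?n x))"
        using f(1) nz by (intro R.inverse R.add R.mult) (auto simp: eq)
      have "analytic_fun I W (\<lambda>x. Re (f x) * inverse (?n x))" "analytic_fun I W (\<lambda>x. (0 - Im (f x)) * inverse (?n x))"
        by (intro R.mult R.diff R.const n; use f(1) in \<open>simp add: eq\<close>)+
      then show ?thesis by (simp add: eq Re_divide Im_divide inverse_eq_divide power2_eq_square)
    qed
  qed (auto simp: eq intro: R.add R.diff R.mult R.const elim: R.cong)
qed

section \<open>Analytic manifolds\<close>

lemma openin_coord_space_imp_poly_open:
  assumes I: "finite I" and W: "openin (coord_space I) (W :: ('i \<Rightarrow> 'f::real_normed_field) set)"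
  shows "poly_open I W"
  unfolding poly_open_def
proof (intro conjI ballI)
  show "W \<subseteq> I \<rightarrow>\<^sub>E UNIV" using openin_subset[OF W] by (simp add: coord_space_def)
  fix a assume "a \<in> W"
  then obtain U where U: "\<forall>i\<in>I. open (U i)" "a \<in> Pi\<^sub>E I U" "Pi\<^sub>E I U \<subseteq> W"
    using W unfolding coord_space_def openin_product_topology_alt by fastforce
  have "\<exists>r>0. \<forall>y. dist y (a i) < r \<longrightarrow> y \<in> U i" if "i \<in> I" for i
    using U that unfolding open_dist by blast
  then obtain r where r: "\<And>i. i \<in> I \<Longrightarrow> r i > 0" "\<And>i y. i \<in> I \<Longrightarrow> dist y (a i) < r i \<Longrightarrow> y \<in> U i"
    by metis
  \<comment> \<open>Finiteness of \<open>I\<close> gives a common radius; inserting 1 keeps the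
    minimum defined when \<open>I\<close> is empty.\<close>
  define s where "s = Min (insert 1 (r ` I))"
  have s: "s > 0" "\<And>i. i \<in> I \<Longrightarrow> s \<le> r i" unfolding s_def using I r(1) by auto
  have "polydisc I a s \<subseteq> Pi\<^sub>E I U"
  proof
    fix x assume x: "x \<in> polydisc I a s"
    have "x i \<in> U i" if i: "i \<in> I" for i
    proof (rule r(2)[OF i])
      have "norm (x i - a i) < s" using x i by (simp add: polydisc_def)
      then show "dist (x i) (a i) < r i" using s(2)[OF i] by (simp add: dist_norm)
    qed
    then show "x \<in> Pi\<^sub>E I U" using x by (auto simp: polydisc_def PiE_iff)
  qed
  then show "\<exists>r>0. polydisc I a r \<subseteq> W" using s(1) U(3) by blast
qed

section \<open>Charts and products of manifolds\<close>

definition chart :: "'p topology \<Rightarrow> 'i set \<Rightarrow> 'p set \<Rightarrow> ('p \<Rightarrow> 'i \<Rightarrow> 'f::real_normed_field) \<Rightarrow> bool" where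
  "chart X I U \<phi> \<longleftrightarrow> openin X U \<and> (\<exists>W. openin (coord_space I) W \<and>
    homeomorphic_map (subtopology X U) (subtopology (coord_space I) W) \<phi>)"

lemma analytic_manifold_alt: "analytic_manifold X I \<A> \<longleftrightarrow>
  finite I \<and> Hausdorff_space X \<and> \<Union>(fst ` \<A>) = topspace X \<and> (\<forall>(U, \<phi>)\<in>\<A>. chart X I U \<phi>) \<and>
  (\<forall>(U, \<phi>)\<in>\<A>. \<forall>(V, \<psi>)\<in>\<A>. \<forall>i\<in>I.
    analytic_fun I (\<phi> ` (U \<inter> V)) (\<lambda>z. \<psi> (the_inv_into U \<phi> z) i))"
  unfolding analytic_manifold_def chart_def ..

lemma analytic_manifold_chart: "analytic_manifold X I \<A> \<Longrightarrow> (U, \<phi>) \<in> \<A> \<Longrightarrow> chart X I U \<phi>"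
  unfolding analytic_manifold_alt by blast

lemma
  assumes "chart X I U \<phi>"
  shows chart_open: "openin X U" and chart_inj: "inj_on \<phi> U"
    and chart_ext: "x \<in> U \<Longrightarrow> \<phi> x \<in> I \<rightarrow>\<^sub>E UNIV"
    and chart_inv: "x \<in> U \<Longrightarrow> the_inv_into U \<phi> (\<phi> x) = x"
    and chart_image: "openin X V \<Longrightarrow> V \<subseteq> U \<Longrightarrow> openin (coord_space I) (\<phi> ` V)"
proof -
  obtain W where U: "openin X U" and W: "openin (coord_space I) W"
    and hom: "homeomorphic_map (subtopology X U) (subtopology (coord_space I) W) \<phi>"
    using assms unfolding chart_def by blast
  have top: "topspace (subtopology X U) = U" using openin_subset[OF U] by auto
  show "openin X U" by (rule U)
  show inj: "inj_on \<phi> U" using homeomorphic_imp_injective_map[OF hom] by (simp only: top)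
  show "x \<in> U \<Longrightarrow> the_inv_into U \<phi> (\<phi> x) = x" using inj by (rule the_inv_into_f_f)
  have "\<phi> ` U = topspace (subtopology (coord_space I) W)"
    using homeomorphic_imp_surjective_map[OF hom] by (simp only: top)
  then show "x \<in> U \<Longrightarrow> \<phi> x \<in> I \<rightarrow>\<^sub>E UNIV" by (auto simp: coord_space_def)
  show "openin (coord_space I) (\<phi> ` V)" if V: "openin X V" "V \<subseteq> U"
  proof -
    have "openin (subtopology X U) V" using V U by (simp add: openin_open_subtopology)
    then have "openin (subtopology (coord_space I) W) (\<phi> ` V)"
      using homeomorphic_imp_open_map[OF hom] by (simp add: open_map_def)
    then show ?thesis using W by (rule openin_trans_full)
  qed
qed

lemma join_homeomorphic:
  "homeomorphic_map (prod_topology (coord_space I) (coord_space J)) (coord_space (I <+> J))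
    (\<lambda>(x, y). case_sum x (y :: _ \<Rightarrow> 'f::topological_space))"
proof -
  have "homeomorphic_maps (prod_topology (coord_space I) (coord_space J)) (coord_space (I <+> J))
    (\<lambda>(x, y). case_sum x (y :: _ \<Rightarrow> 'f)) (\<lambda>z. (restrict (z \<circ> Inl) I, restrict (z \<circ> Inr) J))"
    unfolding homeomorphic_maps_def
  proof (intro conjI ballI)
    have proj: "continuous_map (prod_topology (coord_space I) (coord_space J)) euclidean (\<lambda>p. fst p i)"
      if "i \<in> I" for i
      using continuous_map_compose[OF continuous_map_fst continuous_map_product_projection[OF that]]
      by (simp add: coord_space_def o_def)
    have proj': "continuous_map (prod_topology (coord_space I) (coord_space J)) euclidean (\<lambda>p. snd p j)"
      if "j \<in> J" for j
      using continuous_map_compose[OF continuous_map_snd continuous_map_product_projection[OF that]]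
      by (simp add: coord_space_def o_def)
    show "continuous_map (prod_topology (coord_space I) (coord_space J)) (coord_space (I <+> J))
      (\<lambda>(x, y). case_sum x (y :: _ \<Rightarrow> 'f))"
      unfolding coord_space_def[of "I <+> J"] continuous_map_componentwise
      using proj proj'
      by (auto simp: coord_space_def PiE_def extensional_def case_prod_unfold split: sum.splits)
    show "continuous_map (coord_space (I <+> J)) (prod_topology (coord_space I) (coord_space J))
      (\<lambda>z. (restrict (z \<circ> Inl) I, restrict (z \<circ> Inr) J :: _ \<Rightarrow> 'f))"
      unfolding continuous_map_paired coord_space_def[of I] coord_space_def[of J] continuous_map_componentwise
      by (auto simp: coord_space_def intro!: continuous_map_product_projection)
  next
    fix p :: "('a \<Rightarrow> 'f) \<times> ('b \<Rightarrow> 'f)"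
    assume "p \<in> topspace (prod_topology (coord_space I) (coord_space J))"
    then show "(\<lambda>z. (restrict (z \<circ> Inl) I, restrict (z \<circ> Inr) J)) ((\<lambda>(x, y). case_sum x y) p) = p"
      by (auto simp: coord_space_def PiE_def extensional_def fun_eq_iff)
  next
    fix z :: "'a + 'b \<Rightarrow> 'f" assume "z \<in> topspace (coord_space (I <+> J))"
    then show "(\<lambda>(x, y). case_sum x y) (restrict (z \<circ> Inl) I, restrict (z \<circ> Inr) J) = z"
      by (force simp: coord_space_def PiE_def extensional_def fun_eq_iff split: sum.splits)
  qed
  then show ?thesis using homeomorphic_map_maps by blast
qed

abbreviation chart_prod :: "('p \<Rightarrow> 'i \<Rightarrow> 'f) \<Rightarrow> ('q \<Rightarrow> 'j \<Rightarrow> 'f) \<Rightarrow> 'p \<times> 'q \<Rightarrow> 'i + 'j \<Rightarrow> 'f" where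
  "chart_prod \<phi> \<psi> \<equiv> \<lambda>(x, y). case_sum (\<phi> x) (\<psi> y)"

lemma chart_prod:
  assumes "chart X I U \<phi>" "chart Y J V \<psi>"
  shows "chart (prod_topology X Y) (I <+> J) (U \<times> V) (chart_prod \<phi> \<psi>)"
proof -
  let ?join = "\<lambda>(x, y). case_sum x y"
  obtain W where W: "openin (coord_space I) W"
    "homeomorphic_map (subtopology X U) (subtopology (coord_space I) W) \<phi>"
    using assms(1) unfolding chart_def by blast
  obtain W' where W': "openin (coord_space J) W'"
    "homeomorphic_map (subtopology Y V) (subtopology (coord_space J) W') \<psi>"
    using assms(2) unfolding chart_def by blast
  let ?Z = "prod_topology (coord_space I) (coord_space J)" and ?W = "?join ` (W \<times> W')"
  have WW: "openin ?Z (W \<times> W')" using W(1) W'(1) by (simp add: openin_prod_Times_iff)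
  have open_W: "openin (coord_space (I <+> J)) ?W"
    using homeomorphic_imp_open_map[OF join_homeomorphic, of I J] WW unfolding open_map_def by blast
  obtain \<phi>' \<psi>' where "homeomorphic_maps (subtopology X U) (subtopology (coord_space I) W) \<phi> \<phi>'"
    "homeomorphic_maps (subtopology Y V) (subtopology (coord_space J) W') \<psi> \<psi>'"
    using W(2) W'(2) unfolding homeomorphic_map_maps by blast
  then have "homeomorphic_map (prod_topology (subtopology X U) (subtopology Y V))
      (prod_topology (subtopology (coord_space I) W) (subtopology (coord_space J) W')) (\<lambda>(x, y). (\<phi> x, \<psi> y))"
    unfolding homeomorphic_map_maps using homeomorphic_maps_prod by blast
  then have "homeomorphic_map (subtopology (prod_topology X Y) (U \<times> V)) (subtopology ?Z (W \<times> W')) (\<lambda>(x, y). (\<phi> x, \<psi> y))"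
    by (simp only: subtopology_Times)
  moreover have "homeomorphic_map (subtopology ?Z (W \<times> W')) (subtopology (coord_space (I <+> J)) ?W) ?join"
  proof (rule homeomorphic_map_subtopologies[OF join_homeomorphic])
    have "topspace ?Z \<inter> (W \<times> W') = W \<times> W'" using openin_subset[OF WW] by blast
    moreover have "topspace (coord_space (I <+> J)) \<inter> ?W = ?W" using openin_subset[OF open_W] by blast
    ultimately show "?join ` (topspace ?Z \<inter> (W \<times> W')) = topspace (coord_space (I <+> J)) \<inter> ?W" by simp
  qed
  ultimately have "homeomorphic_map (subtopology (prod_topology X Y) (U \<times> V))
      (subtopology (coord_space (I <+> J)) ?W) (?join \<circ> (\<lambda>(x, y). (\<phi> x, \<psi> y)))"
    by (rule homeomorphic_map_compose)
  moreover have "?join \<circ> (\<lambda>(x, y). (\<phi> x, \<psi> y)) = chart_prod \<phi> \<psi>" by auto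
  moreover have "openin (prod_topology X Y) (U \<times> V)"
    using chart_open[OF assms(1)] chart_open[OF assms(2)] by (simp add: openin_prod_Times_iff)
  ultimately show ?thesis unfolding chart_def using open_W by metis
qed

lemma restrict_chart_prod:
  assumes "\<phi> x \<in> I \<rightarrow>\<^sub>E UNIV" "\<psi> y \<in> J \<rightarrow>\<^sub>E UNIV"
  shows "restrict (chart_prod \<phi> \<psi> (x, y) \<circ> Inl) I = \<phi> x" "restrict (chart_prod \<phi> \<psi> (x, y) \<circ> Inr) J = \<psi> y"
  using assms by (auto simp: fun_eq_iff PiE_def extensional_def)

text \<open>Each component of a change of product charts depends on the coordinates of one factor
  alone, so it is a lifted transition function of that factor.\<close>

lemma analytic_manifold_prod:
  fixes \<A> :: "('p, 'i, 'f::{real_normed_field,banach}) atlas"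
  assumes X: "analytic_manifold X I \<A>" and Y: "analytic_manifold Y J \<B>"
  shows "analytic_manifold (prod_topology X Y) (I <+> J) (prod_atlas \<A> \<B>)"
  unfolding analytic_manifold_alt
proof (intro conjI)
  show fin: "finite (I <+> J)" using X Y by (simp add: analytic_manifold_alt)
  show "Hausdorff_space (prod_topology X Y)"
    using X Y by (simp add: analytic_manifold_alt Hausdorff_space_prod_topology)
  have "\<Union>(fst ` prod_atlas \<A> \<B>) = \<Union>(fst ` \<A>) \<times> \<Union>(fst ` \<B>)"
    unfolding prod_atlas_def by force
  then show "\<Union>(fst ` prod_atlas \<A> \<B>) = topspace (prod_topology X Y)"
    using X Y by (simp add: analytic_manifold_alt)
  show "\<forall>(U, \<phi>)\<in>prod_atlas \<A> \<B>. chart (prod_topology X Y) (I <+> J) U \<phi>"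
    unfolding prod_atlas_def using chart_prod analytic_manifold_chart[OF X] analytic_manifold_chart[OF Y]
    by blast
  have "analytic_fun (I <+> J) (chart_prod \<phi> \<psi> ` ((U \<times> V) \<inter> (U' \<times> V')))
      (\<lambda>z. chart_prod \<phi>' \<psi>' (the_inv_into (U \<times> V) (chart_prod \<phi> \<psi>) z) k)"
    if \<phi>: "(U, \<phi>) \<in> \<A>" and \<psi>: "(V, \<psi>) \<in> \<B>" and \<phi>': "(U', \<phi>') \<in> \<A>" and \<psi>': "(V', \<psi>') \<in> \<B>" and k: "k \<in> I <+> J"
    for U \<phi> V \<psi> U' \<phi>' V' \<psi>' k
  proof -
    note charts = analytic_manifold_chart[OF X \<phi>] analytic_manifold_chart[OF Y \<psi>]
    note c = chart_prod[OF charts]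
    let ?O = "(U \<times> V) \<inter> (U' \<times> V')" and ?\<Phi> = "chart_prod \<phi> \<psi>"
    have "openin (prod_topology X Y) ?O"
      using chart_open[OF analytic_manifold_chart[OF X \<phi>']] chart_open[OF analytic_manifold_chart[OF Y \<psi>']]
        chart_open[OF c] by (intro openin_Int) (auto simp: openin_prod_Times_iff)
    then have W: "poly_open (I <+> J) (?\<Phi> ` ?O)"
      by (intro openin_coord_space_imp_poly_open[OF fin] chart_image[OF c]) auto
    have coords: "restrict (case_sum (\<phi> x) (\<psi> y) \<circ> Inl) I = \<phi> x"
      "restrict (case_sum (\<phi> x) (\<psi> y) \<circ> Inr) J = \<psi> y"
      "the_inv_into (U \<times> V) ?\<Phi> (case_sum (\<phi> x) (\<psi> y)) = (x, y)"
      "the_inv_into U \<phi> (\<phi> x) = x" "the_inv_into V \<psi> (\<psi> y) = y" if "x \<in> U" "y \<in> V" for x y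
      using that restrict_chart_prod[OF chart_ext[OF charts(1)] chart_ext[OF charts(2)]] chart_inv[OF c, of "(x, y)"]
        chart_inv[OF charts(1)] chart_inv[OF charts(2)] by auto
    show ?thesis
    proof (cases k)
      case (Inl i)
      have a: "analytic_fun I (\<phi> ` (U \<inter> U')) (\<lambda>z. \<phi>' (the_inv_into U \<phi> z) i)"
        using X \<phi> \<phi>' k Inl unfolding analytic_manifold_alt by blast
      have "analytic_fun (I <+> J) (?\<Phi> ` ?O) (\<lambda>z. \<phi>' (the_inv_into U \<phi> (restrict (z \<circ> Inl) I)) i)"
        by (rule analytic_fun_lift[OF fin _ _ a W]) (auto simp: coords)
      then show ?thesis by (rule analytic_fun_cong) (auto simp: coords Inl)
    next
      case (Inr j)
      have a: "analytic_fun J (\<psi> ` (V \<inter> V')) (\<lambda>z. \<psi>' (the_inv_into V \<psi> z) j)"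
        using Y \<psi> \<psi>' k Inr unfolding analytic_manifold_alt by blast
      have "analytic_fun (I <+> J) (?\<Phi> ` ?O) (\<lambda>z. \<psi>' (the_inv_into V \<psi> (restrict (z \<circ> Inr) J)) j)"
        by (rule analytic_fun_lift[OF fin _ _ a W]) (auto simp: coords)
      then show ?thesis by (rule analytic_fun_cong) (auto simp: coords Inr)
    qed
  qed
  then show "\<forall>(U, \<phi>)\<in>prod_atlas \<A> \<B>. \<forall>(V, \<psi>)\<in>prod_atlas \<A> \<B>. \<forall>i\<in>I <+> J.
      analytic_fun (I <+> J) (\<phi> ` (U \<inter> V)) (\<lambda>z. \<psi> (the_inv_into U \<phi> z) i)"
    unfolding prod_atlas_def by fast
qed

lemma continuous_map_vec_iff:
  "continuous_map X euclidean f \<longleftrightarrow> (\<forall>i. continuous_map X euclidean (\<lambda>x. f x $ i))"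
  unfolding continuous_map_atin limitin_canonical_iff
  by (auto intro: vec_tendstoI tendsto_vec_nth)

lemma analytic_coords_self: "analytic_coords (self_coord :: 'f::{real_normed_field,euclidean_space} \<Rightarrow> _)"
  unfolding analytic_coords_def self_coord_def
  by (intro exI[of _ "\<lambda>z. z ()"])
    (auto simp: fun_eq_iff intro: continuous_map_product_projection[of "()" UNIV "\<lambda>_. euclidean"])

lemma analytic_coords_Re_Im: "analytic_coords Re_Im_coord"
  unfolding analytic_coords_def
proof (intro exI conjI allI)
  let ?D = "\<lambda>z :: bool \<Rightarrow> real. Complex (z False) (z True)"
  show "?D (Re_Im_coord x) = x" for x by (simp add: Re_Im_coord_def)
  show "Re_Im_coord (?D y) = y" for y by (auto simp: Re_Im_coord_def fun_eq_iff)
  show "continuous_map euclidean euclidean (\<lambda>x. Re_Im_coord x c)" for c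
    by (cases c) (auto simp: Re_Im_coord_def intro: continuous_intros)
  have "continuous_map (product_topology (\<lambda>_. euclidean) UNIV) euclidean (\<lambda>z :: bool \<Rightarrow> real. z b)" for b
    by (rule continuous_map_product_projection) simp
  then show "continuous_map (product_topology (\<lambda>_. euclidean) UNIV) euclidean ?D"
    unfolding continuous_map_atin limitin_canonical_iff by (auto intro: tendsto_Complex)
qed

text \<open>There is a single global chart, and its transition with itself is the identity.\<close>

lemma analytic_manifold_vector:
  fixes C :: "'k::real_normed_field \<Rightarrow> 'c::finite \<Rightarrow> 'f::{real_normed_field,euclidean_space}"
  assumes "analytic_coords C"
  shows "analytic_manifold euclidean UNIV (vector_atlas C :: ('k^'n, _, 'f) atlas)"
proof -
  obtain D where D: "\<And>x. D (C x) = x" "\<And>y. C (D y) = y"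
    and cont: "\<And>c. continuous_map euclidean euclidean (\<lambda>x. C x c)"
    and contD: "continuous_map (product_topology (\<lambda>_. euclidean) UNIV) euclidean D"
    using assms unfolding analytic_coords_def by blast
  let ?\<phi> = "\<lambda>v :: 'k^'n. \<lambda>(i, c). C (v $ i) c"
  let ?\<psi> = "\<lambda>z :: 'n \<times> 'c \<Rightarrow> 'f. \<chi> i. D (\<lambda>c. z (i, c))"
  have "homeomorphic_maps euclidean (coord_space UNIV) ?\<phi> ?\<psi>"
    unfolding homeomorphic_maps_def
  proof (intro conjI ballI)
    have "continuous_map euclidean euclidean (\<lambda>v :: 'k^'n. C (v $ i) c)" for i c
      using continuous_map_compose[OF _ cont[of c], of euclidean "\<lambda>v. v $ i"]
      by (simp add: o_def continuous_on_component)
    then show "continuous_map euclidean (coord_space UNIV) ?\<phi>"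
      unfolding coord_space_def continuous_map_componentwise_UNIV by auto
    have "continuous_map (coord_space UNIV) (product_topology (\<lambda>_. euclidean) UNIV) (\<lambda>z :: 'n \<times> 'c \<Rightarrow> 'f. \<lambda>c. z (i, c))" for i
      unfolding coord_space_def continuous_map_componentwise_UNIV
      by (auto intro: continuous_map_product_projection)
    then have "continuous_map (coord_space UNIV) euclidean (\<lambda>z :: 'n \<times> 'c \<Rightarrow> 'f. D (\<lambda>c. z (i, c)))" for i
      using continuous_map_compose[OF _ contD] by (auto simp: o_def)
    then show "continuous_map (coord_space UNIV) euclidean ?\<psi>"
      unfolding continuous_map_vec_iff by simp
  qed (auto simp: D fun_eq_iff vec_eq_iff)
  then have hom: "homeomorphic_map euclidean (coord_space UNIV) ?\<phi>"
    using homeomorphic_map_maps by blast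
  have chart: "chart euclidean UNIV UNIV ?\<phi>"
    unfolding chart_def using hom by (intro conjI exI[of _ "topspace (coord_space UNIV)"]) auto
  have image: "?\<phi> ` UNIV = UNIV"
    using homeomorphic_imp_surjective_map[OF hom] by (simp add: coord_space_def)
  have "analytic_fun UNIV UNIV (\<lambda>z. ?\<phi> (the_inv_into UNIV ?\<phi> z) k)" for k
  proof (rule analytic_fun_cong)
    have "poly_open UNIV (UNIV :: ('n \<times> 'c \<Rightarrow> 'f) set)"
      unfolding poly_open_def by (auto intro: exI[of _ 1])
    then show "analytic_fun UNIV UNIV (\<lambda>z :: 'n \<times> 'c \<Rightarrow> 'f. z k)"
      by (simp add: analytic_fun_iff analytic_at_coordinate)
    show "z k = ?\<phi> (the_inv_into UNIV ?\<phi> z) k" for z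
      using f_the_inv_into_f[OF chart_inj[OF chart], of z] image by simp
  qed
  from this[of "(_, _)"] have "analytic_fun UNIV UNIV (\<lambda>z. C (the_inv ?\<phi> z $ i) c)" for i c by simp
  then show ?thesis
    unfolding analytic_manifold_alt vector_atlas_def using chart image by simp
qed

section \<open>Transport of manifolds and loops along bijections\<close>

lemma pullback_homeomorphic:
  assumes "bij_betw p S (topspace Y)"
  shows "homeomorphic_maps (pullback_topology S p Y) Y p (the_inv_into S p)"
    and "topspace (pullback_topology S p Y) = S"
proof -
  have p: "inj_on p S" "p ` S = topspace Y" using assms by (auto simp: bij_betw_def)
  let ?k = "the_inv_into S p"
  show top: "topspace (pullback_topology S p Y) = S"
    using p(2) by (auto simp: topspace_pullback_topology)
  have k: "?k y \<in> S" "p (?k y) = y" if "y \<in> topspace Y" for y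
    using that p by (auto simp: the_inv_into_into f_the_inv_into_f)
  have "continuous_map (pullback_topology S p Y) Y (id \<circ> p)"
    by (intro continuous_map_pullback) simp
  moreover have "continuous_map Y (pullback_topology S p Y) ?k"
  proof (rule continuous_map_pullback')
    show "continuous_map Y Y (p \<circ> ?k)" by (rule continuous_map_eq[of _ _ id]) (auto simp: k)
  qed (use k in auto)
  ultimately show "homeomorphic_maps (pullback_topology S p Y) Y p ?k"
    unfolding homeomorphic_maps_def top using the_inv_into_f_f[OF p(1)] k by simp
qed

text \<open>A pulled back chart has the same image as the original one, and its inverse differs only
  by \<open>k\<close>. Coordinate expressions of transported maps are therefore the same functions
  on the same domains.\<close>

lemma pullback_inverse:
  assumes "homeomorphic_maps Z Y p k" "inj_on \<phi> U" "U \<subseteq> topspace Y"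
  shows "(\<lambda>x. \<phi> (p x)) ` {x \<in> topspace Z. p x \<in> U \<and> P x} = \<phi> ` {y \<in> U. P (k y)}"
    and "w \<in> \<phi> ` U \<Longrightarrow> the_inv_into {x \<in> topspace Z. p x \<in> U} (\<lambda>x. \<phi> (p x)) w = k (the_inv_into U \<phi> w)"
proof -
  have p: "\<And>x. x \<in> topspace Z \<Longrightarrow> p x \<in> topspace Y \<and> k (p x) = x"
    and k: "\<And>y. y \<in> topspace Y \<Longrightarrow> k y \<in> topspace Z \<and> p (k y) = y"
    using assms(1) unfolding homeomorphic_maps_def continuous_map_def by auto
  show "(\<lambda>x. \<phi> (p x)) ` {x \<in> topspace Z. p x \<in> U \<and> P x} = \<phi> ` {y \<in> U. P (k y)}"
  proof (intro equalityI subsetI)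
    fix w assume "w \<in> (\<lambda>x. \<phi> (p x)) ` {x \<in> topspace Z. p x \<in> U \<and> P x}"
    then show "w \<in> \<phi> ` {y \<in> U. P (k y)}" using p by auto
  next
    fix w assume "w \<in> \<phi> ` {y \<in> U. P (k y)}"
    then obtain y where "w = \<phi> y" "y \<in> U" "P (k y)" by blast
    then show "w \<in> (\<lambda>x. \<phi> (p x)) ` {x \<in> topspace Z. p x \<in> U \<and> P x}"
      using k[of y] assms(3) by (intro image_eqI[of _ _ "k y"]) auto
  qed
  show "the_inv_into {x \<in> topspace Z. p x \<in> U} (\<lambda>x. \<phi> (p x)) w = k (the_inv_into U \<phi> w)" if w: "w \<in> \<phi> ` U"
  proof -
    obtain y where y: "w = \<phi> y" "y \<in> U" using w by blast
    have inj: "inj_on (\<lambda>x. \<phi> (p x)) {x \<in> topspace Z. p x \<in> U}"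
      using assms(2) p by (auto simp: inj_on_def) (metis p)
    have "the_inv_into {x \<in> topspace Z. p x \<in> U} (\<lambda>x. \<phi> (p x)) (\<phi> (p (k y))) = k y"
      using y(2) k[of y] assms(3) by (intro the_inv_into_f_f[OF inj]) auto
    then show ?thesis using y k[of y] assms(2,3) by (auto simp: the_inv_into_f_f)
  qed
qed

lemma chart_pullback:
  assumes hom: "homeomorphic_maps Z Y p k" and c: "chart Y I U \<phi>"
  shows "chart Z I {x \<in> topspace Z. p x \<in> U} (\<lambda>x. \<phi> (p x))"
proof -
  obtain W where U: "openin Y U" and W: "openin (coord_space I) W"
    and \<phi>: "homeomorphic_map (subtopology Y U) (subtopology (coord_space I) W) \<phi>"
    using c unfolding chart_def by blast
  let ?V = "{x \<in> topspace Z. p x \<in> U}"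
  have "p ` (topspace Z \<inter> ?V) = topspace Y \<inter> U"
  proof (intro equalityI subsetI)
    fix y assume y: "y \<in> topspace Y \<inter> U"
    then have "k y \<in> topspace Z" "p (k y) = y"
      using hom unfolding homeomorphic_maps_def continuous_map_def by auto
    then show "y \<in> p ` (topspace Z \<inter> ?V)" using y by (intro image_eqI[of _ _ "k y"]) auto
  qed (use openin_subset[OF U] in auto)
  then have "homeomorphic_map (subtopology Z ?V) (subtopology Y U) p"
    using hom homeomorphic_map_maps by (intro homeomorphic_map_subtopologies) blast+
  from homeomorphic_map_compose[OF this \<phi>]
  have "homeomorphic_map (subtopology Z ?V) (subtopology (coord_space I) W) (\<lambda>x. \<phi> (p x))"
    by (simp add: o_def)
  moreover have "openin Z ?V"
    using hom U unfolding homeomorphic_maps_def continuous_map_def by blast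
  ultimately show ?thesis unfolding chart_def using W by blast
qed

lemma analytic_manifold_pullback:
  assumes hom: "homeomorphic_maps Z Y p k" and Y: "analytic_manifold Y I \<A>"
  shows "analytic_manifold Z I (pullback_atlas (topspace Z) p \<A>)"
  unfolding analytic_manifold_alt
proof (intro conjI)
  note charts = analytic_manifold_chart[OF Y]
  show "finite I" using Y by (simp add: analytic_manifold_alt)
  have "Z homeomorphic_space Y" using hom unfolding homeomorphic_space_def by blast
  then show "Hausdorff_space Z" using Y homeomorphic_Hausdorff_space by (auto simp: analytic_manifold_alt)
  have p: "\<And>x. x \<in> topspace Z \<Longrightarrow> p x \<in> topspace Y"
    using hom unfolding homeomorphic_maps_def continuous_map_def by auto
  have "\<Union>(fst ` pullback_atlas (topspace Z) p \<A>) = {x \<in> topspace Z. p x \<in> \<Union>(fst ` \<A>)}"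
    unfolding pullback_atlas_def by force
  also have "\<dots> = topspace Z" using Y p by (auto simp: analytic_manifold_alt)
  finally show "\<Union>(fst ` pullback_atlas (topspace Z) p \<A>) = topspace Z" .
  show "\<forall>(U, \<phi>)\<in>pullback_atlas (topspace Z) p \<A>. chart Z I U \<phi>"
    unfolding pullback_atlas_def using chart_pullback[OF hom charts] by blast
  have "analytic_fun I ((\<lambda>x. \<phi> (p x)) ` ({x \<in> topspace Z. p x \<in> U} \<inter> {x \<in> topspace Z. p x \<in> V}))
      (\<lambda>z. \<psi> (p (the_inv_into {x \<in> topspace Z. p x \<in> U} (\<lambda>x. \<phi> (p x)) z)) i)"
    if \<phi>: "(U, \<phi>) \<in> \<A>" and \<psi>: "(V, \<psi>) \<in> \<A>" and i: "i \<in> I" for U \<phi> V \<psi> i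
  proof -
    note c = charts[OF \<phi>]
    have U: "U \<subseteq> topspace Y" using openin_subset[OF chart_open[OF c]] .
    have pk: "p (k y) = y" if "y \<in> topspace Y" for y
      using hom that unfolding homeomorphic_maps_def by auto
    have "{x \<in> topspace Z. p x \<in> U} \<inter> {x \<in> topspace Z. p x \<in> V} = {x \<in> topspace Z. p x \<in> U \<and> p x \<in> V}" by blast
    then have "(\<lambda>x. \<phi> (p x)) ` ({x \<in> topspace Z. p x \<in> U} \<inter> {x \<in> topspace Z. p x \<in> V}) = \<phi> ` {y \<in> U. p (k y) \<in> V}"
      using pullback_inverse(1)[OF hom chart_inj[OF c] U, of "\<lambda>x. p x \<in> V"] by simp
    also have "{y \<in> U. p (k y) \<in> V} = U \<inter> V" using U pk by auto
    finally have image: "(\<lambda>x. \<phi> (p x)) ` ({x \<in> topspace Z. p x \<in> U} \<inter> {x \<in> topspace Z. p x \<in> V}) = \<phi> ` (U \<inter> V)" .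
    have "analytic_fun I (\<phi> ` (U \<inter> V)) (\<lambda>z. \<psi> (the_inv_into U \<phi> z) i)"
      using Y \<phi> \<psi> i unfolding analytic_manifold_alt by blast
    then show ?thesis unfolding image
    proof (rule analytic_fun_cong)
      fix w assume "w \<in> \<phi> ` (U \<inter> V)"
      then obtain y where y: "w = \<phi> y" "y \<in> U" by blast
      then show "\<psi> (the_inv_into U \<phi> w) i = \<psi> (p (the_inv_into {x \<in> topspace Z. p x \<in> U} (\<lambda>x. \<phi> (p x)) w)) i"
        using pullback_inverse(2)[OF hom chart_inj[OF c] U, of w] U pk chart_inv[OF c] by auto
    qed
  qed
  then show "\<forall>(U, \<phi>)\<in>pullback_atlas (topspace Z) p \<A>. \<forall>(V, \<psi>)\<in>pullback_atlas (topspace Z) p \<A>. \<forall>i\<in>I.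
      analytic_fun I (\<phi> ` (U \<inter> V)) (\<lambda>z. \<psi> (the_inv_into U \<phi> z) i)"
    unfolding pullback_atlas_def by fast
qed

lemma analytic_map_cong:
  assumes f: "analytic_map X I \<A> Y J \<B> f" and eq: "\<And>x. x \<in> topspace X \<Longrightarrow> f x = g x"
    and charts: "\<And>U \<phi>. (U, \<phi>) \<in> \<A> \<Longrightarrow> chart X I U \<phi>"
  shows "analytic_map X I \<A> Y J \<B> g"
  unfolding analytic_map_def
proof
  show "continuous_map X Y g" using f eq continuous_map_eq unfolding analytic_map_def by blast
  have "analytic_fun I (\<phi> ` {x \<in> U. g x \<in> V}) (\<lambda>z. \<psi> (g (the_inv_into U \<phi> z)) j)"
    if \<phi>: "(U, \<phi>) \<in> \<A>" and \<psi>: "(V, \<psi>) \<in> \<B>" and j: "j \<in> J" for U \<phi> V \<psi> j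
  proof -
    note ch = charts[OF \<phi>]
    have eq': "f x = g x" if "x \<in> U" for x using eq openin_subset[OF chart_open[OF ch]] that by blast
    then have "{x \<in> U. f x \<in> V} = {x \<in> U. g x \<in> V}" by auto
    moreover have "analytic_fun I (\<phi> ` {x \<in> U. f x \<in> V}) (\<lambda>z. \<psi> (f (the_inv_into U \<phi> z)) j)"
      using f \<phi> \<psi> j unfolding analytic_map_def by blast
    ultimately have "analytic_fun I (\<phi> ` {x \<in> U. g x \<in> V}) (\<lambda>z. \<psi> (f (the_inv_into U \<phi> z)) j)"
      by simp
    then show ?thesis by (rule analytic_fun_cong) (auto simp: chart_inv[OF ch] eq')
  qed
  then show "\<forall>(U, \<phi>)\<in>\<A>. \<forall>(V, \<psi>)\<in>\<B>. \<forall>j\<in>J.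
      analytic_fun I (\<phi> ` {x \<in> U. g x \<in> V}) (\<lambda>z. \<psi> (g (the_inv_into U \<phi> z)) j)"
    by fast
qed

lemma analytic_map_pullback:
  assumes hom: "homeomorphic_maps Z Y p k" and hom': "homeomorphic_maps Z' Y' p' k'"
    and charts: "\<And>U \<phi>. (U, \<phi>) \<in> \<A> \<Longrightarrow> chart Y I U \<phi>"
    and f: "analytic_map Y I \<A> Y' J \<B> f"
    and g: "\<And>x. x \<in> topspace Z \<Longrightarrow> g x = k' (f (p x))"
  shows "analytic_map Z I (pullback_atlas (topspace Z) p \<A>) Z' J (pullback_atlas (topspace Z') p' \<B>) g"
  unfolding analytic_map_def
proof
  have p: "\<And>x. x \<in> topspace Z \<Longrightarrow> p x \<in> topspace Y \<and> k (p x) = x"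
    and k: "\<And>y. y \<in> topspace Y \<Longrightarrow> k y \<in> topspace Z \<and> p (k y) = y"
    and k': "\<And>y. y \<in> topspace Y' \<Longrightarrow> k' y \<in> topspace Z' \<and> p' (k' y) = y"
    and cont: "continuous_map Z Y p" "continuous_map Y' Z' k'"
    using hom hom' unfolding homeomorphic_maps_def continuous_map_def by auto
  have f_cont: "continuous_map Y Y' f" using f by (simp add: analytic_map_def)
  show "continuous_map Z Z' g"
    by (rule continuous_map_eq[OF continuous_map_compose[OF continuous_map_compose[OF cont(1) f_cont] cont(2)]])
      (simp add: g)
  have f_top: "f y \<in> topspace Y'" if "y \<in> topspace Y" for y
    using f_cont that unfolding continuous_map_def by auto
  have "analytic_fun I ((\<lambda>x. \<phi> (p x)) ` {x \<in> {x \<in> topspace Z. p x \<in> U}. g x \<in> {x \<in> topspace Z'. p' x \<in> V}})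
      (\<lambda>z. \<psi> (p' (g (the_inv_into {x \<in> topspace Z. p x \<in> U} (\<lambda>x. \<phi> (p x)) z))) j)"
    if \<phi>: "(U, \<phi>) \<in> \<A>" and \<psi>: "(V, \<psi>) \<in> \<B>" and j: "j \<in> J" for U \<phi> V \<psi> j
  proof -
    note c = charts[OF \<phi>]
    have U: "U \<subseteq> topspace Y" using openin_subset[OF chart_open[OF c]] .
    have gk: "g (k y) = k' (f y)" "p' (g (k y)) = f y" "g (k y) \<in> topspace Z'" if "y \<in> U" for y
      using that U k k' f_top g by (auto simp: subset_iff)
    have "{x \<in> {x \<in> topspace Z. p x \<in> U}. g x \<in> {x \<in> topspace Z'. p' x \<in> V}} =
        {x \<in> topspace Z. p x \<in> U \<and> (g x \<in> topspace Z' \<and> p' (g x) \<in> V)}" by blast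
    then have "(\<lambda>x. \<phi> (p x)) ` {x \<in> {x \<in> topspace Z. p x \<in> U}. g x \<in> {x \<in> topspace Z'. p' x \<in> V}} =
        \<phi> ` {y \<in> U. g (k y) \<in> topspace Z' \<and> p' (g (k y)) \<in> V}"
      using pullback_inverse(1)[OF hom chart_inj[OF c] U, of "\<lambda>x. g x \<in> topspace Z' \<and> p' (g x) \<in> V"] by simp
    also have "{y \<in> U. g (k y) \<in> topspace Z' \<and> p' (g (k y)) \<in> V} = {y \<in> U. f y \<in> V}" using gk by auto
    finally have image: "(\<lambda>x. \<phi> (p x)) ` {x \<in> {x \<in> topspace Z. p x \<in> U}. g x \<in> {x \<in> topspace Z'. p' x \<in> V}} =
        \<phi> ` {y \<in> U. f y \<in> V}" .
    have "analytic_fun I (\<phi> ` {y \<in> U. f y \<in> V}) (\<lambda>z. \<psi> (f (the_inv_into U \<phi> z)) j)"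
      using f \<phi> \<psi> j unfolding analytic_map_def by blast
    then show ?thesis unfolding image
    proof (rule analytic_fun_cong)
      fix w assume "w \<in> \<phi> ` {y \<in> U. f y \<in> V}"
      then obtain y where y: "w = \<phi> y" "y \<in> U" by blast
      then show "\<psi> (f (the_inv_into U \<phi> w)) j =
          \<psi> (p' (g (the_inv_into {x \<in> topspace Z. p x \<in> U} (\<lambda>x. \<phi> (p x)) w))) j"
        using pullback_inverse(2)[OF hom chart_inj[OF c] U, of w] gk chart_inv[OF c] by auto
    qed
  qed
  then show "\<forall>(U, \<phi>)\<in>pullback_atlas (topspace Z) p \<A>. \<forall>(V, \<psi>)\<in>pullback_atlas (topspace Z') p' \<B>. \<forall>j\<in>J.
      analytic_fun I (\<phi> ` {x \<in> U. g x \<in> V}) (\<lambda>z. \<psi> (g (the_inv_into U \<phi> z)) j)"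
    unfolding pullback_atlas_def by fast
qed

lemma pullback_atlas_image:
  "pullback_atlas S p \<A> = (\<lambda>(U, \<phi>). ({x \<in> S. p x \<in> U}, \<lambda>x. \<phi> (p x))) ` \<A>"
  unfolding pullback_atlas_def by force

lemma prod_atlas_image:
  "prod_atlas \<A> \<B> = (\<lambda>((U, \<phi>), (V, \<psi>)). (U \<times> V, chart_prod \<phi> \<psi>)) ` (\<A> \<times> \<B>)"
  unfolding prod_atlas_def by force

lemma prod_pullback_atlas:
  "prod_atlas (pullback_atlas S p \<A>) (pullback_atlas S' p' \<B>) =
    pullback_atlas (S \<times> S') (\<lambda>(x, y). (p x, p' y)) (prod_atlas \<A> \<B>)"
  unfolding prod_atlas_image pullback_atlas_image[of S] pullback_atlas_image[of S']
    pullback_atlas_image[of "S \<times> S'"] image_paired_Times[symmetric] image_image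
  by (rule image_cong[OF refl]) (auto simp: fun_eq_iff)

lemma analytic_loop_pullback:
  fixes \<A> :: "('q, 'i, 'f::{real_normed_field,banach}) atlas"
  assumes G: "analytic_loop G Y I \<A>" and inj: "inj_on h (carrier G)" and car: "carrier L = h ` carrier G"
    and mult: "\<And>x y. x \<in> carrier G \<Longrightarrow> y \<in> carrier G \<Longrightarrow> h x \<otimes>\<^bsub>L\<^esub> h y = h (x \<otimes>\<^bsub>G\<^esub> y)"
    and one: "\<one>\<^bsub>L\<^esub> = h \<one>\<^bsub>G\<^esub>"
    and p: "\<And>x. x \<in> carrier G \<Longrightarrow> p (h x) = x"
  shows "analytic_loop L (pullback_topology (carrier L) p Y) I (pullback_atlas (carrier L) p \<A>)"
proof -
  let ?Z = "pullback_topology (carrier L) p Y"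
  have loop_G: "loop G" and Y: "topspace Y = carrier G" and man: "analytic_manifold Y I \<A>"
    using G by (auto simp: analytic_loop_def)
  note image = loop_image[OF loop_G inj car mult one]
  have "bij_betw p (carrier L) (topspace Y)"
    unfolding Y car by (rule bij_betw_byWitness[where f' = h]) (auto simp: p)
  note hom = pullback_homeomorphic(1)[OF this] and top = pullback_homeomorphic(2)[OF this]
  let ?k = "the_inv_into (carrier L) p"
  have k: "?k x = h x" if "x \<in> carrier G" for x
    using that car p by (intro the_inv_into_f_eq) (auto simp: inj_on_def)
  have hom2: "homeomorphic_maps (prod_topology ?Z ?Z) (prod_topology Y Y)
      (\<lambda>(x, y). (p x, p y)) (\<lambda>(x, y). (?k x, ?k y))"
    unfolding homeomorphic_maps_prod using hom by blast
  have charts: "chart (prod_topology Y Y) (I <+> I) U \<phi>" if "(U, \<phi>) \<in> prod_atlas \<A> \<A>" for U \<phi>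
    using that analytic_manifold_prod[OF man man] analytic_manifold_chart by blast
  have map: "analytic_map (prod_topology ?Z ?Z) (I <+> I) (prod_atlas (pullback_atlas (carrier L) p \<A>) (pullback_atlas (carrier L) p \<A>))
      ?Z I (pullback_atlas (carrier L) p \<A>) (\<lambda>(x, y). g x y)"
    if f: "analytic_map (prod_topology Y Y) (I <+> I) (prod_atlas \<A> \<A>) Y I \<A> (\<lambda>(x, y). f x y)"
      and gf: "\<And>x y. x \<in> carrier G \<Longrightarrow> y \<in> carrier G \<Longrightarrow> g (h x) (h y) = h (f x y)" for f g
  proof -
    have "(\<lambda>(x, y). f x y) \<in> topspace (prod_topology Y Y) \<rightarrow> topspace Y"
      using f unfolding analytic_map_def continuous_map_def by blast
    then have closed: "f x y \<in> carrier G" if "x \<in> carrier G" "y \<in> carrier G" for x y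
      using that Y by (auto simp: Pi_iff)
    have "(case z of (x, y) \<Rightarrow> g x y) = ?k (case (case z of (x, y) \<Rightarrow> (p x, p y)) of (x, y) \<Rightarrow> f x y)"
      if "z \<in> topspace (prod_topology ?Z ?Z)" for z
    proof -
      have "z \<in> carrier L \<times> carrier L" using that by (simp add: top)
      then obtain a b where "z = (h a, h b)" "a \<in> carrier G" "b \<in> carrier G" using car by auto
      then show ?thesis by (simp add: p gf k closed)
    qed
    from analytic_map_pullback[OF hom2 hom charts f this]
    show ?thesis by (simp add: prod_pullback_atlas top)
  qed
  show ?thesis
    unfolding analytic_loop_def
  proof (intro conjI)
    show "loop L" by (rule image(1))
    show "topspace ?Z = carrier L" by (rule top)
    show "analytic_manifold ?Z I (pullback_atlas (carrier L) p \<A>)"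
      using analytic_manifold_pullback[OF hom man] by (simp add: top)
  qed (use G in \<open>auto simp: analytic_loop_def intro: map[where f = "\<lambda>x y. x \<otimes>\<^bsub>G\<^esub> y", OF _ mult]
      map[where f = "\<lambda>x y. ldiv G x y", OF _ image(2)] map[where f = "\<lambda>x y. rdiv G y x", OF _ image(3)]\<close>)
qed

section \<open>The analytic loop\<close>

lemma topological_field_euclidean: "topological_field (euclidean :: 'k::real_normed_field topology)"
proof -
  have "continuous_map euclidean euclidean (\<lambda>(x, y). x + y :: 'k)" "continuous_map euclidean euclidean (\<lambda>(x, y). x * y :: 'k)"
    "continuous_map euclidean euclidean (uminus :: 'k \<Rightarrow> 'k)"
    unfolding continuous_map_iff_continuous2 case_prod_unfold by (intro continuous_intros)+
  moreover have "continuous_map (subtopology euclidean (UNIV - {0})) euclidean (inverse :: 'k \<Rightarrow> 'k)"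
    unfolding continuous_map_iff_continuous by (intro continuous_intros) auto
  ultimately show ?thesis by (simp add: topological_field_def)
qed

lemma analytic_coordinate_fun:
  fixes W :: "('i \<Rightarrow> 'f::{real_normed_field,banach}) set"
  shows "finite I \<Longrightarrow> poly_open I W \<Longrightarrow> k \<in> I \<Longrightarrow> analytic_fun I W (\<lambda>z. z k)"
  by (simp add: analytic_fun_iff analytic_at_coordinate)

text \<open>Matrix entries that are analytic in a chart of one factor, viewed as functions of the
  coordinates of a product through the selection \<open>e\<close>.\<close>

lemma matrix_map_entries:
  fixes \<A> :: "('p, 'i, 'f::{real_normed_field,banach}) atlas" and e :: "'i \<Rightarrow> 'j"
  assumes g: "analytic_map X I \<A> euclidean UNIV (matrix_atlas C) g" and U: "(U, \<phi>) \<in> \<A>"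
    and e: "finite J" "inj_on e I" "e ` I \<subseteq> J" and W: "poly_open J W"
    and into: "\<And>z. z \<in> W \<Longrightarrow> restrict (z \<circ> e) I \<in> \<phi> ` U"
  shows "coord_analytic C J W (\<lambda>z. g (the_inv_into U \<phi> (restrict (z \<circ> e) I)) $ i $ j)"
  unfolding coord_analytic_def
proof
  fix c
  have "\<forall>(V, \<psi>)\<in>matrix_atlas C. \<forall>k\<in>UNIV.
      analytic_fun I (\<phi> ` {x \<in> U. g x \<in> V}) (\<lambda>z. \<psi> (g (the_inv_into U \<phi> z)) k)"
    using g U unfolding analytic_map_def by blast
  then have "analytic_fun I (\<phi> ` U) (\<lambda>z. C (g (the_inv_into U \<phi> z) $ i $ j) c)"
    by (simp add: matrix_atlas_def)
  from analytic_fun_lift[OF e this W into]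
  show "analytic_fun J W (\<lambda>z. C (g (the_inv_into U \<phi> (restrict (z \<circ> e) I)) $ i $ j) c)" .
qed

lemma continuous_map_entries:
  assumes "continuous_map Z euclidean (g :: 'z \<Rightarrow> 'k::real_normed_field^'m^'l)"
  shows "continuous_map Z euclidean (\<lambda>x. g x $ i $ j)"
  using assms by (simp add: continuous_map_vec_iff)

text \<open>Closure of analytic functions under the field operations enters as the assumption
  \<open>algebra\<close>, for the coordinates of pairs of loop elements. This lets real matrices,
  complex matrices and complex matrices over real manifolds share one proof.\<close>

locale Lie_setup = loop_setup \<Gamma>0 \<delta> A B
  for \<Gamma>0 :: "('k::real_normed_field^'n^'n) set" and \<delta> A B +
  fixes C0 :: "'k \<Rightarrow> 'c::finite \<Rightarrow> 'f::{real_normed_field,euclidean_space}"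
    and X :: "('k^'n^'n) topology" and I :: "'i set" and \<A> :: "('k^'n^'n, 'i, 'f) atlas"
  assumes coords: "analytic_coords C0"
    and algebra: "\<And>W :: (('n \<times> 'c + 'i) + ('n \<times> 'c + 'i) \<Rightarrow> 'f) set.
      finite I \<Longrightarrow> poly_open ((UNIV <+> I) <+> (UNIV <+> I)) W \<Longrightarrow>
      function_algebra W (coord_analytic C0 ((UNIV <+> I) <+> (UNIV <+> I)) W)"
    and Lie: "matrix_Lie_structure C0 \<Gamma>0 \<delta> X I \<A>"
begin

abbreviation "G0 \<equiv> GL\<lparr>carrier := \<Gamma>0\<rparr>"
abbreviation "Y \<equiv> prod_topology (euclidean :: ('k^'n) topology) X"
abbreviation "K \<equiv> (UNIV :: ('n \<times> 'c) set) <+> I"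
abbreviation "vc \<equiv> \<lambda>v :: 'k^'n. \<lambda>(i, c). C0 (v $ i) c"
abbreviation "\<B> \<equiv> prod_atlas (vector_atlas C0 :: ('k^'n, _, 'f) atlas) \<A>"

lemma manifold_X: "analytic_manifold X I \<A>" and topspace_X: "topspace X = \<Gamma>0"
  and mult_X: "analytic_map (prod_topology X X) (I <+> I) (prod_atlas \<A> \<A>) X I \<A> (\<lambda>(x, y). x \<otimes>\<^bsub>G0\<^esub> y)"
  and ldiv_X: "analytic_map (prod_topology X X) (I <+> I) (prod_atlas \<A> \<A>) X I \<A> (\<lambda>(x, y). ldiv G0 x y)"
  and rdiv_X: "analytic_map (prod_topology X X) (I <+> I) (prod_atlas \<A> \<A>) X I \<A> (\<lambda>(x, y). rdiv G0 y x)"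
  and entries_X: "analytic_map X I \<A> euclidean UNIV (matrix_atlas C0) (\<lambda>M. M)"
  and delta_X: "analytic_map X I \<A> euclidean UNIV (matrix_atlas C0) \<delta>"
  using Lie unfolding matrix_Lie_structure_def analytic_loop_def by auto

lemma manifold_Y: "analytic_manifold Y K \<B>"
  by (rule analytic_manifold_prod[OF analytic_manifold_vector[OF coords] manifold_X])

lemma topspace_Y: "topspace Y = carrier Q"
  by (simp add: topspace_X Q_simps)

lemma mem_atlas: "(U, \<Phi>) \<in> \<B> \<longleftrightarrow> (\<exists>V \<phi>. (V, \<phi>) \<in> \<A> \<and> U = UNIV \<times> V \<and> \<Phi> = chart_prod vc \<phi>)"
  unfolding prod_atlas_def vector_atlas_def by auto

text \<open>The vector part of the operation is rational in the entries and goes through the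
  function algebra, once for continuous and once for analytic functions. The matrix part is the
  group operation \<open>fM\<close>, whose analyticity in the charts of \<open>\<Gamma>0\<close> is
  part of the Lie structure and does not follow from its entries.\<close>

lemma analytic_operation:
  assumes fM: "analytic_map (prod_topology X X) (I <+> I) (prod_atlas \<A> \<A>) X I \<A> (\<lambda>(x, y). fM x y)"
    and op: "\<And>p r. p \<in> carrier Q \<Longrightarrow> r \<in> carrier Q \<Longrightarrow> snd (f p r) = fM (snd p) (snd r)"
    and cont: "\<And>p r. function_algebra (topspace (prod_topology Y Y)) (continuous_map (prod_topology Y Y) (euclidean :: 'k topology)) \<Longrightarrow>
      Q_fun (topspace (prod_topology Y Y)) (continuous_map (prod_topology Y Y) (euclidean :: 'k topology)) p \<Longrightarrow>
      Q_fun (topspace (prod_topology Y Y)) (continuous_map (prod_topology Y Y) (euclidean :: 'k topology)) r \<Longrightarrow>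
      Q_fun (topspace (prod_topology Y Y)) (continuous_map (prod_topology Y Y) (euclidean :: 'k topology)) (\<lambda>x. f (p x) (r x))"
    and analytic: "\<And>W p r. function_algebra W (coord_analytic C0 (K <+> K) W) \<Longrightarrow>
      Q_fun W (coord_analytic C0 (K <+> K) W) p \<Longrightarrow> Q_fun W (coord_analytic C0 (K <+> K) W) r \<Longrightarrow>
      Q_fun W (coord_analytic C0 (K <+> K) W) (\<lambda>x. f (p x) (r x))"
  shows "analytic_map (prod_topology Y Y) (K <+> K) (prod_atlas \<B> \<B>) Y K \<B> (\<lambda>(p, r). f p r)"
  unfolding analytic_map_def
proof
  let ?Z = "prod_topology Y Y"
  have top: "topspace ?Z = carrier Q \<times> carrier Q" by (simp add: topspace_X Q_simps)
  \<comment> \<open>Continuity is settled before the charts are treated, since it makes the domains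
    of the coordinate expressions open.\<close>
  show continuous: "continuous_map ?Z Y (\<lambda>(p, r). f p r)"
  proof -
    note alg = function_algebra_continuous[OF topological_field_euclidean[where 'k = 'k]]
    interpret Z: function_algebra "topspace ?Z" "continuous_map ?Z (euclidean :: 'k topology)" by (rule alg)
    have proj: "Q_fun (topspace ?Z) (continuous_map ?Z euclidean) \<pi>" if \<pi>: "continuous_map ?Z Y \<pi>" for \<pi>
    proof -
      have fs: "continuous_map ?Z euclidean (\<lambda>z. fst (\<pi> z))" "continuous_map ?Z X (\<lambda>z. snd (\<pi> z))"
        using continuous_map_compose[OF \<pi> continuous_map_fst] continuous_map_compose[OF \<pi> continuous_map_snd]
        by (simp_all add: o_def)
      have "continuous_map X euclidean (\<lambda>M. M)" "continuous_map X euclidean \<delta>"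
        using entries_X delta_X by (simp_all add: analytic_map_def)
      from continuous_map_compose[OF fs(2) this(1)] continuous_map_compose[OF fs(2) this(2)]
      have "continuous_map ?Z euclidean (\<lambda>z. snd (\<pi> z) $ i $ j)"
        "continuous_map ?Z euclidean (\<lambda>z. \<delta> (snd (\<pi> z)) $ i $ j)" for i j
        by (simp_all add: o_def continuous_map_entries)
      moreover have "continuous_map ?Z euclidean (\<lambda>z. fst (\<pi> z) $ i)" for i
        using fs(1) by (simp add: continuous_map_vec_iff)
      moreover have "snd (\<pi> z) \<in> \<Gamma>0" if "z \<in> topspace ?Z" for z
        using fs(2) that unfolding continuous_map_def topspace_X by auto
      ultimately show ?thesis unfolding Q_fun_def Z.Fv_def Z.Fm_def by blast
    qed
    have "Q_fun (topspace ?Z) (continuous_map ?Z euclidean) (\<lambda>z. f (fst z) (snd z))"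
      by (rule cont[OF alg proj[OF continuous_map_fst] proj[OF continuous_map_snd]])
    then have "continuous_map ?Z euclidean (\<lambda>z. fst (f (fst z) (snd z)))"
      unfolding Q_fun_def Z.Fv_def by (simp add: continuous_map_vec_iff)
    \<comment> \<open>Continuity of the entries would not suffice here, because the topology of
      \<open>X\<close> may be finer than that of the matrix space.\<close>
    moreover have "continuous_map ?Z X (\<lambda>z. snd (f (fst z) (snd z)))"
    proof -
      have snds: "continuous_map ?Z (prod_topology X X) (\<lambda>z. (snd (fst z), snd (snd z)))"
        using continuous_map_compose[OF continuous_map_fst[of Y Y] continuous_map_snd]
          continuous_map_compose[OF continuous_map_snd[of Y Y] continuous_map_snd]
        by (simp add: continuous_map_paired o_def)
      have "continuous_map (prod_topology X X) X (\<lambda>(x, y). fM x y)"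
        using fM by (simp add: analytic_map_def)
      from continuous_map_compose[OF snds this]
      have "continuous_map ?Z X (\<lambda>z. fM (snd (fst z)) (snd (snd z)))" by (simp add: o_def)
      then show ?thesis by (rule continuous_map_eq) (auto simp: top op simp del: topspace_prod_topology)
    qed
    ultimately have "continuous_map ?Z Y (\<lambda>z. (fst (f (fst z) (snd z)), snd (f (fst z) (snd z))))"
      by (rule continuous_map_pairedI)
    then show ?thesis by (simp add: case_prod_unfold)
  qed
  have "analytic_fun (K <+> K) (\<Phi> ` {x \<in> (UNIV \<times> U1) \<times> (UNIV \<times> U2). (\<lambda>(p, r). f p r) x \<in> UNIV \<times> U3})
      (\<lambda>z. chart_prod vc \<phi>3 ((\<lambda>(p, r). f p r) (the_inv_into ((UNIV \<times> U1) \<times> (UNIV \<times> U2)) \<Phi> z)) k)"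
    if U1: "(U1, \<phi>1) \<in> \<A>" and U2: "(U2, \<phi>2) \<in> \<A>" and U3: "(U3, \<phi>3) \<in> \<A>" and k: "k \<in> K"
      and \<Phi>: "\<Phi> = chart_prod (chart_prod vc \<phi>1) (chart_prod vc \<phi>2)" for U1 \<phi>1 U2 \<phi>2 U3 \<phi>3 \<Phi> k
  proof -
    let ?U = "(UNIV \<times> U1) \<times> (UNIV \<times> U2)" and ?f = "\<lambda>(p, r). f p r"
    let ?O = "{x \<in> ?U. ?f x \<in> UNIV \<times> U3}"
    let ?p = "\<lambda>z. fst (the_inv_into ?U \<Phi> z)" and ?r = "\<lambda>z. snd (the_inv_into ?U \<Phi> z)"
    note c1 = analytic_manifold_chart[OF manifold_X U1] and c2 = analytic_manifold_chart[OF manifold_X U2]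
      and c3 = analytic_manifold_chart[OF manifold_X U3]
    have B: "(UNIV \<times> U1, chart_prod vc \<phi>1) \<in> \<B>" "(UNIV \<times> U2, chart_prod vc \<phi>2) \<in> \<B>"
      "(UNIV \<times> U3, chart_prod vc \<phi>3) \<in> \<B>"
      using U1 U2 U3 unfolding mem_atlas by blast+
    have c: "chart ?Z (K <+> K) ?U \<Phi>"
      unfolding \<Phi> by (intro chart_prod analytic_manifold_chart[OF manifold_Y] B)
    have fin: "finite (K <+> K)" "finite I" using manifold_X by (simp_all add: analytic_manifold_alt)
    define W where "W = \<Phi> ` ?O"
    have W: "poly_open (K <+> K) W"
    proof -
      have "openin Y (UNIV \<times> U3)" by (rule chart_open[OF analytic_manifold_chart[OF manifold_Y B(3)]])
      then have "openin ?Z {x \<in> topspace ?Z. ?f x \<in> UNIV \<times> U3}"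
        using continuous unfolding continuous_map_def by blast
      then have "openin ?Z (?U \<inter> {x \<in> topspace ?Z. ?f x \<in> UNIV \<times> U3})"
        using chart_open[OF c] by (rule openin_Int[rotated])
      also have "?U \<inter> {x \<in> topspace ?Z. ?f x \<in> UNIV \<times> U3} = ?O"
        using openin_subset[OF chart_open[OF c]] by blast
      finally show ?thesis
        unfolding W_def by (intro openin_coord_space_imp_poly_open[OF fin(1)] chart_image[OF c]) auto
    qed
    interpret function_algebra W "coord_analytic C0 (K <+> K) W" using fin W by (intro algebra)
    have pt: "\<exists>v M w N. z = case_sum (case_sum (vc v) (\<phi>1 M)) (case_sum (vc w) (\<phi>2 N)) \<and> M \<in> U1 \<and> N \<in> U2 \<and>
        the_inv_into ?U \<Phi> z = ((v, M), (w, N)) \<and> snd (f (v, M) (w, N)) \<in> U3" if "z \<in> W" for z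
    proof -
      obtain x where x: "z = \<Phi> x" "x \<in> ?O" using \<open>z \<in> W\<close> unfolding W_def by (rule imageE)
      obtain v M w N where vM: "x = ((v, M), (w, N))" by (metis surj_pair)
      have MN: "M \<in> U1" "N \<in> U2" "snd (f (v, M) (w, N)) \<in> U3" using x(2) by (auto simp: vM mem_Times_iff)
      have "the_inv_into ?U \<Phi> z = ((v, M), (w, N))"
        unfolding x(1) vM by (rule chart_inv[OF c]) (simp add: MN)
      moreover have "z = case_sum (case_sum (vc v) (\<phi>1 M)) (case_sum (vc w) (\<phi>2 N))"
        by (simp add: x(1) vM \<Phi>)
      ultimately show ?thesis using MN by blast
    qed
    have carrier: "?p z \<in> carrier Q" "?r z \<in> carrier Q" if "z \<in> W" for z
      using pt[OF that] openin_subset[OF chart_open[OF c1]] openin_subset[OF chart_open[OF c2]]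
      by (auto simp: topspace_X Q_simps)
    have e1: "restrict (z \<circ> (Inl \<circ> Inr)) I = \<phi>1 (snd (?p z))" "snd (?p z) \<in> U1"
      and e2: "restrict (z \<circ> (Inr \<circ> Inr)) I = \<phi>2 (snd (?r z))" "snd (?r z) \<in> U2"
      and e3: "snd (f (?p z) (?r z)) \<in> U3"
      and v1: "C0 (fst (?p z) $ i) c' = z (Inl (Inl (i, c')))" and v2: "C0 (fst (?r z) $ i) c' = z (Inr (Inl (i, c')))"
      if "z \<in> W" for z i c'
    proof -
      obtain v M w N where z: "z = case_sum (case_sum (vc v) (\<phi>1 M)) (case_sum (vc w) (\<phi>2 N))" "M \<in> U1" "N \<in> U2"
        "the_inv_into ?U \<Phi> z = ((v, M), (w, N))" "snd (f (v, M) (w, N)) \<in> U3"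
        using pt[OF \<open>z \<in> W\<close>] by blast
      have "z \<circ> (Inl \<circ> Inr) = \<phi>1 M" "z \<circ> (Inr \<circ> Inr) = \<phi>2 N" unfolding z(1) by (auto simp: o_def)
      then show "restrict (z \<circ> (Inl \<circ> Inr)) I = \<phi>1 (snd (?p z))" "restrict (z \<circ> (Inr \<circ> Inr)) I = \<phi>2 (snd (?r z))"
        using chart_ext[OF c1 z(2)] chart_ext[OF c2 z(3)] z(4) by (simp_all add: PiE_restrict)
      show "snd (?p z) \<in> U1" "snd (?r z) \<in> U2" "snd (f (?p z) (?r z)) \<in> U3" using z by simp_all
      show "C0 (fst (?p z) $ i) c' = z (Inl (Inl (i, c')))" "C0 (fst (?r z) $ i) c' = z (Inr (Inl (i, c')))"
        unfolding z(4) unfolding z(1) by simp_all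
    qed
    have inj: "inj_on (Inl \<circ> Inr) I" "inj_on (Inr \<circ> Inr) I"
      "(Inl \<circ> Inr) ` I \<subseteq> K <+> K" "(Inr \<circ> Inr) ` I \<subseteq> K <+> K" by (auto simp: inj_on_def)
    have Qp: "Q_fun W (coord_analytic C0 (K <+> K) W) ?p"
      unfolding Q_fun_def Fv_def Fm_def
    proof (intro conjI ballI allI)
      show "snd (?p z) \<in> \<Gamma>0" if "z \<in> W" for z using carrier(1)[OF that] by (auto simp: Q_simps)
      show "coord_analytic C0 (K <+> K) W (\<lambda>z. fst (?p z) $ i)" for i
        unfolding coord_analytic_def
      proof
        fix c'
        have "analytic_fun (K <+> K) W (\<lambda>z. z (Inl (Inl (i, c'))))"
          using fin W by (intro analytic_coordinate_fun) auto
        then show "analytic_fun (K <+> K) W (\<lambda>z. C0 (fst (?p z) $ i) c')"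
          by (rule analytic_fun_cong) (simp add: v1)
      qed
      have into: "restrict (z \<circ> (Inl \<circ> Inr)) I \<in> \<phi>1 ` U1" if "z \<in> W" for z using e1[OF that] by simp
      show "coord_analytic C0 (K <+> K) W (\<lambda>z. snd (?p z) $ i $ j)" for i j
        by (rule cong[OF matrix_map_entries[OF entries_X U1 fin(1) inj(1,3) W into]])
          (simp_all add: e1 chart_inv[OF c1])
      show "coord_analytic C0 (K <+> K) W (\<lambda>z. \<delta> (snd (?p z)) $ i $ j)" for i j
        by (rule cong[OF matrix_map_entries[OF delta_X U1 fin(1) inj(1,3) W into]])
          (simp_all add: e1 chart_inv[OF c1])
    qed
    have Qr: "Q_fun W (coord_analytic C0 (K <+> K) W) ?r"
      unfolding Q_fun_def Fv_def Fm_def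
    proof (intro conjI ballI allI)
      show "snd (?r z) \<in> \<Gamma>0" if "z \<in> W" for z using carrier(2)[OF that] by (auto simp: Q_simps)
      show "coord_analytic C0 (K <+> K) W (\<lambda>z. fst (?r z) $ i)" for i
        unfolding coord_analytic_def
      proof
        fix c'
        have "analytic_fun (K <+> K) W (\<lambda>z. z (Inr (Inl (i, c'))))"
          using fin W by (intro analytic_coordinate_fun) auto
        then show "analytic_fun (K <+> K) W (\<lambda>z. C0 (fst (?r z) $ i) c')"
          by (rule analytic_fun_cong) (simp add: v2)
      qed
      have into: "restrict (z \<circ> (Inr \<circ> Inr)) I \<in> \<phi>2 ` U2" if "z \<in> W" for z using e2[OF that] by simp
      show "coord_analytic C0 (K <+> K) W (\<lambda>z. snd (?r z) $ i $ j)" for i j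
        by (rule cong[OF matrix_map_entries[OF entries_X U2 fin(1) inj(2,4) W into]])
          (simp_all add: e2 chart_inv[OF c2])
      show "coord_analytic C0 (K <+> K) W (\<lambda>z. \<delta> (snd (?r z)) $ i $ j)" for i j
        by (rule cong[OF matrix_map_entries[OF delta_X U2 fin(1) inj(2,4) W into]])
          (simp_all add: e2 chart_inv[OF c2])
    qed
    have Qf: "Q_fun W (coord_analytic C0 (K <+> K) W) (\<lambda>z. f (?p z) (?r z))"
      by (rule analytic[OF function_algebra_axioms Qp Qr])
    show ?thesis unfolding W_def[symmetric]
    proof (cases k)
      case (Inl ic)
      obtain i c' where ic: "ic = (i, c')" by (cases ic)
      have "analytic_fun (K <+> K) W (\<lambda>z. C0 (fst (f (?p z) (?r z)) $ i) c')"
        using Qf unfolding Q_fun_def Fv_def coord_analytic_def by blast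
      then show "analytic_fun (K <+> K) W (\<lambda>z. chart_prod vc \<phi>3 (?f (the_inv_into ?U \<Phi> z)) k)"
        by (simp add: Inl ic case_prod_unfold)
    next
      case (Inr j)
      \<comment> \<open>This embedding picks the coordinates of the two matrix parts out of all
        coordinates of a pair; on them the chart expression of \<open>fM\<close> is defined.\<close>
      let ?e = "map_sum Inr Inr :: 'i + 'i \<Rightarrow> ('n \<times> 'c + 'i) + ('n \<times> 'c + 'i)"
      let ?\<Psi> = "chart_prod \<phi>1 \<phi>2"
      have j: "j \<in> I" using k Inr by auto
      have "(U1 \<times> U2, ?\<Psi>) \<in> prod_atlas \<A> \<A>" using U1 U2 unfolding prod_atlas_def by blast
      then have a: "analytic_fun (I <+> I) (?\<Psi> ` {x \<in> U1 \<times> U2. (\<lambda>(x, y). fM x y) x \<in> U3})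
          (\<lambda>z. \<phi>3 ((\<lambda>(x, y). fM x y) (the_inv_into (U1 \<times> U2) ?\<Psi> z)) j)"
        using fM U3 j unfolding analytic_map_def by blast
      have e: "inj_on ?e (I <+> I)" "?e ` (I <+> I) \<subseteq> K <+> K"
        by (auto simp: inj_on_def)
      have r: "restrict (z \<circ> ?e) (I <+> I) = ?\<Psi> (snd (?p z), snd (?r z))" if "z \<in> W" for z
      proof
        fix k' show "restrict (z \<circ> ?e) (I <+> I) k' = ?\<Psi> (snd (?p z), snd (?r z)) k'"
          unfolding prod.case e1(1)[OF that, symmetric] e2(1)[OF that, symmetric] by (cases k') auto
      qed
      have op': "snd (f (?p z) (?r z)) = fM (snd (?p z)) (snd (?r z))" if "z \<in> W" for z
        by (rule op[OF carrier[OF that]])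
      have into: "restrict (z \<circ> ?e) (I <+> I) \<in> ?\<Psi> ` {x \<in> U1 \<times> U2. (\<lambda>(x, y). fM x y) x \<in> U3}" if "z \<in> W" for z
        unfolding r[OF that]
        by (rule imageI) (use e1(2)[OF that] e2(2)[OF that] e3[OF that] op'[OF that] in simp)
      show "analytic_fun (K <+> K) W (\<lambda>z. chart_prod vc \<phi>3 (?f (the_inv_into ?U \<Phi> z)) k)"
      proof (rule analytic_fun_cong[OF analytic_fun_lift[OF fin(1) e a W into]])
        fix z assume z: "z \<in> W"
        have "the_inv_into (U1 \<times> U2) ?\<Psi> (?\<Psi> (snd (?p z), snd (?r z))) = (snd (?p z), snd (?r z))"
          using e1(2)[OF z] e2(2)[OF z] by (intro chart_inv[OF chart_prod[OF c1 c2]]) simp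
        then show "\<phi>3 ((\<lambda>(x, y). fM x y) (the_inv_into (U1 \<times> U2) ?\<Psi> (restrict (z \<circ> ?e) (I <+> I)))) j =
            chart_prod vc \<phi>3 (?f (the_inv_into ?U \<Phi> z)) k"
          unfolding r[OF z] using op'[OF z] by (simp add: Inr case_prod_unfold)
      qed assumption
    qed
  qed
  note main = this
  show "\<forall>(U, \<Phi>)\<in>prod_atlas \<B> \<B>. \<forall>(V, \<Psi>)\<in>\<B>. \<forall>j\<in>K.
      analytic_fun (K <+> K) (\<Phi> ` {x \<in> U. (\<lambda>(p, r). f p r) x \<in> V}) (\<lambda>z. \<Psi> ((\<lambda>(p, r). f p r) (the_inv_into U \<Phi> z)) j)"
  proof (intro ballI, clarify)
    fix U \<Phi> V \<Psi> j assume "(U, \<Phi>) \<in> prod_atlas \<B> \<B>" and V: "(V, \<Psi>) \<in> \<B>" and j: "j \<in> K"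
    then obtain U' \<Phi>' U'' \<Phi>'' where "(U', \<Phi>') \<in> \<B>" "(U'', \<Phi>'') \<in> \<B>" "U = U' \<times> U''" "\<Phi> = chart_prod \<Phi>' \<Phi>''"
      unfolding prod_atlas_def[of \<B>] by blast
    with V obtain U1 \<phi>1 U2 \<phi>2 U3 \<phi>3 where "(U1, \<phi>1) \<in> \<A>" "(U2, \<phi>2) \<in> \<A>" "(U3, \<phi>3) \<in> \<A>"
      "U = (UNIV \<times> U1) \<times> (UNIV \<times> U2)" "\<Phi> = chart_prod (chart_prod vc \<phi>1) (chart_prod vc \<phi>2)"
      "V = UNIV \<times> U3" "\<Psi> = chart_prod vc \<phi>3"
      unfolding mem_atlas by blast
    then show "analytic_fun (K <+> K) (\<Phi> ` {x \<in> U. (\<lambda>(p, r). f p r) x \<in> V}) (\<lambda>z. \<Psi> ((\<lambda>(p, r). f p r) (the_inv_into U \<Phi> z)) j)"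
      using main j by simp
  qed
qed

lemma analytic_loop_Q: "analytic_loop Q Y K \<B>"
proof -
  have G0: "loop G0"
    by (rule group.group_imp_loop[OF subgroup.subgroup_is_group[OF subgroup_\<Gamma>0 group_GL]])
  have div: "ldiv G0 M N = matrix_inv M ** N" "rdiv G0 N M = N ** matrix_inv M" if "M \<in> \<Gamma>0" "N \<in> \<Gamma>0" for M N
    using that by (auto intro!: loop_ldiv[OF G0] loop_rdiv[OF G0] simp: GL_simps mult_cancel_\<Gamma>0)
  note charts = analytic_manifold_chart[OF analytic_manifold_prod[OF manifold_Y manifold_Y]]
  have "analytic_map (prod_topology Y Y) (K <+> K) (prod_atlas \<B> \<B>) Y K \<B> (\<lambda>(p, r). p \<otimes>\<^bsub>Q\<^esub> r)"
    by (rule analytic_operation[OF mult_X]) (auto simp: Q_simps GL_simps intro: Q_fun_operations)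
  moreover have "analytic_map (prod_topology Y Y) (K <+> K) (prod_atlas \<B> \<B>) Y K \<B> (\<lambda>(p, r). ldiv Q p r)"
  proof (rule analytic_map_cong)
    show "analytic_map (prod_topology Y Y) (K <+> K) (prod_atlas \<B> \<B>) Y K \<B> (\<lambda>(p, r). qldiv p r)"
    proof (rule analytic_operation[OF ldiv_X])
      show "snd (qldiv p r) = ldiv G0 (snd p) (snd r)" if "p \<in> carrier Q" "r \<in> carrier Q" for p r
        using that by (auto simp: Q_simps qldiv_def div)
    qed (rule Q_fun_operations, assumption+)+
  qed (auto simp: topspace_X Q_simps Q_division intro: charts)
  moreover have "analytic_map (prod_topology Y Y) (K <+> K) (prod_atlas \<B> \<B>) Y K \<B> (\<lambda>(p, r). rdiv Q r p)"
  proof (rule analytic_map_cong)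
    show "analytic_map (prod_topology Y Y) (K <+> K) (prod_atlas \<B> \<B>) Y K \<B> (\<lambda>(p, r). qrdiv r p)"
    proof (rule analytic_operation[OF rdiv_X])
      show "snd (qrdiv r p) = rdiv G0 (snd r) (snd p)" if "p \<in> carrier Q" "r \<in> carrier Q" for p r
        using that by (auto simp: Q_simps qrdiv_def div)
    qed (rule Q_fun_operations, assumption+)+
  qed (auto simp: topspace_X Q_simps Q_division intro: charts)
  ultimately show ?thesis
    unfolding analytic_loop_def using loop_Q topspace_Y manifold_Y by blast
qed

lemma analytic_L: "analytic_L_Xi C0 \<Gamma>0 \<delta> A B X I \<A>"
  unfolding analytic_L_Xi_def coset_manifold_topology_def coset_atlas_def L_lcosets[symmetric]
  by (rule analytic_loop_pullback[OF analytic_loop_Q inj_q_Q L_carrier' L_mult L_one kappa_q'])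

end

section \<open>Lie structures on matrix groups\<close>

lemma analytic_L_self_coord:
  fixes \<Gamma>0 :: "('k::{real_normed_field,euclidean_space}^'n^'n) set" and I :: "'i set"
  assumes "loop_data \<Gamma>0 \<delta> A B" "matrix_Lie_structure self_coord \<Gamma>0 \<delta> X I \<A>"
  shows "analytic_L_Xi self_coord \<Gamma>0 \<delta> A B X I \<A>"
proof -
  interpret Lie_setup \<Gamma>0 \<delta> A B self_coord X I \<A>
    by (intro Lie_setup.intro Lie_setup_axioms.intro loop_setup.intro assms analytic_coords_self
        function_algebra_self_coord) auto
  show ?thesis by (rule analytic_L)
qed

lemma analytic_L_Re_Im_coord:
  fixes \<Gamma>0 :: "(complex^'n^'n) set" and I :: "'i set"
  assumes "loop_data \<Gamma>0 \<delta> A B" "matrix_Lie_structure Re_Im_coord \<Gamma>0 \<delta> X I \<A>"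
  shows "analytic_L_Xi Re_Im_coord \<Gamma>0 \<delta> A B X I \<A>"
proof -
  interpret Lie_setup \<Gamma>0 \<delta> A B Re_Im_coord X I \<A>
    by (intro Lie_setup.intro Lie_setup_axioms.intro loop_setup.intro assms analytic_coords_Re_Im
        function_algebra_Re_Im_coord) auto
  show ?thesis by (rule analytic_L)
qed

text \<open>The coordinate space of dimension 0 is a single point, so a one-term constant series
  suffices.\<close>

lemma analytic_fun_empty:
  assumes "W \<subseteq> {} \<rightarrow>\<^sub>E UNIV"
  shows "analytic_fun {} W (f :: ('i \<Rightarrow> 'f::real_normed_field) \<Rightarrow> 'f)"
  unfolding analytic_fun_def
proof (intro conjI ballI)
  fix a assume a: "a \<in> W"
  show "\<exists>r>0. \<exists>c. \<forall>x\<in>{} \<rightarrow>\<^sub>E UNIV. (\<forall>i\<in>{}. norm (x i - a i) < r) \<longrightarrow>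
      x \<in> W \<and> ((\<lambda>\<alpha>. c \<alpha> * (\<Prod>i\<in>{}. (x i - a i) ^ \<alpha> i)) has_sum f x) ({} \<rightarrow>\<^sub>E UNIV)"
  proof (intro exI[of _ 1] exI[of _ "\<lambda>_. f a"] conjI ballI impI)
    fix x :: "'i \<Rightarrow> 'f" assume "x \<in> {} \<rightarrow>\<^sub>E UNIV"
    then have "x = a" using assms a by auto
    then show "x \<in> W" "((\<lambda>\<alpha>. f a * (\<Prod>i\<in>{}. (x i - a i) ^ \<alpha> i)) has_sum f x) ({} \<rightarrow>\<^sub>E UNIV)"
      using a by (auto intro: has_sum_finiteI)
  qed simp
qed (rule assms)

text \<open>A group of matrices with the discrete topology is a Lie group of dimension 0.\<close>

lemma discrete_Lie_structure:
  fixes \<Gamma>0 :: "('k::real_normed_field^'n^'n) set" and C :: "'k \<Rightarrow> 'c \<Rightarrow> 'f::real_normed_field"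
  assumes "subgroup \<Gamma>0 GL"
  shows "\<exists>X (d::nat) \<A>. matrix_Lie_structure C \<Gamma>0 \<delta> X {..<d} \<A>"
proof -
  let ?G = "GL\<lparr>carrier := \<Gamma>0\<rparr>" and ?X = "discrete_topology \<Gamma>0"
  define \<A> :: "('k^'n^'n, nat, 'f) atlas" where "\<A> = (\<lambda>M. ({M}, \<lambda>_ _. undefined)) ` \<Gamma>0"
  have loop: "loop ?G"
    by (rule group.group_imp_loop[OF subgroup.subgroup_is_group[OF assms group_GL]])
  have "homeomorphic_maps (discrete_topology {M}) (discrete_topology {\<lambda>_ :: nat. undefined :: 'f}) (\<lambda>_ _. undefined) (\<lambda>_. M)"
    for M :: "'k^'n^'n"
    by (simp add: homeomorphic_maps_def)
  then have hom: "homeomorphic_map (discrete_topology {M}) (discrete_topology {\<lambda>_ :: nat. undefined :: 'f}) (\<lambda>_ _. undefined)"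
    for M :: "'k^'n^'n"
    using homeomorphic_map_maps by blast
  have coord: "coord_space {} = discrete_topology {\<lambda>_ :: nat. undefined :: 'f}"
    by (simp add: coord_space_def product_topology_empty_discrete)
  have "chart ?X {} {M} (\<lambda>_. \<lambda>_ :: nat. undefined :: 'f)" if "M \<in> \<Gamma>0" for M
    unfolding chart_def coord using that hom[of M]
    by (intro conjI exI[of _ "{\<lambda>_. undefined}"]) (simp_all add: subtopology_discrete_topology)
  then have manifold: "analytic_manifold ?X {} \<A>"
    unfolding analytic_manifold_alt \<A>_def by auto
  have map: "analytic_map (prod_topology ?X ?X) ({} <+> {}) (prod_atlas \<A> \<A>) ?X {} \<A> (\<lambda>(x, y). f x y)"
    if "\<And>x y. x \<in> \<Gamma>0 \<Longrightarrow> y \<in> \<Gamma>0 \<Longrightarrow> f x y \<in> \<Gamma>0" for f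
    unfolding analytic_map_def prod_topology_discrete_topology[symmetric]
    using that by (auto simp: Pi_iff)
  have closed: "x \<otimes>\<^bsub>?G\<^esub> y \<in> \<Gamma>0" "ldiv ?G x y \<in> \<Gamma>0" "rdiv ?G y x \<in> \<Gamma>0" if "x \<in> \<Gamma>0" "y \<in> \<Gamma>0" for x y
    using loop loop_division[OF loop, of x y] that by (auto simp: loop_def)
  have "analytic_loop ?G ?X {} \<A>"
    unfolding analytic_loop_def
    by (intro conjI loop manifold map closed topspace_discrete_topology[THEN trans]) simp_all
  moreover have "analytic_map ?X {} \<A> euclidean UNIV (matrix_atlas C) g" for g :: "'k^'n^'n \<Rightarrow> 'k^'n^'n"
    unfolding analytic_map_def \<A>_def by (auto intro!: analytic_fun_empty)
  ultimately have "matrix_Lie_structure C \<Gamma>0 \<delta> ?X {..<0} \<A>"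
    by (simp add: matrix_Lie_structure_def)
  then show ?thesis by blast
qed

lemma loop_data_Lie_structure:
  fixes \<Gamma>0 :: "('k::real_normed_field^'n^'n) set" and C :: "'k \<Rightarrow> 'c \<Rightarrow> 'f::real_normed_field"
  assumes "loop_data \<Gamma>0 \<delta> A B"
  shows "\<exists>X (d::nat) \<A>. matrix_Lie_structure C \<Gamma>0 \<delta> X {..<d} \<A>"
  using assms by (intro discrete_Lie_structure) (simp add: loop_data_def)

text \<open>The analytic claims carry their own data, because the field of the fixed data is
  arbitrary. They assert that a Lie structure exists, which keeps them from being vacuous, and treat
  complex matrices over real as well as over complex manifolds.\<close>

theorem theorem1:
  fixes \<Gamma>0 :: "('k::field^'n^'n) set"
    and \<delta> :: "'k^'n^'n \<Rightarrow> 'k^'n^'n"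
    and A B :: "'k^'n^'n"
  defines "\<Gamma> \<equiv> Gam \<Gamma>0 \<delta>"
    and "H \<equiv> graph_group \<delta> A"
    and "TB \<equiv> graph_group \<delta> B"
    and "\<Xi> \<equiv> graph_group \<delta> B <#>\<^bsub>Gam \<Gamma>0 \<delta>\<^esub> Gam0' \<Gamma>0 \<delta>"
    and "\<sigma> \<equiv> sigma \<Gamma>0 \<delta> A B"
    and "L \<equiv> L_Xi \<Gamma>0 \<delta> A B"
    and "P \<equiv> twisted_product \<Gamma>0 \<delta> A B"
    and "TB' \<equiv> normal_closure (Gam \<Gamma>0 \<delta>) (graph_group \<delta> B)"
    and "\<Delta>' \<equiv> normal_closure (Gam \<Gamma>0 \<delta>) (graph_group \<delta> B) <#>\<^bsub>Gam \<Gamma>0 \<delta>\<^esub> Gam0' \<Gamma>0 \<delta>"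
    and "\<Theta> \<equiv> normal_core (Gam \<Gamma>0 \<delta>) (graph_group \<delta> A)"
  assumes data: "loop_data \<Gamma>0 \<delta> A B"
  shows
   "(\<forall>v. \<forall>M\<in>\<Gamma>0. invertible (B ** M - \<delta> M ** A) \<and>
        \<sigma> (gmat \<delta> 0 v M <#\<^bsub>\<Gamma>\<^esub> H) =
          gmat \<delta> ((M ** matrix_inv (B ** M - \<delta> M ** A)) *v v)
                 ((B ** M ** matrix_inv (B ** M - \<delta> M ** A)) *v v) M) \<and>
    transitive_section \<Gamma> H \<sigma> \<and>
    (\<sigma> ` (lcosets\<^bsub>\<Gamma>\<^esub> H) = \<Xi>) \<and>
    (sharply_transitive_section (\<Gamma>\<lparr>carrier := \<Delta>'\<rparr>) (H \<inter> \<Delta>') (\<lambda>X. \<sigma> (X <#>\<^bsub>\<Gamma>\<^esub> H))) \<and>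
    (sharply_transitive_section \<Gamma> H \<sigma> \<longleftrightarrow> \<Delta>' = carrier \<Gamma>) \<and>
    loop L \<and>
    (L \<cong> P) \<and>
    (semidirect P (UNIV \<times> {mat 1}) ({0} \<times> \<Gamma>0)) \<and>
    ((\<lambda>u. (u, mat 1)) \<in> iso additive_group (P\<lparr>carrier := UNIV \<times> {mat 1}\<rparr>)) \<and>
    ((\<lambda>M. (0, M)) \<in> iso (GL\<lparr>carrier := \<Gamma>0\<rparr>) (P\<lparr>carrier := {0} \<times> \<Gamma>0\<rparr>)) \<and>
    (\<forall>M1\<in>\<Gamma>0. \<forall>M2\<in>\<Gamma>0. invertible (B - \<delta> (M1 ** M2) ** A ** matrix_inv (M1 ** M2)) \<and>
        invertible (psi \<delta> A B M1 M2)) \<and>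
    ({matrix_inv M ** matrix_inv B ** \<delta> M | M. M \<in> \<Gamma>0} = {matrix_inv B} \<longleftrightarrow> TB \<lhd> \<Gamma>) \<and>
    ({matrix_inv M ** matrix_inv B ** \<delta> M | M. M \<in> \<Gamma>0} = {matrix_inv B} \<longrightarrow> group L) \<and>
    (\<Theta> \<inter> \<Delta>' = {\<one>\<^bsub>\<Gamma>\<^esub>} \<longrightarrow>
       (group L \<longleftrightarrow> {matrix_inv M ** matrix_inv B ** \<delta> M | M. M \<in> \<Gamma>0} = {matrix_inv B})) \<and>
    (group L \<longleftrightarrow> (TB <#>\<^bsub>\<Gamma>\<^esub> \<Theta>) \<lhd> \<Gamma>) \<and>
    (TB' \<lhd> \<Gamma>) \<and>
    (subgroup \<Delta>' \<Gamma> \<and> semidirect (\<Gamma>\<lparr>carrier := \<Delta>'\<rparr>) TB' (Gam0' \<Gamma>0 \<delta>)) \<and>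
    (\<forall>M0\<in>\<Gamma>0. \<not> has_eigenvalue (matrix_inv M0 ** matrix_inv B ** \<delta> M0 ** B) 1 \<longrightarrow>
       TB' = {gmat \<delta> u v (mat 1) | u v. True} \<and> \<Delta>' = carrier \<Gamma>) \<and>
    (\<Theta> \<lhd> \<Gamma> \<and> \<Theta> \<subseteq> H) \<and>
    (\<exists>V. greatest_subspace (\<lambda>v. \<forall>M\<in>\<Gamma>0. \<delta> M *v v = (A ** M ** matrix_inv A) *v v) V \<and>
       \<Theta> = {gmat \<delta> v (A *v v) (mat 1) | v. A *v v \<in> V}) \<and>
    (generate \<Gamma> \<Xi> = \<Delta>') \<and>
    (\<exists>h \<in> iso ((\<Gamma>\<lparr>carrier := \<Delta>'\<rparr>) Mod (\<Theta> \<inter> \<Delta>'))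
               ((BijGroup (carrier L))\<lparr>carrier := left_mult_group L\<rparr>).
       (\<forall>x\<in>\<Delta>'. h ((\<Theta> \<inter> \<Delta>') #>\<^bsub>\<Gamma>\<^esub> x) = (\<lambda>X\<in>carrier L. x <#\<^bsub>\<Gamma>\<^esub> X)) \<and>
       h ` carrier ((\<Gamma>\<lparr>carrier := H \<inter> \<Delta>'\<rparr>) Mod (\<Theta> \<inter> \<Delta>')) =
         {f \<in> left_mult_group L. f \<one>\<^bsub>L\<^esub> = \<one>\<^bsub>L\<^esub>}) \<and>
    (\<not> group L \<longrightarrow> \<not> left_inverse_property L \<and> \<not> right_inverse_property L) \<and>
    (\<forall>T. topological_field T \<longrightarrow> topological_loop L (coset_topology T \<Gamma>0 \<delta> A)) \<and>
    (\<forall>(\<Gamma>r :: (real^'n^'n) set) \<delta>r Ar Br. loop_data \<Gamma>r \<delta>r Ar Br \<longrightarrow>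
       (\<exists>X (d::nat) \<A>. matrix_Lie_structure self_coord \<Gamma>r \<delta>r X {..<d} \<A>) \<and>
       (\<forall>X (d::nat) \<A>. matrix_Lie_structure self_coord \<Gamma>r \<delta>r X {..<d} \<A> \<longrightarrow>
          analytic_L_Xi self_coord \<Gamma>r \<delta>r Ar Br X {..<d} \<A>)) \<and>
    (\<forall>(\<Gamma>c :: (complex^'n^'n) set) \<delta>c Ac Bc. loop_data \<Gamma>c \<delta>c Ac Bc \<longrightarrow>
       (\<exists>X (d::nat) \<A>. matrix_Lie_structure Re_Im_coord \<Gamma>c \<delta>c X {..<d} \<A>) \<and>
       (\<forall>X (d::nat) \<A>. matrix_Lie_structure Re_Im_coord \<Gamma>c \<delta>c X {..<d} \<A> \<longrightarrow>
          analytic_L_Xi Re_Im_coord \<Gamma>c \<delta>c Ac Bc X {..<d} \<A>) \<and>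
       (\<forall>X (d::nat) \<A>. matrix_Lie_structure self_coord \<Gamma>c \<delta>c X {..<d} \<A> \<longrightarrow>
          analytic_L_Xi self_coord \<Gamma>c \<delta>c Ac Bc X {..<d} \<A>))"
proof -
  interpret loop_setup \<Gamma>0 \<delta> A B by unfold_locales (rule data)
  have sigma: "\<forall>v. \<forall>M\<in>\<Gamma>0. invertible (B ** M - \<delta> M ** A) \<and>
      sigma \<Gamma>0 \<delta> A B (gmat \<delta> 0 v M <#\<^bsub>Gam \<Gamma>0 \<delta>\<^esub> graph_group \<delta> A) =
        gmat \<delta> ((M ** matrix_inv (B ** M - \<delta> M ** A)) *v v)
               ((B ** M ** matrix_inv (B ** M - \<delta> M ** A)) *v v) M"
    using BM_inv sigma_q_value by (simp add: q_def sigma_value_def)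
  have iso: "L_Xi \<Gamma>0 \<delta> A B \<cong> twisted_product \<Gamma>0 \<delta> A B"
    unfolding is_iso_def using iso_P_to_L by blast
  have psi: "\<forall>M1\<in>\<Gamma>0. \<forall>M2\<in>\<Gamma>0. invertible (B - \<delta> (M1 ** M2) ** A ** matrix_inv (M1 ** M2)) \<and>
      invertible (psi \<delta> A B M1 M2)"
    using C_invertible psi_invertible \<Gamma>0_mult unfolding C_def by blast
  let ?L = "L_Xi \<Gamma>0 \<delta> A B" and ?\<Gamma> = "Gam \<Gamma>0 \<delta>"
  let ?TB' = "normal_closure ?\<Gamma> (graph_group \<delta> B)" and ?\<Theta> = "normal_core ?\<Gamma> (graph_group \<delta> A)"
  let ?\<Delta>' = "?TB' <#>\<^bsub>?\<Gamma>\<^esub> Gam0' \<Gamma>0 \<delta>"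
  let ?conj = "{matrix_inv M ** matrix_inv B ** \<delta> M | M. M \<in> \<Gamma>0} = {matrix_inv B}"
  have "?conj \<longrightarrow> group ?L"
    unfolding conjugates_eq_iff using TB_normal_imp_group by blast
  moreover have "?\<Theta> \<inter> ?\<Delta>' = {\<one>\<^bsub>?\<Gamma>\<^esub>} \<longrightarrow> (group ?L \<longleftrightarrow> ?conj)"
    unfolding conjugates_eq_iff using TB_normal_imp_group group_imp_TB_normal by blast
  moreover have "\<forall>M0\<in>\<Gamma>0. \<not> has_eigenvalue (matrix_inv M0 ** matrix_inv B ** \<delta> M0 ** B) 1 \<longrightarrow>
      ?TB' = {gmat \<delta> u v (mat 1) | u v. True} \<and> ?\<Delta>' = carrier ?\<Gamma>"
    using no_eigenvalue_Delta' by blast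
  moreover have "\<not> group ?L \<longrightarrow> \<not> left_inverse_property ?L \<and> \<not> right_inverse_property ?L"
    using not_group_no_inverse_property by blast
  moreover have "\<forall>T. topological_field T \<longrightarrow> topological_loop ?L (coset_topology T \<Gamma>0 \<delta> A)"
    using topological_loop_L by blast
  moreover have "\<forall>(\<Gamma>r :: (real^'n^'n) set) \<delta>r Ar Br. loop_data \<Gamma>r \<delta>r Ar Br \<longrightarrow>
       (\<exists>X (d::nat) \<A>. matrix_Lie_structure self_coord \<Gamma>r \<delta>r X {..<d} \<A>) \<and>
       (\<forall>X (d::nat) \<A>. matrix_Lie_structure self_coord \<Gamma>r \<delta>r X {..<d} \<A> \<longrightarrow>
          analytic_L_Xi self_coord \<Gamma>r \<delta>r Ar Br X {..<d} \<A>)"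
    by (intro allI impI conjI loop_data_Lie_structure analytic_L_self_coord)
  moreover have "\<forall>(\<Gamma>c :: (complex^'n^'n) set) \<delta>c Ac Bc. loop_data \<Gamma>c \<delta>c Ac Bc \<longrightarrow>
       (\<exists>X (d::nat) \<A>. matrix_Lie_structure Re_Im_coord \<Gamma>c \<delta>c X {..<d} \<A>) \<and>
       (\<forall>X (d::nat) \<A>. matrix_Lie_structure Re_Im_coord \<Gamma>c \<delta>c X {..<d} \<A> \<longrightarrow>
          analytic_L_Xi Re_Im_coord \<Gamma>c \<delta>c Ac Bc X {..<d} \<A>) \<and>
       (\<forall>X (d::nat) \<A>. matrix_Lie_structure self_coord \<Gamma>c \<delta>c X {..<d} \<A> \<longrightarrow>
          analytic_L_Xi self_coord \<Gamma>c \<delta>c Ac Bc X {..<d} \<A>)"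
    by (intro allI impI conjI loop_data_Lie_structure analytic_L_self_coord analytic_L_Re_Im_coord)
  ultimately show ?thesis
    unfolding \<Gamma>_def H_def TB_def \<Xi>_def \<sigma>_def L_def P_def TB'_def \<Delta>'_def \<Theta>_def
    by (intro conjI sigma transitive_section_sigma sigma_image sharply_transitive_Delta'
        sharply_transitive_Gamma_iff loop_L iso semidirect_P iso_vectors iso_matrices psi
        conjugates_eq_iff group_iff_TB_Theta_normal TB'_normal subgroup_Delta' semidirect_Delta'
        Theta_normal Theta_subset Theta_subspace generate_Xi left_mult_group_iso)
qed

end
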